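(* Let $\mathcal C$ be a braided monoidal category with unit object $\underline 1$ and braiding $\Psi$, and let $H=(H,\mu_r,1_r,\Delta_g,\epsilon_g,S)$ be a Hopf algebra in $\mathcal C$ with invertible antipode $S$. Suppose there are a morphism $\Lambda:\underline 1\to H$ which is a left integral and a morphism $\int:H\to\underline 1$ which is a right integral, such that $\int\circ\Lambda=\mathrm{id}_{\underline 1}$. Then there exist a structure of Frobenius algebra on $(H,\mu_r,1_r)$ and a structure of Frobenius coalgebra on $(H,\Delta_g,\epsilon_g)$ in $\mathcal C$ such that the antipode $S$ has the special form $$S=(\cup_g\otimes\mathrm{id})(\mathrm{id}\otimes g_r),$$ where $g_r$ is the metric of the Frobenius algebra and $\cup_g$ the bilinear form of the Frobenius coalgebra. Consequently $H$ extends to a braided F-Hopf algebra: with $\mu_g,1_g,\Delta_r,\epsilon_r$ the associated structures, $(\mu_r,1_r,\Delta_r,\epsilon_r)$ and $(\mu_g,1_g,\Delta_g,\epsilon_g)$ are F-algebras on $H$, and $(\mu_r,1_r,\Delta_g,\epsilon_g)$ and $(\mu_g\circ\Psi,1_g,\Delta_r,\epsilon_r)$ are a pair of Hopf algebras in $\mathcal C$ on the same object $H$, the second of which is isomorphic to $H^\star$.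
   Context: Associators and unit constraints are suppressed. A Hopf algebra in $\mathcal C$ (braided Hopf algebra) is an object $H$ with an algebra $(\mu,1)$, a coalgebra $(\Delta,\epsilon)$ and antipode $S$, all morphisms in $\mathcal C$, such that $\Delta\mu=(\mu\otimes\mu)(\mathrm{id}\otimes\Psi\otimes\mathrm{id})(\Delta\otimes\Delta)$, $\Delta 1=1\otimes1$, $\epsilon\mu=\epsilon\otimes\epsilon$, $\epsilon 1=\mathrm{id}_{\underline 1}$ and $\mu(S\otimes\mathrm{id})\Delta=1\epsilon=\mu(\mathrm{id}\otimes S)\Delta$. Left integral: $\mu_r(\mathrm{id}\otimes\Lambda)=\Lambda\circ\epsilon_g$. Right integral: $(\int\otimes\mathrm{id})\Delta_g=1_r\circ\int$. A Frobenius algebra in $\mathcal C$ is an algebra $(H,\mu_r,1_r)$ with morphisms $\cup_r:H\otimes H\to\underline 1$ and $g_r:\underline 1\to H\otimes H$ such that $\cup_r(\mu_r\otimes\mathrm{id})=\cup_r(\mathrm{id}\otimes\mu_r)$ and $(\cup_r\otimes\mathrm{id})(\mathrm{id}\otimes g_r)=\mathrm{id}=(\mathrm{id}\otimes\cup_r)(g_r\otimes\mathrm{id})$; $g_r$ is called the metric. A Frobenius coalgebra is a coalgebra $(H,\Delta_g,\epsilon_g)$ with mutually inverse (in the same sense) morphisms $\cup_g:H\otimes H\to\underline 1$, $g_g:\underline 1\to H\otimes H$ such that $(\Delta_g\otimes\mathrm{id})g_g=(\mathrm{id}\otimes\Delta_g)g_g$. Associated structures: $\Delta_r=(\mathrm{id}\otimes\mu_r)(g_r\otimes\mathrm{id})=(\mu_r\otimes\mathrm{id})(\mathrm{id}\otimes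 g_r)$, $\epsilon_r=\cup_r(\mathrm{id}\otimes 1_r)$, $\mu_g=(\mathrm{id}\otimes\cup_g)(\Delta_g\otimes\mathrm{id})=(\cup_g\otimes\mathrm{id})(\mathrm{id}\otimes\Delta_g)$, $1_g=(\mathrm{id}\otimes\epsilon_g)g_g$. An F-algebra is an algebra $(\mu,1)$ and coalgebra $(\Delta,\epsilon)$ on the same object with $(\mathrm{id}\otimes\mu)(\Delta\otimes\mathrm{id})=\Delta\mu=(\mu\otimes\mathrm{id})(\mathrm{id}\otimes\Delta)$. $H^\star$ denotes the categorical dual of $H$, with structure morphisms the adjoints of those of $H$ taken with nested evaluations/coevaluations (no braid crossings), which is again a Hopf algebra in $\mathcal C$. *)

theory Defs
  imports Main
begin

section \<open>Braided monoidal categories\<close>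

text \<open>
  Categories are given by a set of objects and a set of arrows with domain and codomain;
  the operations are only constrained on actual objects and composable arrows.
  No strictness is assumed: associativity and unit constraints are explicit everywhere below.
\<close>

record ('o, 'a) category_data =
  Obj :: "'o set"
  Arr :: "'a set"
  Dom :: "'a \<Rightarrow> 'o"
  Cod :: "'a \<Rightarrow> 'o"
  Id :: "'o \<Rightarrow> 'a"
  Comp :: "'a \<Rightarrow> 'a \<Rightarrow> 'a" (infixr "\<cdot>\<index>" 60)

record ('o, 'a) monoidal_data = "('o, 'a) category_data" +
  unit_obj :: "'o" ("\<one>\<index>")
  tensor_obj :: "'o \<Rightarrow> 'o \<Rightarrow> 'o" (infixr "\<boxtimes>\<index>" 70)
  tensor :: "'a \<Rightarrow> 'a \<Rightarrow> 'a" (infixr "\<otimes>\<index>" 70)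
  assoc :: "'o \<Rightarrow> 'o \<Rightarrow> 'o \<Rightarrow> 'a"  \<comment> \<open>\<open>(X \<boxtimes> Y) \<boxtimes> Z \<rightarrow> X \<boxtimes> (Y \<boxtimes> Z)\<close>\<close>
  lunit :: "'o \<Rightarrow> 'a"              \<comment> \<open>\<open>\<one> \<boxtimes> X \<rightarrow> X\<close>\<close>
  runit :: "'o \<Rightarrow> 'a"              \<comment> \<open>\<open>X \<boxtimes> \<one> \<rightarrow> X\<close>\<close>

record ('o, 'a) braided_data = "('o, 'a) monoidal_data" +
  braid :: "'o \<Rightarrow> 'o \<Rightarrow> 'a"        \<comment> \<open>\<open>X \<boxtimes> Y \<rightarrow> Y \<boxtimes> X\<close>\<close>

definition hom :: "('o, 'a, 'x) category_data_scheme \<Rightarrow> 'o \<Rightarrow> 'o \<Rightarrow> 'a set" where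
  "hom C X Y = {f \<in> Arr C. Dom C f = X \<and> Cod C f = Y}"

definition inverse_arrows :: "('o, 'a, 'x) category_data_scheme \<Rightarrow> 'a \<Rightarrow> 'a \<Rightarrow> bool" where
  "inverse_arrows C f g \<longleftrightarrow>
     f \<in> hom C (Dom C f) (Cod C f) \<and> g \<in> hom C (Cod C f) (Dom C f) \<and>
     g \<cdot>\<^bsub>C\<^esub> f = Id C (Dom C f) \<and> f \<cdot>\<^bsub>C\<^esub> g = Id C (Cod C f)"

definition is_iso :: "('o, 'a, 'x) category_data_scheme \<Rightarrow> 'a \<Rightarrow> bool" where
  "is_iso C f \<longleftrightarrow> (\<exists>g. inverse_arrows C f g)"

text \<open>Only meaningful if \<open>f\<close> is an isomorphism.\<close>

definition cinv :: "('o, 'a, 'x) category_data_scheme \<Rightarrow> 'a \<Rightarrow> 'a" where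
  "cinv C f = (THE g. inverse_arrows C f g)"

locale category =
  fixes C :: "('o, 'a, 'x) category_data_scheme" (structure)
  assumes Dom_Obj: "f \<in> Arr C \<Longrightarrow> Dom C f \<in> Obj C"
    and Cod_Obj: "f \<in> Arr C \<Longrightarrow> Cod C f \<in> Obj C"
    and Id_hom: "X \<in> Obj C \<Longrightarrow> Id C X \<in> hom C X X"
    and Comp_hom: "f \<in> hom C X Y \<Longrightarrow> g \<in> hom C Y Z \<Longrightarrow> g \<cdot> f \<in> hom C X Z"
    and Comp_Id: "f \<in> hom C X Y \<Longrightarrow> f \<cdot> Id C X = f"
    and Id_Comp: "f \<in> hom C X Y \<Longrightarrow> Id C Y \<cdot> f = f"
    and Comp_assoc: "f \<in> hom C W X \<Longrightarrow> g \<in> hom C X Y \<Longrightarrow> h \<in> hom C Y Z \<Longrightarrow>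
           (h \<cdot> g) \<cdot> f = h \<cdot> (g \<cdot> f)"

locale monoidal_category = category C
  for C :: "('o, 'a, 'x) monoidal_data_scheme" (structure) +
  assumes unit_Obj: "\<one> \<in> Obj C"
    and tensor_Obj: "X \<in> Obj C \<Longrightarrow> Y \<in> Obj C \<Longrightarrow> X \<boxtimes> Y \<in> Obj C"
    and tensor_hom: "f \<in> hom C X Y \<Longrightarrow> f' \<in> hom C X' Y' \<Longrightarrow>
           f \<otimes> f' \<in> hom C (X \<boxtimes> X') (Y \<boxtimes> Y')"
    and tensor_Id: "X \<in> Obj C \<Longrightarrow> Y \<in> Obj C \<Longrightarrow> Id C X \<otimes> Id C Y = Id C (X \<boxtimes> Y)"
    and tensor_Comp: "f \<in> hom C X Y \<Longrightarrow> g \<in> hom C Y Z \<Longrightarrow>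
           f' \<in> hom C X' Y' \<Longrightarrow> g' \<in> hom C Y' Z' \<Longrightarrow>
           (g \<cdot> f) \<otimes> (g' \<cdot> f') = (g \<otimes> g') \<cdot> (f \<otimes> f')"
    and assoc_hom: "X \<in> Obj C \<Longrightarrow> Y \<in> Obj C \<Longrightarrow> Z \<in> Obj C \<Longrightarrow>
           assoc C X Y Z \<in> hom C ((X \<boxtimes> Y) \<boxtimes> Z) (X \<boxtimes> (Y \<boxtimes> Z))"
    and assoc_iso: "X \<in> Obj C \<Longrightarrow> Y \<in> Obj C \<Longrightarrow> Z \<in> Obj C \<Longrightarrow> is_iso C (assoc C X Y Z)"
    and assoc_natural: "f \<in> hom C X X' \<Longrightarrow> g \<in> hom C Y Y' \<Longrightarrow> h \<in> hom C Z Z' \<Longrightarrow>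
           assoc C X' Y' Z' \<cdot> ((f \<otimes> g) \<otimes> h) = (f \<otimes> (g \<otimes> h)) \<cdot> assoc C X Y Z"
    and lunit_hom: "X \<in> Obj C \<Longrightarrow> lunit C X \<in> hom C (\<one> \<boxtimes> X) X"
    and lunit_iso: "X \<in> Obj C \<Longrightarrow> is_iso C (lunit C X)"
    and lunit_natural: "f \<in> hom C X Y \<Longrightarrow> lunit C Y \<cdot> (Id C \<one> \<otimes> f) = f \<cdot> lunit C X"
    and runit_hom: "X \<in> Obj C \<Longrightarrow> runit C X \<in> hom C (X \<boxtimes> \<one>) X"
    and runit_iso: "X \<in> Obj C \<Longrightarrow> is_iso C (runit C X)"
    and runit_natural: "f \<in> hom C X Y \<Longrightarrow> runit C Y \<cdot> (f \<otimes> Id C \<one>) = f \<cdot> runit C X"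
    and pentagon: "W \<in> Obj C \<Longrightarrow> X \<in> Obj C \<Longrightarrow> Y \<in> Obj C \<Longrightarrow> Z \<in> Obj C \<Longrightarrow>
           (Id C W \<otimes> assoc C X Y Z) \<cdot> assoc C W (X \<boxtimes> Y) Z \<cdot> (assoc C W X Y \<otimes> Id C Z) =
           assoc C W X (Y \<boxtimes> Z) \<cdot> assoc C (W \<boxtimes> X) Y Z"
    and triangle: "X \<in> Obj C \<Longrightarrow> Y \<in> Obj C \<Longrightarrow>
           (Id C X \<otimes> lunit C Y) \<cdot> assoc C X \<one> Y = runit C X \<otimes> Id C Y"

locale braided_monoidal_category = monoidal_category C
  for C :: "('o, 'a, 'x) braided_data_scheme" (structure) +
  assumes braid_hom: "X \<in> Obj C \<Longrightarrow> Y \<in> Obj C \<Longrightarrow> braid C X Y \<in> hom C (X \<boxtimes> Y) (Y \<boxtimes> X)"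
    and braid_iso: "X \<in> Obj C \<Longrightarrow> Y \<in> Obj C \<Longrightarrow> is_iso C (braid C X Y)"
    and braid_natural: "f \<in> hom C X X' \<Longrightarrow> g \<in> hom C Y Y' \<Longrightarrow>
           braid C X' Y' \<cdot> (f \<otimes> g) = (g \<otimes> f) \<cdot> braid C X Y"
    and hexagon: "X \<in> Obj C \<Longrightarrow> Y \<in> Obj C \<Longrightarrow> Z \<in> Obj C \<Longrightarrow>
           assoc C Y Z X \<cdot> braid C X (Y \<boxtimes> Z) \<cdot> assoc C X Y Z =
           (Id C Y \<otimes> braid C X Z) \<cdot> assoc C Y X Z \<cdot> (braid C X Y \<otimes> Id C Z)"
    and hexagon_inv: "X \<in> Obj C \<Longrightarrow> Y \<in> Obj C \<Longrightarrow> Z \<in> Obj C \<Longrightarrow>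
           cinv C (assoc C Z X Y) \<cdot> braid C (X \<boxtimes> Y) Z \<cdot> cinv C (assoc C X Y Z) =
           (braid C X Z \<otimes> Id C Y) \<cdot> cinv C (assoc C X Z Y) \<cdot> (Id C X \<otimes> braid C Y Z)"


section \<open>Algebras, coalgebras and duals\<close>

context
  fixes C :: "('o, 'a, 'x) monoidal_data_scheme" (structure)
begin

definition algebra :: "'o \<Rightarrow> 'a \<Rightarrow> 'a \<Rightarrow> bool" where
  "algebra H \<mu> \<eta> \<longleftrightarrow>
     H \<in> Obj C \<and> \<mu> \<in> hom C (H \<boxtimes> H) H \<and> \<eta> \<in> hom C \<one> H \<and>
     \<mu> \<cdot> (\<mu> \<otimes> Id C H) = \<mu> \<cdot> (Id C H \<otimes> \<mu>) \<cdot> assoc C H H H \<and>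
     \<mu> \<cdot> (\<eta> \<otimes> Id C H) = lunit C H \<and>
     \<mu> \<cdot> (Id C H \<otimes> \<eta>) = runit C H"

definition coalgebra :: "'o \<Rightarrow> 'a \<Rightarrow> 'a \<Rightarrow> bool" where
  "coalgebra H \<Delta> \<epsilon> \<longleftrightarrow>
     H \<in> Obj C \<and> \<Delta> \<in> hom C H (H \<boxtimes> H) \<and> \<epsilon> \<in> hom C H \<one> \<and>
     assoc C H H H \<cdot> (\<Delta> \<otimes> Id C H) \<cdot> \<Delta> = (Id C H \<otimes> \<Delta>) \<cdot> \<Delta> \<and>
     lunit C H \<cdot> (\<epsilon> \<otimes> Id C H) \<cdot> \<Delta> = Id C H \<and>
     runit C H \<cdot> (Id C H \<otimes> \<epsilon>) \<cdot> \<Delta> = Id C H"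

text \<open>
  \<open>D\<close> is a left dual of \<open>X\<close>, with \<open>ev : D \<boxtimes> X \<rightarrow> \<one>\<close> and \<open>coev : \<one> \<rightarrow> X \<boxtimes> D\<close>.
  For \<open>D = X\<close> this says that \<open>ev\<close> and \<open>coev\<close> are mutually inverse in the sense used for
  Frobenius structures.
\<close>

definition dual_pairing :: "'o \<Rightarrow> 'o \<Rightarrow> 'a \<Rightarrow> 'a \<Rightarrow> bool" where
  "dual_pairing X D ev coev \<longleftrightarrow>
     X \<in> Obj C \<and> D \<in> Obj C \<and> ev \<in> hom C (D \<boxtimes> X) \<one> \<and> coev \<in> hom C \<one> (X \<boxtimes> D) \<and>
     lunit C D \<cdot> (ev \<otimes> Id C D) \<cdot> cinv C (assoc C D X D) \<cdot> (Id C D \<otimes> coev)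
       \<cdot> cinv C (runit C D) = Id C D \<and>
     runit C X \<cdot> (Id C X \<otimes> ev) \<cdot> assoc C X D X \<cdot> (coev \<otimes> Id C X)
       \<cdot> cinv C (lunit C X) = Id C X"

definition frobenius_algebra :: "'o \<Rightarrow> 'a \<Rightarrow> 'a \<Rightarrow> 'a \<Rightarrow> 'a \<Rightarrow> bool" where
  "frobenius_algebra H \<mu> \<eta> cup g \<longleftrightarrow>
     algebra H \<mu> \<eta> \<and> dual_pairing H H cup g \<and>
     cup \<cdot> (\<mu> \<otimes> Id C H) = cup \<cdot> (Id C H \<otimes> \<mu>) \<cdot> assoc C H H H"

definition frobenius_coalgebra :: "'o \<Rightarrow> 'a \<Rightarrow> 'a \<Rightarrow> 'a \<Rightarrow> 'a \<Rightarrow> bool" where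
  "frobenius_coalgebra H \<Delta> \<epsilon> cup g \<longleftrightarrow>
     coalgebra H \<Delta> \<epsilon> \<and> dual_pairing H H cup g \<and>
     assoc C H H H \<cdot> (\<Delta> \<otimes> Id C H) \<cdot> g = (Id C H \<otimes> \<Delta>) \<cdot> g"

text \<open>
  The coalgebra structure associated to a Frobenius algebra and the algebra structure associated
  to a Frobenius coalgebra.
\<close>

definition frobenius_comult :: "'o \<Rightarrow> 'a \<Rightarrow> 'a \<Rightarrow> 'a" where
  "frobenius_comult H \<mu> g = (Id C H \<otimes> \<mu>) \<cdot> assoc C H H H \<cdot> (g \<otimes> Id C H) \<cdot> cinv C (lunit C H)"

definition frobenius_counit :: "'o \<Rightarrow> 'a \<Rightarrow> 'a \<Rightarrow> 'a" where
  "frobenius_counit H \<eta> cup = cup \<cdot> (Id C H \<otimes> \<eta>) \<cdot> cinv C (runit C H)"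

definition frobenius_mult :: "'o \<Rightarrow> 'a \<Rightarrow> 'a \<Rightarrow> 'a" where
  "frobenius_mult H \<Delta> cup = runit C H \<cdot> (Id C H \<otimes> cup) \<cdot> assoc C H H H \<cdot> (\<Delta> \<otimes> Id C H)"

definition frobenius_unit :: "'o \<Rightarrow> 'a \<Rightarrow> 'a \<Rightarrow> 'a" where
  "frobenius_unit H \<epsilon> g = runit C H \<cdot> (Id C H \<otimes> \<epsilon>) \<cdot> g"

definition F_algebra :: "'o \<Rightarrow> 'a \<Rightarrow> 'a \<Rightarrow> 'a \<Rightarrow> 'a \<Rightarrow> bool" where
  "F_algebra H \<mu> \<eta> \<Delta> \<epsilon> \<longleftrightarrow>
     algebra H \<mu> \<eta> \<and> coalgebra H \<Delta> \<epsilon> \<and>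
     (Id C H \<otimes> \<mu>) \<cdot> assoc C H H H \<cdot> (\<Delta> \<otimes> Id C H) = \<Delta> \<cdot> \<mu> \<and>
     \<Delta> \<cdot> \<mu> = (\<mu> \<otimes> Id C H) \<cdot> cinv C (assoc C H H H) \<cdot> (Id C H \<otimes> \<Delta>)"

text \<open>
  The adjoint \<open>DY \<rightarrow> DX\<close> of \<open>f : X \<rightarrow> Y\<close>, where \<open>coevX : \<one> \<rightarrow> X \<boxtimes> DX\<close> and
  \<open>evY : DY \<boxtimes> Y \<rightarrow> \<one>\<close>.
\<close>

definition adjoint :: "'o \<Rightarrow> 'o \<Rightarrow> 'a \<Rightarrow> 'o \<Rightarrow> 'a \<Rightarrow> 'a \<Rightarrow> 'a" where
  "adjoint X DX coevX DY evY f =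
     lunit C DX \<cdot> (evY \<otimes> Id C DX) \<cdot> ((Id C DY \<otimes> f) \<otimes> Id C DX)
       \<cdot> cinv C (assoc C DY X DX) \<cdot> (Id C DY \<otimes> coevX) \<cdot> cinv C (runit C DY)"

text \<open>
  The nested pairing \<open>ev (id \<otimes> ev \<otimes> id) : (D \<boxtimes> D) \<boxtimes> (X \<boxtimes> X) \<rightarrow> \<one>\<close> and copairing
  \<open>(id \<otimes> coev \<otimes> id) coev : \<one> \<rightarrow> (X \<boxtimes> X) \<boxtimes> (D \<boxtimes> D)\<close>, making \<open>D \<boxtimes> D\<close> a dual of \<open>X \<boxtimes> X\<close>.
\<close>

definition nested_ev :: "'o \<Rightarrow> 'o \<Rightarrow> 'a \<Rightarrow> 'a" where
  "nested_ev X D ev =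
     ev \<cdot> (Id C D \<otimes> lunit C X) \<cdot> (Id C D \<otimes> (ev \<otimes> Id C X))
       \<cdot> (Id C D \<otimes> cinv C (assoc C D X X)) \<cdot> assoc C D D (X \<boxtimes> X)"

definition nested_coev :: "'o \<Rightarrow> 'o \<Rightarrow> 'a \<Rightarrow> 'a" where
  "nested_coev X D coev =
     cinv C (assoc C X X (D \<boxtimes> D)) \<cdot> (Id C X \<otimes> assoc C X D D)
       \<cdot> (Id C X \<otimes> (coev \<otimes> Id C D)) \<cdot> (Id C X \<otimes> cinv C (lunit C D)) \<cdot> coev"

end


section \<open>Hopf algebras\<close>

record ('o, 'a) hopf_data =
  hobj :: "'o"
  hmult :: "'a"
  hunit :: "'a"
  hcomult :: "'a"
  hcounit :: "'a"
  hantipode :: "'a"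

context
  fixes C :: "('o, 'a, 'x) braided_data_scheme" (structure)
begin

definition middle_braid :: "'o \<Rightarrow> 'a"  \<comment> \<open>\<open>id \<otimes> \<Psi> \<otimes> id\<close> on \<open>(H \<boxtimes> H) \<boxtimes> (H \<boxtimes> H)\<close>\<close> where
  "middle_braid H =
     cinv C (assoc C H H (H \<boxtimes> H)) \<cdot> (Id C H \<otimes> assoc C H H H)
       \<cdot> (Id C H \<otimes> (braid C H H \<otimes> Id C H))
       \<cdot> (Id C H \<otimes> cinv C (assoc C H H H)) \<cdot> assoc C H H (H \<boxtimes> H)"

definition hopf_algebra :: "('o, 'a) hopf_data \<Rightarrow> bool" where
  "hopf_algebra K \<longleftrightarrow>
     (let H = hobj K; \<mu> = hmult K; \<eta> = hunit K; \<Delta> = hcomult K; \<epsilon> = hcounit K; S = hantipode K in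
      algebra C H \<mu> \<eta> \<and> coalgebra C H \<Delta> \<epsilon> \<and> S \<in> hom C H H \<and>
      \<Delta> \<cdot> \<mu> = (\<mu> \<otimes> \<mu>) \<cdot> middle_braid H \<cdot> (\<Delta> \<otimes> \<Delta>) \<and>
      \<Delta> \<cdot> \<eta> = (\<eta> \<otimes> \<eta>) \<cdot> cinv C (lunit C \<one>) \<and>
      \<epsilon> \<cdot> \<mu> = lunit C \<one> \<cdot> (\<epsilon> \<otimes> \<epsilon>) \<and>
      \<epsilon> \<cdot> \<eta> = Id C \<one> \<and>
      \<mu> \<cdot> (S \<otimes> Id C H) \<cdot> \<Delta> = \<eta> \<cdot> \<epsilon> \<and>
      \<mu> \<cdot> (Id C H \<otimes> S) \<cdot> \<Delta> = \<eta> \<cdot> \<epsilon>)"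

definition left_integral :: "('o, 'a) hopf_data \<Rightarrow> 'a \<Rightarrow> bool" where
  "left_integral K \<Lambda> \<longleftrightarrow>
     \<Lambda> \<in> hom C \<one> (hobj K) \<and>
     hmult K \<cdot> (Id C (hobj K) \<otimes> \<Lambda>) = \<Lambda> \<cdot> hcounit K \<cdot> runit C (hobj K)"

text \<open>The integral is the functional \<open>I : H \<rightarrow> \<one>\<close>, as opposed to the element \<open>\<Lambda> : \<one> \<rightarrow> H\<close> above.\<close>

definition right_integral :: "('o, 'a) hopf_data \<Rightarrow> 'a \<Rightarrow> bool" where
  "right_integral K I \<longleftrightarrow>
     I \<in> hom C (hobj K) \<one> \<and>
     lunit C (hobj K) \<cdot> (I \<otimes> Id C (hobj K)) \<cdot> hcomult K = hunit K \<cdot> I"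

text \<open>
  The Hopf algebra structure on a left dual \<open>(D, ev, coev)\<close> of the underlying object. The unit
  object is its own dual via \<open>lunit \<one>\<close>, and \<open>D \<boxtimes> D\<close> is the dual of \<open>H \<boxtimes> H\<close> by the nested
  pairing, so no braiding enters: \<open>\<langle>\<phi>\<psi>, h\<rangle> = \<langle>\<phi>, h\<^sub>2\<rangle> \<langle>\<psi>, h\<^sub>1\<rangle>\<close>.
\<close>

definition dual_hopf ::
  "('o, 'a) hopf_data \<Rightarrow> 'o \<Rightarrow> 'a \<Rightarrow> 'a \<Rightarrow> ('o, 'a) hopf_data" where
  "dual_hopf K D ev coev =
     (let H = hobj K; ev2 = nested_ev C H D ev; coev2 = nested_coev C H D coev in
      \<lparr> hobj = D,
        hmult = adjoint C H D coev (D \<boxtimes> D) ev2 (hcomult K),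
        hunit = adjoint C H D coev \<one> (lunit C \<one>) (hcounit K),
        hcomult = adjoint C (H \<boxtimes> H) (D \<boxtimes> D) coev2 D ev (hmult K),
        hcounit = adjoint C \<one> \<one> (cinv C (lunit C \<one>)) D ev (hunit K),
        hantipode = adjoint C H D coev D ev (hantipode K) \<rparr>)"

definition hopf_isomorphic :: "('o, 'a) hopf_data \<Rightarrow> ('o, 'a) hopf_data \<Rightarrow> bool" where
  "hopf_isomorphic K L \<longleftrightarrow>
     (\<exists>\<theta> \<in> hom C (hobj K) (hobj L). is_iso C \<theta> \<and>
        \<theta> \<cdot> hmult K = hmult L \<cdot> (\<theta> \<otimes> \<theta>) \<and> \<theta> \<cdot> hunit K = hunit L \<and>
        hcomult L \<cdot> \<theta> = (\<theta> \<otimes> \<theta>) \<cdot> hcomult K \<and> hcounit L \<cdot> \<theta> = hcounit K \<and>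
        \<theta> \<cdot> hantipode K = hantipode L \<cdot> \<theta>)"

end

end

theory Submission
  imports Defs
begin

text \<open>
  Put \<open>cup\<^sub>r = I \<cdot> \<mu>\<^sub>r\<close>, \<open>g\<^sub>r = (id \<otimes> S) \<cdot> \<Delta>\<^sub>g \<cdot> \<Lambda>\<close>, \<open>g\<^sub>g = \<Delta>\<^sub>g \<cdot> \<Lambda>\<close> and \<open>cup\<^sub>g = cup\<^sub>r \<cdot> (S \<otimes> id)\<close>. Since \<open>\<Lambda>\<close> is a left
  integral and \<open>S\<close> is invertible and antimultiplicative, \<open>g\<^sub>r\<close> is central: \<open>h g\<^sup>1 \<otimes> g\<^sup>2 = g\<^sup>1 \<otimes> g\<^sup>2 h\<close>. This and
  the fact that \<open>I \<cdot> S\<close> is a left integral reduce both zigzag identities to \<open>I \<cdot> \<Lambda> = 1\<close>, and the formula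
  for \<open>S\<close> is one of them. The F-algebra laws follow formally. The second Hopf algebra is the dual of
  \<open>H\<close> along the pairing \<open>a \<otimes> h \<mapsto> I(S\<^sup>2(h) a)\<close> of \<open>H\<close> with itself (composed with the braiding), hence it
  is a Hopf algebra, and it is isomorphic to the dual along any other left dual of the object.

  All identities are equalities of string diagrams. The category is not strict, so an arrow between
  bracketed tensor products is replaced by a natural family of arrows indexed by an arbitrary object
  \<open>R\<close> tensored on the right; composition of such families is strictly associative.
\<close>

section \<open>Diagrams as words\<close>

text \<open>The antipode is put into the metric \<open>g\<^sub>r\<close> and the form
  \<open>cup\<^sub>g\<close>, and kept out of \<open>cup\<^sub>r\<close> and
  \<open>g\<^sub>g\<close>, so that both Frobenius structures have the same second zigzag word; the
  first one for the coalgebra follows from that for the algebra by cancelling \<open>S\<close>. The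
  scalar \<open>I \<cdot> S \<cdot> \<Lambda>\<close> met in the shared zigzag is not fixed by the
  hypotheses and has to be computed.

  The obstacle is the second Hopf algebra. Every product in its bialgebra law hides a braiding,
  besides the one in the middle of the law. These laws are never checked directly: they are verified
  for the dual along an abstract pairing, where only one crossing has to be transported, and
  afterwards four structure arrows are compared with the dual along a concrete pairing. No antipode
  is prescribed for the second structure, so the one of the dual is taken. The comparison is
  feasible because the pairing also has a form without crossings, I(S(S^-1(a) S(h))), whose outer
  functional I S is a left integral.\<close>

datatype color = Hc | Dc | Ec

text \<open>Domains of arrows depend on brackets and unit objects, so these are recorded in trees;
  \<open>flat\<close> keeps only the strands. The colour \<open>Hc\<close> stands for the Hopf
  algebra, \<open>Dc\<close> and \<open>Ec\<close> for two left duals of it, which must coexist in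
  one diagram to be compared.\<close>

datatype tree = Leaf color | Unit | Node tree tree (infixr "\<diamondop>" 65)

fun flat :: "tree \<Rightarrow> color list" where
  "flat (Leaf c) = [c]"
| "flat Unit = []"
| "flat (t \<diamondop> u) = flat t @ flat u"

text \<open>Braidings are indexed by trees and not by colours, because the hexagons and naturality
  involve crossings of composite or empty bundles. Concrete calculations only contain crossings of
  single strands.\<close>

datatype gen = Mu | Eta | Delta | Eps | Ant | Ant_inv | Lam | Itg
  | Br tree tree | Br_inv tree tree | Ev color | Coev color

fun src :: "gen \<Rightarrow> tree" where
  "src Mu = Leaf Hc \<diamondop> Leaf Hc" | "src Eta = Unit" | "src Delta = Leaf Hc" | "src Eps = Leaf Hc"
| "src Ant = Leaf Hc" | "src Ant_inv = Leaf Hc" | "src Lam = Unit" | "src Itg = Leaf Hc"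
| "src (Br t u) = t \<diamondop> u" | "src (Br_inv t u) = u \<diamondop> t"
| "src (Ev c) = Leaf c \<diamondop> Leaf Hc" | "src (Coev c) = Unit"

fun tgt :: "gen \<Rightarrow> tree" where
  "tgt Mu = Leaf Hc" | "tgt Eta = Leaf Hc" | "tgt Delta = Leaf Hc \<diamondop> Leaf Hc" | "tgt Eps = Unit"
| "tgt Ant = Leaf Hc" | "tgt Ant_inv = Leaf Hc" | "tgt Lam = Leaf Hc" | "tgt Itg = Unit"
| "tgt (Br t u) = u \<diamondop> t" | "tgt (Br_inv t u) = t \<diamondop> u"
| "tgt (Ev c) = Unit" | "tgt (Coev c) = Leaf Hc \<diamondop> Leaf c"

text \<open>
  A string diagram is a list of layers; the layer \<open>(g, i)\<close> applies \<open>g\<close> to the strands starting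
  with number \<open>i\<close>, counted from \<open>0\<close>.
\<close>

type_synonym word = "(gen \<times> nat) list"

abbreviation ins :: "gen \<Rightarrow> color list" where "ins g \<equiv> flat (src g)"
abbreviation outs :: "gen \<Rightarrow> color list" where "outs g \<equiv> flat (tgt g)"

text \<open>The result \<open>None\<close> marks an ill-typed layer. The bound on \<open>i\<close>
  is a separate test because a generator without inputs would match even beyond the last
  strand.\<close>

fun wcod :: "color list \<Rightarrow> word \<Rightarrow> color list option" where
  "wcod xs [] = Some xs"
| "wcod xs ((g, i) # p) =
     (if i \<le> length xs \<and> take (length (ins g)) (drop i xs) = ins g
      then wcod (take i xs @ outs g @ drop (i + length (ins g)) xs) p else None)"

definition shift :: "nat \<Rightarrow> word \<Rightarrow> word" where
  "shift k p = map (\<lambda>(g, i). (g, k + i)) p"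

text \<open>The layer that moves to the front must be recounted with the inputs of the other
  generator, and the one that moves back with the new outputs. Both alternatives arise at once if
  \<open>f\<close> has no outputs, \<open>g\<close> has no inputs and they sit at the same place:
  \<open>g\<close> may then pass on either side.\<close>

definition exchange :: "gen \<times> nat \<Rightarrow> gen \<times> nat \<Rightarrow> word list" where
  "exchange s t = (case s of (f, i) \<Rightarrow> case t of (g, j) \<Rightarrow>
     (if i + length (outs f) \<le> j then [[(g, j - length (outs f) + length (ins f)), (f, i)]] else []) @
     (if j + length (ins g) \<le> i then [[(g, j), (f, i - length (ins g) + length (outs g))]] else []))"

text \<open>Every returned word starts with \<open>g\<close>. There can be several, since
  \<open>g\<close> may occur repeatedly and may pass a closed end on two sides; committing to one of
  them could lose the isotopy.\<close>

fun fronts :: "gen \<Rightarrow> word \<Rightarrow> word list" where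
  "fronts g [] = []"
| "fronts g (s # p) = (if fst s = g then [s # p] else []) @
     concat (map (\<lambda>p'. case p' of [] \<Rightarrow> [] | t # p'' \<Rightarrow> map (\<lambda>st. st @ p'') (exchange s t)) (fronts g p))"

text \<open>
  A sound but incomplete test for equality up to interchange: the layers of the second word are
  brought to the front of the first one, one after the other.
\<close>

fun isotopic :: "word \<Rightarrow> word \<Rightarrow> bool" where
  "isotopic p [] = (p = [])"
| "isotopic p (s # q) =
     list_ex (\<lambda>p'. case p' of [] \<Rightarrow> False | t # p'' \<Rightarrow> t = s \<and> isotopic p'' q) (fronts (fst s) p)"

text \<open>
  Rewriting up to interchange is decided by evaluation, so that a step of a diagrammatic proof only
  has to name its rule.
\<close>

definition rewrite_step :: "color list \<Rightarrow> word \<Rightarrow> word \<Rightarrow> color list \<Rightarrow> word \<Rightarrow> word \<Rightarrow> bool" where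
  "rewrite_step ys l r xs p q \<longleftrightarrow> wcod xs p \<noteq> None \<and>
     list_ex (\<lambda>n. case wcod xs (take n p) of None \<Rightarrow> False | Some zs \<Rightarrow>
       list_ex (\<lambda>k. take (length l) (drop n p) = shift k l \<and> take (length ys) (drop k zs) = ys \<and>
           isotopic (take n p @ shift k r @ drop (n + length l) p) q)
         [0..<Suc (length zs)])
       [0..<Suc (length p)]"

text \<open>
  The crossings of a single strand \<open>t\<close> with a bundle \<open>u\<close>, from left to right (\<open>over\<close>) and from
  right to left (\<open>under\<close>), and the same for the inverse braiding.
\<close>

fun over :: "tree \<Rightarrow> tree \<Rightarrow> word" where
  "over t Unit = []"
| "over t (Leaf c) = [(Br t (Leaf c), 0)]"
| "over t (u \<diamondop> v) = over t u @ shift (length (flat u)) (over t v)"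

fun under :: "tree \<Rightarrow> tree \<Rightarrow> word" where
  "under t Unit = []"
| "under t (Leaf c) = [(Br (Leaf c) t, 0)]"
| "under t (u \<diamondop> v) = shift (length (flat u)) (under t v) @ under t u"

fun over_inv :: "tree \<Rightarrow> tree \<Rightarrow> word" where
  "over_inv t Unit = []"
| "over_inv t (Leaf c) = [(Br_inv (Leaf c) t, 0)]"
| "over_inv t (u \<diamondop> v) = over_inv t u @ shift (length (flat u)) (over_inv t v)"

fun under_inv :: "tree \<Rightarrow> tree \<Rightarrow> word" where
  "under_inv t Unit = []"
| "under_inv t (Leaf c) = [(Br_inv t (Leaf c), 0)]"
| "under_inv t (u \<diamondop> v) = shift (length (flat u)) (under_inv t v) @ under_inv t u"

lemma wcod_append: "wcod xs (p @ q) = Option.bind (wcod xs p) (\<lambda>ys. wcod ys q)"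
  by (induction xs p rule: wcod.induct) auto

lemma shift_Nil [simp]: "shift k [] = []"
  and shift_Cons [simp]: "shift k ((g, i) # p) = (g, k + i) # shift k p"
  and shift_append [simp]: "shift k (p @ q) = shift k p @ shift k q"
  and shift_shift [simp]: "shift k (shift j p) = shift (k + j) p"
  and shift_0 [simp]: "shift 0 p = p"
  by (auto simp: shift_def add.assoc)

lemma wcod_ConsE:
  assumes "wcod xs ((g, i) # p) = Some ys"
  obtains as bs where "xs = as @ ins g @ bs" "length as = i" "wcod (as @ outs g @ bs) p = Some ys"
proof
  let ?as = "take i xs" and ?bs = "drop (i + length (ins g)) xs"
  have *: "i \<le> length xs" "take (length (ins g)) (drop i xs) = ins g"
    using assms by (auto split: if_splits)
  show "length ?as = i" using * by simp
  show "xs = ?as @ ins g @ ?bs"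
    by (subst *(2)[symmetric]) (simp flip: drop_drop add: add.commute[of i])
  show "wcod (?as @ outs g @ ?bs) p = Some ys" using assms by (auto split: if_splits)
qed

lemma wcod_at [simp]:
  "wcod (as @ ins g @ bs) ((g, length as) # p) = wcod (as @ outs g @ bs) p"
  by simp

lemma wcod_at':
  "length as = i \<Longrightarrow> wcod (as @ ins g @ bs) ((g, i) # p) = wcod (as @ outs g @ bs) p"
  by auto

lemma wcod_shift:
  "wcod xs p = Some ys \<Longrightarrow> wcod (us @ xs @ vs) (shift (length us) p) = Some (us @ ys @ vs)"
proof (induction p arbitrary: xs)
  case (Cons s p)
  obtain g i where s: "s = (g, i)" by force
  then obtain as bs where *: "xs = as @ ins g @ bs" "length as = i"
    "wcod (as @ outs g @ bs) p = Some ys"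
    using wcod_ConsE Cons.prems by metis
  have "wcod ((us @ as) @ ins g @ (bs @ vs)) (shift (length us) (s # p)) =
      wcod ((us @ as) @ outs g @ (bs @ vs)) (shift (length us) p)"
    using s * by (simp only: shift_Cons) (rule wcod_at', simp)
  with Cons.IH[OF *(3)] show ?case by (simp add: *(1))
qed simp

section \<open>Interpretation of words in a braided monoidal category\<close>

context category
begin

lemma hom_iff: "f \<in> hom C X Y \<longleftrightarrow> f \<in> Arr C \<and> Dom C f = X \<and> Cod C f = Y"
  by (auto simp: hom_def)

lemma comp_Arr [simp]:
  assumes "f \<in> Arr C" "g \<in> Arr C" "Cod C f = Dom C g"
  shows "g \<cdot> f \<in> Arr C" "Dom C (g \<cdot> f) = Dom C f" "Cod C (g \<cdot> f) = Cod C g"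
  using Comp_hom[of f "Dom C f" "Cod C f" g "Cod C g"] assms by (auto simp: hom_iff)

lemma id_Arr [simp]:
  assumes "X \<in> Obj C"
  shows "Id C X \<in> Arr C" "Dom C (Id C X) = X" "Cod C (Id C X) = X"
  using Id_hom[OF assms] by (auto simp: hom_iff)

lemma Dom_Cod_Obj [simp]: "f \<in> Arr C \<Longrightarrow> Dom C f \<in> Obj C" "f \<in> Arr C \<Longrightarrow> Cod C f \<in> Obj C"
  by (auto intro: Dom_Obj Cod_Obj)

lemma comp_assoc [simp]:
  "f \<in> Arr C \<Longrightarrow> g \<in> Arr C \<Longrightarrow> h \<in> Arr C \<Longrightarrow> Cod C f = Dom C g \<Longrightarrow> Cod C g = Dom C h \<Longrightarrow>
    (h \<cdot> g) \<cdot> f = h \<cdot> g \<cdot> f"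
  using Comp_assoc[of f "Dom C f" "Cod C f" g "Cod C g" h "Cod C h"] by (auto simp: hom_iff)

lemma comp_id [simp]: "f \<in> Arr C \<Longrightarrow> Dom C f = X \<Longrightarrow> f \<cdot> Id C X = f"
  and id_comp [simp]: "f \<in> Arr C \<Longrightarrow> Cod C f = X \<Longrightarrow> Id C X \<cdot> f = f"
  using Comp_Id Id_Comp by (auto simp: hom_iff)

text \<open>Composites are normalised to nest to the right, so an equation for
  \<open>g \<cdot> f\<close> is hidden as soon as another arrow precedes it.\<close>

lemma comp_cong:
  assumes "g \<cdot> f = k" "f \<in> Arr C" "g \<in> Arr C" "h \<in> Arr C" "Cod C h = Dom C f" "Cod C f = Dom C g"
  shows "g \<cdot> f \<cdot> h = k \<cdot> h"
  using assms by (metis comp_assoc)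

lemma inverse_arrows_unique:
  assumes "inverse_arrows C f g" "inverse_arrows C f h"
  shows "g = h"
proof -
  have *: "f \<in> Arr C" "g \<in> Arr C" "h \<in> Arr C" "Dom C g = Cod C f" "Cod C h = Dom C f"
      "Dom C h = Cod C f" "Cod C g = Dom C f" "g \<cdot> f = Id C (Dom C f)" "f \<cdot> h = Id C (Cod C f)"
    using assms by (auto simp: inverse_arrows_def hom_iff)
  have "g = g \<cdot> f \<cdot> h" using * by simp
  also have "\<dots> = (g \<cdot> f) \<cdot> h" by (rule comp_assoc[symmetric]) (use * in simp_all)
  also have "\<dots> = h" unfolding *(8) using * by simp
  finally show ?thesis .
qed

lemma cinv_eqI: "inverse_arrows C f g \<Longrightarrow> cinv C f = g"
  unfolding cinv_def by (blast intro: inverse_arrows_unique)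

lemma inverse_arrows_cinv: "is_iso C f \<Longrightarrow> inverse_arrows C f (cinv C f)"
  unfolding is_iso_def using cinv_eqI by auto

lemma iso_Arr: "is_iso C f \<Longrightarrow> f \<in> Arr C"
  by (auto simp: is_iso_def inverse_arrows_def hom_iff)

lemma cinv_Arr [simp]:
  assumes "is_iso C f"
  shows "cinv C f \<in> Arr C" "Dom C (cinv C f) = Cod C f" "Cod C (cinv C f) = Dom C f"
    "cinv C f \<cdot> f = Id C (Dom C f)" "f \<cdot> cinv C f = Id C (Cod C f)"
  using inverse_arrows_cinv[OF assms] by (auto simp: inverse_arrows_def hom_iff)

lemma cinv_cancel [simp]:
  assumes "is_iso C f" "g \<in> Arr C" "Cod C g = Dom C f"
  shows "cinv C f \<cdot> f \<cdot> g = g"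
  using assms iso_Arr[OF assms(1)] by (subst comp_cong[OF cinv_Arr(4)[OF assms(1)]]) simp_all

lemma cancel_cinv [simp]:
  assumes "is_iso C f" "g \<in> Arr C" "Cod C g = Cod C f"
  shows "f \<cdot> cinv C f \<cdot> g = g"
  using assms iso_Arr[OF assms(1)] by (subst comp_cong[OF cinv_Arr(5)[OF assms(1)]]) simp_all

lemma iso_id: "X \<in> Obj C \<Longrightarrow> is_iso C (Id C X)"
  unfolding is_iso_def inverse_arrows_def by (auto intro!: exI[of _ "Id C X"] simp: hom_iff)

lemma iso_comp:
  assumes "is_iso C f" "is_iso C g" "Cod C f = Dom C g"
  shows "is_iso C (g \<cdot> f)"
  unfolding is_iso_def inverse_arrows_def
  using assms iso_Arr by (auto intro!: exI[of _ "cinv C f \<cdot> cinv C g"] simp: hom_iff)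

lemma iso_cancel_right:
  assumes "is_iso C h" "f \<in> Arr C" "g \<in> Arr C" "Dom C f = Cod C h" "Dom C g = Cod C h"
    and "f \<cdot> h = g \<cdot> h"
  shows "f = g"
proof -
  have "(f \<cdot> h) \<cdot> cinv C h = (g \<cdot> h) \<cdot> cinv C h" using assms by simp
  then show ?thesis using assms(1-5) iso_Arr[OF assms(1)] by simp
qed

lemma iso_cancel_left:
  assumes "is_iso C h" "f \<in> Arr C" "g \<in> Arr C" "Cod C f = Dom C h" "Cod C g = Dom C h"
    and "h \<cdot> f = h \<cdot> g"
  shows "f = g"
proof -
  have "cinv C h \<cdot> h \<cdot> f = cinv C h \<cdot> h \<cdot> g" using assms by simp
  then show ?thesis using assms(1-5) iso_Arr[OF assms(1)] by simp
qed

end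

context monoidal_category
begin

declare unit_Obj [simp] tensor_Obj [simp] assoc_iso [simp] lunit_iso [simp] runit_iso [simp]

lemma tensor_Arr [simp]:
  assumes "f \<in> Arr C" "g \<in> Arr C"
  shows "f \<otimes> g \<in> Arr C" "Dom C (f \<otimes> g) = Dom C f \<boxtimes> Dom C g" "Cod C (f \<otimes> g) = Cod C f \<boxtimes> Cod C g"
  using tensor_hom[of f "Dom C f" "Cod C f" g "Dom C g" "Cod C g"] assms by (auto simp: hom_iff)

lemma tensor_comp [simp]:
  assumes "f \<in> Arr C" "g \<in> Arr C" "f' \<in> Arr C" "g' \<in> Arr C" "Cod C f = Dom C g" "Cod C f' = Dom C g'"
  shows "(g \<otimes> g') \<cdot> (f \<otimes> f') = (g \<cdot> f) \<otimes> (g' \<cdot> f')"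
  using tensor_Comp[of f "Dom C f" "Cod C f" g "Cod C g" f' "Dom C f'" "Cod C f'" g' "Cod C g'"] assms
  by (auto simp: hom_iff)

lemma tensor_comp_comp [simp]:
  assumes "f \<in> Arr C" "g \<in> Arr C" "f' \<in> Arr C" "g' \<in> Arr C" "Cod C f = Dom C g" "Cod C f' = Dom C g'"
    "h \<in> Arr C" "Cod C h = Dom C f \<boxtimes> Dom C f'"
  shows "(g \<otimes> g') \<cdot> (f \<otimes> f') \<cdot> h = ((g \<cdot> f) \<otimes> (g' \<cdot> f')) \<cdot> h"
  using assms by (intro comp_cong) auto

lemma tensor_id [simp]: "X \<in> Obj C \<Longrightarrow> Y \<in> Obj C \<Longrightarrow> Id C X \<otimes> Id C Y = Id C (X \<boxtimes> Y)"
  by (rule tensor_Id)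

lemma assoc_Arr [simp]:
  assumes "X \<in> Obj C" "Y \<in> Obj C" "Z \<in> Obj C"
  shows "assoc C X Y Z \<in> Arr C" "Dom C (assoc C X Y Z) = (X \<boxtimes> Y) \<boxtimes> Z"
    "Cod C (assoc C X Y Z) = X \<boxtimes> Y \<boxtimes> Z"
  using assoc_hom[OF assms] by (auto simp: hom_iff)

lemma unit_Arr [simp]:
  assumes "X \<in> Obj C"
  shows "lunit C X \<in> Arr C" "Dom C (lunit C X) = \<one> \<boxtimes> X" "Cod C (lunit C X) = X"
    "runit C X \<in> Arr C" "Dom C (runit C X) = X \<boxtimes> \<one>" "Cod C (runit C X) = X"
  using lunit_hom[OF assms] runit_hom[OF assms] by (auto simp: hom_iff)

lemma assoc_nat:
  assumes "f \<in> Arr C" "g \<in> Arr C" "h \<in> Arr C" "Cod C f = X" "Cod C g = Y" "Cod C h = Z"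
  shows "assoc C X Y Z \<cdot> ((f \<otimes> g) \<otimes> h) = (f \<otimes> (g \<otimes> h)) \<cdot> assoc C (Dom C f) (Dom C g) (Dom C h)"
  using assms assoc_natural[of f "Dom C f" X g "Dom C g" Y h "Dom C h" Z] by (auto simp: hom_iff)

lemma lunit_nat:
  "f \<in> Arr C \<Longrightarrow> lunit C (Cod C f) \<cdot> (Id C \<one> \<otimes> f) = f \<cdot> lunit C (Dom C f)"
  using lunit_natural by (auto simp: hom_iff)

lemma runit_nat:
  "f \<in> Arr C \<Longrightarrow> runit C (Cod C f) \<cdot> (f \<otimes> Id C \<one>) = f \<cdot> runit C (Dom C f)"
  using runit_natural by (auto simp: hom_iff)

lemma iso_tensor:
  assumes "is_iso C f" "is_iso C g"
  shows "is_iso C (f \<otimes> g)"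
  unfolding is_iso_def inverse_arrows_def
  using assms iso_Arr by (auto intro!: exI[of _ "cinv C f \<otimes> cinv C g"] simp: hom_iff)

text \<open>By naturality of \<open>runit\<close>, tensoring with the unit object is isomorphic to
  the identity functor.\<close>

lemma tensor_unit_faithful:
  assumes "f \<in> hom C X Y" "g \<in> hom C X Y" "f \<otimes> Id C \<one> = g \<otimes> Id C \<one>"
  shows "f = g"
proof -
  have *: "f \<in> Arr C" "g \<in> Arr C" "X = Dom C f" "Dom C g = Dom C f" "Cod C g = Cod C f"
    using assms by (auto simp: hom_iff)
  then have "f \<cdot> runit C (Dom C f) = g \<cdot> runit C (Dom C f)"
    using runit_nat[of f] runit_nat[of g] assms(3) by simp
  then show ?thesis
    by (rule iso_cancel_right[rotated -1]) (use * in simp_all)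
qed

lemma unit_tensor_faithful:
  assumes "f \<in> hom C X Y" "g \<in> hom C X Y" "Id C \<one> \<otimes> f = Id C \<one> \<otimes> g"
  shows "f = g"
proof -
  have *: "f \<in> Arr C" "g \<in> Arr C" "X = Dom C f" "Dom C g = Dom C f" "Cod C g = Cod C f"
    using assms by (auto simp: hom_iff)
  then have "f \<cdot> lunit C (Dom C f) = g \<cdot> lunit C (Dom C f)"
    using lunit_nat[of f] lunit_nat[of g] assms(3) by simp
  then show ?thesis
    by (rule iso_cancel_right[rotated -1]) (use * in simp_all)
qed

text \<open>The classical consequence of pentagon and triangle that is not among the axioms. After
  tensoring with the unit object and composing with an invertible associator, both sides can be
  computed from the pentagon; faithfulness removes the extra factor.\<close>

lemma lunit_tensor:
  assumes [simp]: "X \<in> Obj C" "Y \<in> Obj C"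
  shows "lunit C (X \<boxtimes> Y) \<cdot> assoc C \<one> X Y = lunit C X \<otimes> Id C Y"
proof (rule unit_tensor_faithful)
  let ?a = "assoc C \<one> (\<one> \<boxtimes> X) Y \<cdot> (assoc C \<one> \<one> X \<otimes> Id C Y)"
  have tri: "(Id C \<one> \<otimes> lunit C Z) \<cdot> assoc C \<one> \<one> Z = runit C \<one> \<otimes> Id C Z" if "Z \<in> Obj C" for Z
    using triangle[of \<one> Z] that by simp
  have "(Id C \<one> \<otimes> (lunit C (X \<boxtimes> Y) \<cdot> assoc C \<one> X Y)) \<cdot> ?a
      = (Id C \<one> \<otimes> lunit C (X \<boxtimes> Y)) \<cdot> (Id C \<one> \<otimes> assoc C \<one> X Y) \<cdot> ?a"
    by simp
  also have "\<dots> = (Id C \<one> \<otimes> lunit C (X \<boxtimes> Y)) \<cdot> assoc C \<one> \<one> (X \<boxtimes> Y) \<cdot> assoc C (\<one> \<boxtimes> \<one>) X Y"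
    by (subst pentagon) simp_all
  also have "\<dots> = (runit C \<one> \<otimes> Id C (X \<boxtimes> Y)) \<cdot> assoc C (\<one> \<boxtimes> \<one>) X Y"
    by (rule comp_cong) (simp_all add: tri)
  also have "\<dots> = assoc C \<one> X Y \<cdot> ((runit C \<one> \<otimes> Id C X) \<otimes> Id C Y)"
    by (subst assoc_nat) (simp_all del: tensor_id add: tensor_id[symmetric])
  also have "\<dots> = assoc C \<one> X Y \<cdot> ((Id C \<one> \<otimes> lunit C X) \<otimes> Id C Y) \<cdot> (assoc C \<one> \<one> X \<otimes> Id C Y)"
    by (simp add: tri)
  also have "\<dots> = (Id C \<one> \<otimes> (lunit C X \<otimes> Id C Y)) \<cdot> ?a"
    by (subst comp_cong[OF assoc_nat]) simp_all
  finally show "Id C \<one> \<otimes> (lunit C (X \<boxtimes> Y) \<cdot> assoc C \<one> X Y) = Id C \<one> \<otimes> (lunit C X \<otimes> Id C Y)"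
    by (rule iso_cancel_right[rotated -1]) (auto intro!: iso_comp iso_tensor iso_id)
qed (auto simp: hom_iff)

end

section \<open>Strictification by the left action of words on objects\<close>

locale colored = braided_monoidal_category C
  for C :: "('o, 'a, 'x) braided_data_scheme" (structure) +
  fixes ob :: "color \<Rightarrow> 'o"
  assumes ob_Obj [simp]: "ob c \<in> Obj C"
begin

fun tob :: "tree \<Rightarrow> 'o" where
  "tob (Leaf c) = ob c"
| "tob Unit = \<one>"
| "tob (t \<diamondop> u) = tob t \<boxtimes> tob u"

text \<open>
  Objects are strictified by their action on the left: the word \<open>[x, y]\<close> stands for the functor
  \<open>R \<mapsto> x \<boxtimes> (y \<boxtimes> R)\<close>, so that concatenation of words is composition of functors.
\<close>

fun act :: "color list \<Rightarrow> 'o \<Rightarrow> 'o" where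
  "act [] R = R"
| "act (x # xs) R = ob x \<boxtimes> act xs R"

fun acta :: "color list \<Rightarrow> 'a \<Rightarrow> 'a" where
  "acta [] f = f"
| "acta (x # xs) f = Id C (ob x) \<otimes> acta xs f"

text \<open>The canonical isomorphism
  \<open>tob t \<boxtimes> R \<rightarrow> act (flat t) R\<close>: it pushes the brackets to the
  right and drops the units. Right unit constraints do not occur, as \<open>R\<close> always stands
  to the right.\<close>

fun can :: "tree \<Rightarrow> 'o \<Rightarrow> 'a" where
  "can (Leaf c) R = Id C (ob c \<boxtimes> R)"
| "can Unit R = lunit C R"
| "can (t \<diamondop> u) R = can t (act (flat u) R) \<cdot> (Id C (tob t) \<otimes> can u R) \<cdot> assoc C (tob t) (tob u) R"

lemma tob_Obj [simp]: "tob t \<in> Obj C"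
  by (induction t) auto

lemma act_Obj [simp]: "R \<in> Obj C \<Longrightarrow> act xs R \<in> Obj C"
  by (induction xs) auto

lemma act_append [simp]: "act (xs @ ys) R = act xs (act ys R)"
  by (induction xs) auto

lemma acta_append [simp]: "acta (xs @ ys) R = acta xs (acta ys R)"
  by (induction xs) auto

lemma acta_Arr [simp]:
  assumes "f \<in> Arr C"
  shows "acta xs f \<in> Arr C" "Dom C (acta xs f) = act xs (Dom C f)" "Cod C (acta xs f) = act xs (Cod C f)"
  using assms by (induction xs) auto

lemma acta_comp:
  "f \<in> Arr C \<Longrightarrow> g \<in> Arr C \<Longrightarrow> Cod C f = Dom C g \<Longrightarrow> acta xs (g \<cdot> f) = acta xs g \<cdot> acta xs f"
  by (induction xs) auto

lemma acta_id [simp]: "R \<in> Obj C \<Longrightarrow> acta xs (Id C R) = Id C (act xs R)"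
  by (induction xs) auto

lemma can_Arr [simp]:
  assumes "R \<in> Obj C"
  shows "can t R \<in> Arr C" "Dom C (can t R) = tob t \<boxtimes> R" "Cod C (can t R) = act (flat t) R"
  using assms by (induction t arbitrary: R) auto

lemma can_iso [simp]: "R \<in> Obj C \<Longrightarrow> is_iso C (can t R)"
  by (induction t arbitrary: R) (auto intro!: iso_comp iso_tensor iso_id)

lemma can_nat:
  "f \<in> Arr C \<Longrightarrow> can t (Cod C f) \<cdot> (Id C (tob t) \<otimes> f) = acta (flat t) f \<cdot> can t (Dom C f)"
proof (induction t arbitrary: f)
  case (Node t u)
  let ?T = "Id C (tob t)" and ?U = "Id C (tob u)" and ?Y = "Cod C f" and ?X = "Dom C f"
  note [simp] = Node.prems
  have "can (t \<diamondop> u) ?Y \<cdot> (Id C (tob (t \<diamondop> u)) \<otimes> f)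
      = can t (act (flat u) ?Y) \<cdot> (?T \<otimes> can u ?Y) \<cdot> assoc C (tob t) (tob u) ?Y \<cdot> ((?T \<otimes> ?U) \<otimes> f)"
    by simp
  also have "\<dots> = can t (act (flat u) ?Y) \<cdot> (?T \<otimes> (can u ?Y \<cdot> (?U \<otimes> f))) \<cdot> assoc C (tob t) (tob u) ?X"
    by (subst assoc_nat) auto
  also have "\<dots> = can t (act (flat u) ?Y) \<cdot> (?T \<otimes> acta (flat u) f) \<cdot> (?T \<otimes> can u ?X) \<cdot> assoc C (tob t) (tob u) ?X"
    by (subst Node.IH(2)) auto
  also have "\<dots> = acta (flat t) (acta (flat u) f) \<cdot> can t (act (flat u) ?X) \<cdot> (?T \<otimes> can u ?X) \<cdot> assoc C (tob t) (tob u) ?X"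
    using Node.IH(1)[of "acta (flat u) f"] by (subst comp_cong) auto
  finally show ?case by simp
qed (auto simp: lunit_nat)

end

section \<open>Words as natural transformations\<close>

locale diagram = colored C ob
  for C :: "('o, 'a, 'x) braided_data_scheme" (structure) and ob :: "color \<Rightarrow> 'o" +
  fixes ar :: "gen \<Rightarrow> 'a"
  assumes ar_hom: "ar g \<in> hom C (tob (src g)) (tob (tgt g))"
    and ar_Br: "ar (Br t u) = braid C (tob t) (tob u)"
    and ar_Br_inv: "ar (Br_inv t u) = cinv C (braid C (tob t) (tob u))"
begin

text \<open>The generator acting on the leftmost strands of \<open>act (ins g) R\<close>. The
  strands to its right are absorbed into \<open>R\<close>, those to its left are supplied by
  \<open>acta\<close>, so a layer needs no associators.\<close>

definition fam :: "gen \<Rightarrow> 'o \<Rightarrow> 'a" where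
  "fam g R = can (tgt g) R \<cdot> (ar g \<otimes> Id C R) \<cdot> cinv C (can (src g) R)"

fun run :: "color list \<Rightarrow> word \<Rightarrow> 'o \<Rightarrow> 'a" where
  "run xs [] R = Id C (act xs R)"
| "run xs ((g, i) # p) R =
     run (take i xs @ outs g @ drop (i + length (ins g)) xs) p R \<cdot>
     acta (take i xs) (fam g (act (drop (i + length (ins g)) xs) R))"

text \<open>Equality is demanded for every \<open>R\<close> and not just the unit object: this makes
  it stable under adding strands on the right, hence a congruence for rewriting inside a larger
  diagram.\<close>

definition weq :: "word \<Rightarrow> color list \<Rightarrow> word \<Rightarrow> bool" ("(_ \<approx>\<langle>_\<rangle> _)" [51, 0, 51] 50) where
  "p \<approx>\<langle>xs\<rangle> q \<longleftrightarrow> wcod xs p \<noteq> None \<and> wcod xs q = wcod xs p \<and> (\<forall>R\<in>Obj C. run xs p R = run xs q R)"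

text \<open>The link between arrows with brackets and words without: conjugating
  \<open>f \<otimes> Id C R\<close> by the canonical isomorphisms gives the family of
  \<open>p\<close>. One arrow may be denoted by many words, all equal in the sense of
  \<open>weq\<close>.\<close>

definition den :: "tree \<Rightarrow> tree \<Rightarrow> 'a \<Rightarrow> word \<Rightarrow> bool" where
  "den t u f p \<longleftrightarrow> f \<in> hom C (tob t) (tob u) \<and> wcod (flat t) p = Some (flat u) \<and>
     (\<forall>R\<in>Obj C. can u R \<cdot> (f \<otimes> Id C R) = run (flat t) p R \<cdot> can t R)"

lemma ar_Arr [simp]: "ar g \<in> Arr C" "Dom C (ar g) = tob (src g)" "Cod C (ar g) = tob (tgt g)"
  using ar_hom[of g] by (auto simp: hom_iff)

lemma fam_Arr [simp]:
  assumes "R \<in> Obj C"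
  shows "fam g R \<in> Arr C" "Dom C (fam g R) = act (ins g) R" "Cod C (fam g R) = act (outs g) R"
  using assms by (auto simp: fam_def)

lemma fam_nat:
  assumes [simp]: "f \<in> Arr C"
  shows "acta (outs g) f \<cdot> fam g (Dom C f) = fam g (Cod C f) \<cdot> acta (ins g) f"
proof (rule iso_cancel_right[of "can (src g) (Dom C f)"])
  have "(acta (outs g) f \<cdot> fam g (Dom C f)) \<cdot> can (src g) (Dom C f)
      = acta (outs g) f \<cdot> can (tgt g) (Dom C f) \<cdot> (ar g \<otimes> Id C (Dom C f))"
    by (simp add: fam_def)
  also have "\<dots> = can (tgt g) (Cod C f) \<cdot> (ar g \<otimes> f)"
    by (subst comp_cong[OF can_nat[symmetric]]) simp_all
  also have "\<dots> = fam g (Cod C f) \<cdot> can (src g) (Cod C f) \<cdot> (Id C (tob (src g)) \<otimes> f)"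
    by (simp add: fam_def)
  also have "\<dots> = (fam g (Cod C f) \<cdot> acta (ins g) f) \<cdot> can (src g) (Dom C f)"
    by (subst can_nat) simp_all
  finally show "(acta (outs g) f \<cdot> fam g (Dom C f)) \<cdot> can (src g) (Dom C f) =
    (fam g (Cod C f) \<cdot> acta (ins g) f) \<cdot> can (src g) (Dom C f)" .
qed simp_all

lemma run_at:
  "length as = i \<Longrightarrow> run (as @ ins g @ bs) ((g, i) # p) R =
     run (as @ outs g @ bs) p R \<cdot> acta as (fam g (act bs R))"
  by auto

lemma run_Arr:
  assumes "R \<in> Obj C"
  shows "wcod xs p = Some ys \<Longrightarrow>
    run xs p R \<in> Arr C \<and> Dom C (run xs p R) = act xs R \<and> Cod C (run xs p R) = act ys R"
proof (induction p arbitrary: xs)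
  case (Cons s p)
  obtain g i where s: "s = (g, i)" by force
  then obtain as bs where *: "xs = as @ ins g @ bs" "length as = i"
    "wcod (as @ outs g @ bs) p = Some ys"
    using wcod_ConsE Cons.prems by metis
  show ?case using Cons.IH[OF *(3)] assms *(1,2) unfolding s by (simp add: run_at del: run.simps)
qed (use assms in simp)

lemma run_append:
  assumes [simp]: "R \<in> Obj C"
  shows "wcod xs p = Some ys \<Longrightarrow> wcod ys q = Some zs \<Longrightarrow> run xs (p @ q) R = run ys q R \<cdot> run xs p R"
proof (induction p arbitrary: xs)
  case Nil
  then show ?case using run_Arr[of R xs q zs] by simp
next
  case (Cons s p)
  obtain g i where s: "s = (g, i)" by force
  then obtain as bs where *: "xs = as @ ins g @ bs" "length as = i"
    "wcod (as @ outs g @ bs) p = Some ys"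
    using wcod_ConsE Cons.prems by metis
  show ?case
    using Cons.IH[OF *(3) Cons.prems(2)] run_Arr[OF assms *(3)] run_Arr[OF assms Cons.prems(2)] *(1,2)
    unfolding s by (simp add: run_at del: run.simps)
qed

lemma run_shift:
  assumes [simp]: "R \<in> Obj C"
  shows "wcod xs p = Some ys \<Longrightarrow>
    run (us @ xs @ vs) (shift (length us) p) R = acta us (run xs p (act vs R))"
proof (induction p arbitrary: xs)
  case (Cons s p)
  obtain g i where s: "s = (g, i)" by force
  then obtain as bs where *: "xs = as @ ins g @ bs" "length as = i"
    "wcod (as @ outs g @ bs) p = Some ys"
    using wcod_ConsE Cons.prems by metis
  have "run ((us @ as) @ ins g @ (bs @ vs)) ((g, length us + i) # shift (length us) p) R
      = run ((us @ as) @ outs g @ (bs @ vs)) (shift (length us) p) R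
          \<cdot> acta (us @ as) (fam g (act (bs @ vs) R))"
    by (rule run_at) (simp add: *)
  then show ?case
    using Cons.IH[OF *(3)] run_Arr[OF _ *(3), of "act vs R"] *(1,2)
    unfolding s by (simp add: run_at acta_comp del: run.simps)
qed simp

subsection \<open>Equality of words\<close>

lemma weq_refl: "wcod xs p \<noteq> None \<Longrightarrow> p \<approx>\<langle>xs\<rangle> p"
  by (auto simp: weq_def)

lemma weq_sym: "p \<approx>\<langle>xs\<rangle> q \<Longrightarrow> q \<approx>\<langle>xs\<rangle> p"
  by (auto simp: weq_def)

lemma weq_trans [trans]: "p \<approx>\<langle>xs\<rangle> q \<Longrightarrow> q \<approx>\<langle>xs\<rangle> r \<Longrightarrow> p \<approx>\<langle>xs\<rangle> r"
  by (auto simp: weq_def)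

lemma weq_cong:
  assumes "l \<approx>\<langle>ys\<rangle> r" "wcod xs p = Some (us @ ys @ vs)" "wcod xs (p @ shift (length us) l @ q) \<noteq> None"
  shows "p @ shift (length us) l @ q \<approx>\<langle>xs\<rangle> p @ shift (length us) r @ q"
proof -
  obtain zs where l: "wcod ys l = Some zs" and r: "wcod ys r = Some zs"
    using assms(1) by (auto simp: weq_def)
  note ls = wcod_shift[OF l, of us vs] and rs = wcod_shift[OF r, of us vs]
  obtain ws where q: "wcod (us @ zs @ vs) q = Some ws"
    using assms(2,3) ls by (auto simp: wcod_append)
  have "run xs (p @ shift (length us) l @ q) R = run xs (p @ shift (length us) r @ q) R" if "R \<in> Obj C" for R
  proof -
    have "run (us @ ys @ vs) (shift (length us) l @ q) R = run (us @ ys @ vs) (shift (length us) r @ q) R"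
      using assms(1) that run_append[OF that ls q] run_append[OF that rs q] run_shift[OF that l, of us vs]
        run_shift[OF that r, of us vs] by (simp add: weq_def)
    then show ?thesis
      using run_append[OF that assms(2), of "shift (length us) l @ q"]
        run_append[OF that assms(2), of "shift (length us) r @ q"] ls rs q
      by (simp add: wcod_append)
  qed
  then show ?thesis using assms(2) ls rs q by (auto simp: weq_def wcod_append)
qed

lemma weq_Cons:
  assumes "wcod xs (s # p) \<noteq> None" "\<And>ys. wcod xs [s] = Some ys \<Longrightarrow> p \<approx>\<langle>ys\<rangle> q"
  shows "s # p \<approx>\<langle>xs\<rangle> s # q"
proof -
  obtain ys where ys: "wcod xs [s] = Some ys"
    using assms(1) by (cases s) (auto split: if_splits)
  have "p \<approx>\<langle>ys\<rangle> q" by (rule assms(2)[OF ys])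
  from weq_cong[OF this, of xs "[s]" "[]" "[]" "[]"] show ?thesis
    using ys assms(1) \<open>p \<approx>\<langle>ys\<rangle> q\<close> by (auto simp: weq_def wcod_append split: Option.bind_splits)
qed

text \<open>The interchange law is naturality of the family of the left-hand generator.\<close>

lemma weq_interchange:
  fixes f g as bs cs
  defines "i \<equiv> length as" and "j \<equiv> length (as @ outs f @ bs)" and "k \<equiv> length (as @ ins f @ bs)"
    and "xs \<equiv> as @ ins f @ bs @ ins g @ cs"
  shows "[(f, i), (g, j)] \<approx>\<langle>xs\<rangle> [(g, k), (f, i)]"
proof -
  let ?ys = "as @ outs f @ bs @ outs g @ cs"
  have c1: "wcod xs [(f, i), (g, j)] = Some ?ys" and c2: "wcod xs [(g, k), (f, i)] = Some ?ys"
    using wcod_at'[of as i f "bs @ ins g @ cs" "[(g, j)]"]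
      wcod_at'[of "as @ outs f @ bs" j g cs "[]"]
      wcod_at'[of "as @ ins f @ bs" k g cs "[(f, i)]"] wcod_at'[of as i f "bs @ outs g @ cs" "[]"]
    by (simp_all add: xs_def i_def j_def k_def del: wcod.simps(2) wcod_at)
  have "run xs [(f, i), (g, j)] R = run xs [(g, k), (f, i)] R" if [simp]: "R \<in> Obj C" for R
  proof -
    let ?h = "acta bs (fam g (act cs R))"
    have "run xs [(f, i), (g, j)] R = acta as (acta (outs f) ?h \<cdot> fam f (Dom C ?h))"
      using run_at[of as i f "bs @ ins g @ cs" "[(g, j)]" R]
        run_at[of "as @ outs f @ bs" j g cs "[]" R]
      by (simp add: xs_def i_def j_def k_def acta_comp del: run.simps(2))
    also have "\<dots> = acta as (fam f (Cod C ?h) \<cdot> acta (ins f) ?h)"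
      by (subst fam_nat) simp_all
    also have "\<dots> = run xs [(g, k), (f, i)] R"
      using run_at[of "as @ ins f @ bs" k g cs "[(f, i)]" R] run_at[of as i f "bs @ outs g @ cs" "[]" R]
      by (simp add: xs_def i_def j_def k_def acta_comp del: run.simps(2))
    finally show ?thesis .
  qed
  then show ?thesis using c1 c2 by (simp add: weq_def)
qed

lemma weq_exchange:
  assumes "st \<in> set (exchange s t)" "wcod xs [s, t] \<noteq> None"
  shows "[s, t] \<approx>\<langle>xs\<rangle> st"
proof -
  obtain f i where s: "s = (f, i)" by force
  obtain g j where t: "t = (g, j)" by force
  obtain as bs where 1: "xs = as @ ins f @ bs" "length as = i" "wcod (as @ outs f @ bs) [t] \<noteq> None"
    using assms(2) wcod_ConsE unfolding s t by (metis not_Some_eq)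
  then obtain as' bs' where 2: "as @ outs f @ bs = as' @ ins g @ bs'" "length as' = j"
    using wcod_ConsE unfolding t by (metis not_Some_eq)
  consider (right) "i + length (outs f) \<le> j" "st = [(g, j - length (outs f) + length (ins f)), (f, i)]"
    | (left) "j + length (ins g) \<le> i" "st = [(g, j), (f, i - length (ins g) + length (outs g))]"
    using assms(1) by (auto simp: s t exchange_def split: if_splits)
  then show ?thesis
  proof cases
    case right
    then obtain cs where "as' = as @ outs f @ cs" "bs = cs @ ins g @ bs'"
      using 1 2 by (auto simp: append_eq_append_conv2)
    moreover from this have "j = i + length (outs f) + length cs" using 1 2 by simp
    ultimately show ?thesis
      using weq_interchange[of f as g cs bs'] right(2) 1(1,2) by (simp add: s t ac_simps)
  next
    case left
    have "as @ (outs f @ bs) = (as' @ ins g) @ bs'" using 2(1) by simp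
    then consider cs where "as = (as' @ ins g) @ cs" "cs @ outs f @ bs = bs'"
      | us where "as @ us = as' @ ins g" "outs f @ bs = us @ bs'"
      unfolding append_eq_append_conv2 by blast
    then obtain cs where "as = as' @ ins g @ cs" "bs' = cs @ outs f @ bs"
    proof cases
      case (2 us)
      have "length us = 0"
        using arg_cong[OF 2(1), of length] left(1) 1(2) \<open>length as' = j\<close> by (simp del: length_0_conv)
      with 2 that[of "[]"] show thesis by simp
    qed (simp add: that)
    moreover from this have "i = j + length (ins g) + length cs" using 1 2 by simp
    ultimately show ?thesis
      using weq_interchange[of g as' f cs bs, THEN weq_sym] left(2) 1(1) 2(2) by (simp add: s t ac_simps)
  qed
qed

lemma weq_fronts:
  "wcod xs p \<noteq> None \<Longrightarrow> p' \<in> set (fronts g p) \<Longrightarrow> p \<approx>\<langle>xs\<rangle> p'"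
proof (induction p arbitrary: xs p')
  case (Cons s p)
  consider "p' = s # p" | t p'' st where "t # p'' \<in> set (fronts g p)" "st \<in> set (exchange s t)" "p' = st @ p''"
    using Cons.prems(2) by (auto split: if_splits list.splits)
  then show ?case
  proof cases
    case 1
    then show ?thesis using Cons.prems by (simp add: weq_refl)
  next
    case 2
    have "s # p \<approx>\<langle>xs\<rangle> s # t # p''"
    proof (rule weq_Cons[OF Cons.prems(1)])
      fix ys assume "wcod xs [s] = Some ys"
      then have "wcod ys p \<noteq> None"
        using Cons.prems(1) wcod_append[of xs "[s]" p] by simp
      then show "p \<approx>\<langle>ys\<rangle> t # p''" using Cons.IH 2(1) by blast
    qed
    also have "s # t # p'' \<approx>\<langle>xs\<rangle> p'"
    proof -
      have "wcod xs (s # t # p'') \<noteq> None" using \<open>s # p \<approx>\<langle>xs\<rangle> s # t # p''\<close> by (auto simp: weq_def)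
      moreover from this have "wcod xs [s, t] \<noteq> None"
        using wcod_append[of xs "[s, t]" p''] by (auto split: Option.bind_splits)
      ultimately show ?thesis
        using weq_cong[OF weq_exchange[OF 2(2)], of xs xs "[]" "[]" "[]" p''] 2(3) by simp
    qed
    finally show ?thesis .
  qed
qed simp

lemma weq_isotopic: "isotopic p q \<Longrightarrow> wcod xs p \<noteq> None \<Longrightarrow> p \<approx>\<langle>xs\<rangle> q"
proof (induction q arbitrary: p xs)
  case Nil
  then show ?case by (simp add: weq_refl)
next
  case (Cons s q)
  from Cons.prems(1) obtain p' where p': "p' \<in> set (fronts (fst s) p)"
    "case p' of [] \<Rightarrow> False | t # p'' \<Rightarrow> t = s \<and> isotopic p'' q"
    unfolding isotopic.simps list_ex_iff by blast
  then obtain p'' where *: "s # p'' \<in> set (fronts (fst s) p)" "isotopic p'' q"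
    by (cases p' rule: list.exhaust) auto
  note 1 = weq_fronts[OF Cons.prems(2) *(1)]
  also have "s # p'' \<approx>\<langle>xs\<rangle> s # q"
  proof (rule weq_Cons)
    show w: "wcod xs (s # p'') \<noteq> None" using 1 by (auto simp: weq_def)
    fix ys assume "wcod xs [s] = Some ys"
    then have "wcod ys p'' \<noteq> None"
      using w wcod_append[of xs "[s]" p''] by simp
    then show "p'' \<approx>\<langle>ys\<rangle> q" using Cons.IH *(2) by blast
  qed
  finally show ?case .
qed

text \<open>The redex must be contiguous in the source word, while the target is only compared up to
  interchange. The displayed words are therefore listed in the order that suits the next rule, and
  an initial isotopy step appears where the given order does not. The colours \<open>ys\<close>
  locate the strands when the rule is applied to an empty word, that is, when a diagram is
  inserted.\<close>

lemma rw:
  assumes "l \<approx>\<langle>ys\<rangle> r" "rewrite_step ys l r xs p q"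
  shows "p \<approx>\<langle>xs\<rangle> q"
proof -
  obtain n k zs where *: "wcod xs p \<noteq> None" "wcod xs (take n p) = Some zs" "k \<le> length zs"
    "take (length l) (drop n p) = shift k l" "take (length ys) (drop k zs) = ys"
    "isotopic (take n p @ shift k r @ drop (n + length l) p) q"
  proof -
    obtain n where n: "case wcod xs (take n p) of None \<Rightarrow> False | Some zs \<Rightarrow>
       list_ex (\<lambda>k. take (length l) (drop n p) = shift k l \<and> take (length ys) (drop k zs) = ys \<and>
           isotopic (take n p @ shift k r @ drop (n + length l) p) q) [0..<Suc (length zs)]"
      using assms(2) unfolding rewrite_step_def list_ex_iff by blast
    then obtain zs where "wcod xs (take n p) = Some zs"
      by (cases "wcod xs (take n p)") auto
    with n assms(2) that show thesis
      by (auto simp: rewrite_step_def list_ex_iff less_Suc_eq_le simp del: upt_Suc)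
  qed
  have p: "p = take n p @ shift k l @ drop (n + length l) p"
    unfolding *(4)[symmetric] by (metis append_take_drop_id drop_drop add.commute)
  have zs: "zs = take k zs @ ys @ drop (k + length ys) zs"
    by (metis *(5) append_take_drop_id drop_drop add.commute)
  have "p \<approx>\<langle>xs\<rangle> take n p @ shift k r @ drop (n + length l) p"
    using weq_cong[OF assms(1), of xs "take n p" "take k zs" "drop (k + length ys) zs" "drop (n + length l) p"]
      *(1,2,3) p zs by simp
  moreover from this have "take n p @ shift k r @ drop (n + length l) p \<approx>\<langle>xs\<rangle> q"
    by (intro weq_isotopic *) (auto simp: weq_def)
  ultimately show ?thesis by (rule weq_trans)
qed

lemma rw_sym: "l \<approx>\<langle>ys\<rangle> r \<Longrightarrow> rewrite_step ys r l xs p q \<Longrightarrow> p \<approx>\<langle>xs\<rangle> q"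
  using rw weq_sym by blast

lemma weq_append:
  assumes "p \<approx>\<langle>xs\<rangle> p'" "wcod xs p = Some ys" "q \<approx>\<langle>ys\<rangle> q'"
  shows "p @ q \<approx>\<langle>xs\<rangle> p' @ q'"
  using assms run_append[of _ xs p ys q] run_append[of _ xs p' ys q']
  by (auto simp: weq_def wcod_append)

lemma weq_shift:
  assumes "p \<approx>\<langle>xs\<rangle> q"
  shows "shift (length us) p \<approx>\<langle>us @ xs @ vs\<rangle> shift (length us) q"
proof -
  obtain ys where "wcod xs p = Some ys" "wcod xs q = Some ys" using assms by (auto simp: weq_def)
  then show ?thesis
    using assms wcod_shift run_shift[of _ xs _ ys us vs] by (auto simp: weq_def)
qed

text \<open>One word is a section and the other a retraction of the same isomorphism, up to the
  given equality; inserting the one composite and cancelling the other identifies them.\<close>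

lemma weq_inverse_unique:
  assumes "p \<approx>\<langle>xs\<rangle> p'" "wcod xs p = Some ys" "q @ p \<approx>\<langle>ys\<rangle> []" "p' @ q' \<approx>\<langle>xs\<rangle> []"
    and q: "wcod ys q = Some xs"
  shows "q \<approx>\<langle>ys\<rangle> q'"
proof -
  have q': "wcod ys q' = Some xs" and p': "wcod xs p' = Some ys"
    using assms by (auto simp: weq_def wcod_append)
  have "q @ [] \<approx>\<langle>ys\<rangle> q @ p' @ q'"
    by (rule weq_append[OF weq_refl q weq_sym[OF assms(4)]]) (simp add: q)
  also have "q @ p' @ q' \<approx>\<langle>ys\<rangle> q @ p @ q'"
    by (rule weq_append[OF weq_refl q weq_append[OF weq_sym[OF assms(1)] p' weq_refl]])
      (simp_all add: q q')
  also have "\<dots> \<approx>\<langle>ys\<rangle> [] @ q'"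
    using weq_append[OF assms(3) _ weq_refl, of ys q'] q q' assms(2) by (simp add: wcod_append)
  finally show ?thesis by simp
qed


subsection \<open>Arrows denoted by words\<close>

lemma den_comp:
  assumes "den t u f p" "den u v g q"
  shows "den t v (g \<cdot> f) (p @ q)"
proof -
  have f: "f \<in> Arr C" "Dom C f = tob t" "Cod C f = tob u" "wcod (flat t) p = Some (flat u)"
    and g: "g \<in> Arr C" "Dom C g = tob u" "Cod C g = tob v" "wcod (flat u) q = Some (flat v)"
    using assms by (auto simp: den_def hom_iff)
  have "can v R \<cdot> ((g \<cdot> f) \<otimes> Id C R) = run (flat t) (p @ q) R \<cdot> can t R" if [simp]: "R \<in> Obj C" for R
  proof -
    note A = run_Arr[OF that f(4)] run_Arr[OF that g(4)]
    have "can v R \<cdot> ((g \<cdot> f) \<otimes> Id C R) = can v R \<cdot> (g \<otimes> Id C R) \<cdot> (f \<otimes> Id C R)"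
      using f g by simp
    also have "\<dots> = run (flat u) q R \<cdot> can u R \<cdot> (f \<otimes> Id C R)"
      using assms(2) f g A by (subst comp_cong[of _ _ "run (flat u) q R \<cdot> can u R"]) (auto simp: den_def)
    also have "can u R \<cdot> (f \<otimes> Id C R) = run (flat t) p R \<cdot> can t R"
      using assms(1) by (simp add: den_def)
    finally show ?thesis using A f g by (simp add: run_append[OF that f(4) g(4)])
  qed
  then show ?thesis using f g by (simp add: den_def hom_iff wcod_append)
qed

text \<open>In the word \<open>f\<close> acts before \<open>g\<close>, with the inputs of
  \<open>g\<close> waiting in the argument \<open>R\<close>; therefore \<open>g\<close> is shifted
  by the number of outputs of \<open>f\<close>, not of its inputs.\<close>

lemma den_tensor:
  assumes "den t u f p" "den t' u' g q"
  shows "den (t \<diamondop> t') (u \<diamondop> u') (f \<otimes> g) (p @ shift (length (flat u)) q)"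
proof -
  have f: "f \<in> Arr C" "Dom C f = tob t" "Cod C f = tob u" "wcod (flat t) p = Some (flat u)"
    and g: "g \<in> Arr C" "Dom C g = tob t'" "Cod C g = tob u'" "wcod (flat t') q = Some (flat u')"
    using assms by (auto simp: den_def hom_iff)
  have p: "wcod (flat t @ flat t') p = Some (flat u @ flat t')"
    using wcod_shift[OF f(4), of "[]" "flat t'"] by simp
  have q: "wcod (flat u @ flat t') (shift (length (flat u)) q) = Some (flat u @ flat u')"
    using wcod_shift[OF g(4), of "flat u" "[]"] by simp
  have "can (u \<diamondop> u') R \<cdot> ((f \<otimes> g) \<otimes> Id C R)
      = run (flat t @ flat t') (p @ shift (length (flat u)) q) R \<cdot> can (t \<diamondop> t') R"
    if [simp]: "R \<in> Obj C" for R
  proof -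
    let ?R = "act (flat t') R" and ?a = "assoc C (tob t) (tob t') R"
    note A [simp] = run_Arr[OF that g(4)] run_Arr[OF _ f(4), of ?R, simplified]
    have "can (u \<diamondop> u') R \<cdot> ((f \<otimes> g) \<otimes> Id C R)
        = can u (act (flat u') R) \<cdot> (Id C (tob u) \<otimes> can u' R) \<cdot> assoc C (tob u) (tob u') R \<cdot> ((f \<otimes> g) \<otimes> Id C R)"
      using f g by simp
    also have "\<dots> = can u (act (flat u') R) \<cdot> (f \<otimes> (can u' R \<cdot> (g \<otimes> Id C R))) \<cdot> ?a"
      using f g by (subst assoc_nat) simp_all
    also have "can u' R \<cdot> (g \<otimes> Id C R) = run (flat t') q R \<cdot> can t' R"
      using assms(2) by (simp add: den_def)
    also have "can u (act (flat u') R) \<cdot> (f \<otimes> (run (flat t') q R \<cdot> can t' R)) \<cdot> ?a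
        = can u (act (flat u') R) \<cdot> (Id C (tob u) \<otimes> run (flat t') q R) \<cdot> (f \<otimes> Id C ?R) \<cdot> (Id C (tob t) \<otimes> can t' R) \<cdot> ?a"
      using f g by simp
    also have "\<dots> = acta (flat u) (run (flat t') q R) \<cdot> can u ?R \<cdot> (f \<otimes> Id C ?R) \<cdot> (Id C (tob t) \<otimes> can t' R) \<cdot> ?a"
      using can_nat[of "run (flat t') q R" u] f g
      by (subst comp_cong[of _ _ "acta (flat u) (run (flat t') q R) \<cdot> can u ?R"]) simp_all
    also have "can u ?R \<cdot> (f \<otimes> Id C ?R) \<cdot> (Id C (tob t) \<otimes> can t' R) \<cdot> ?a
        = (run (flat t) p ?R \<cdot> can t ?R) \<cdot> (Id C (tob t) \<otimes> can t' R) \<cdot> ?a"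
      using assms(1) f by (intro comp_cong) (simp_all add: den_def)
    also have "acta (flat u) (run (flat t') q R) \<cdot> \<dots>
        = (acta (flat u) (run (flat t') q R) \<cdot> run (flat t) p ?R) \<cdot> can (t \<diamondop> t') R"
      by simp
    also have "acta (flat u) (run (flat t') q R) \<cdot> run (flat t) p ?R
        = run (flat t @ flat t') (p @ shift (length (flat u)) q) R"
      using run_append[OF that p q] run_shift[OF that g(4), of "flat u" "[]"]
        run_shift[OF that f(4), of "[]" "flat t'"] by simp
    finally show ?thesis .
  qed
  then show ?thesis using f g p q by (simp add: den_def hom_iff wcod_append)
qed

lemma den_id: "X = tob t \<Longrightarrow> den t t (Id C X) []"
  by (simp add: den_def hom_iff)

text \<open>That an associator denotes the empty word is the pentagon. In the same way the left unit
  constraint rests on \<open>lunit_tensor\<close>, and the right one is the triangle.\<close>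

lemma den_assoc:
  assumes [simp]: "X = tob t" "Y = tob u" "Z = tob v"
  shows "den ((t \<diamondop> u) \<diamondop> v) (t \<diamondop> (u \<diamondop> v)) (assoc C X Y Z) []"
proof -
  have "can (t \<diamondop> (u \<diamondop> v)) R \<cdot> (assoc C X Y Z \<otimes> Id C R) = can ((t \<diamondop> u) \<diamondop> v) R" if [simp]: "R \<in> Obj C" for R
  proof -
    let ?V = "act (flat v) R"
    have "can (t \<diamondop> (u \<diamondop> v)) R \<cdot> (assoc C X Y Z \<otimes> Id C R)
        = can t (act (flat u) ?V) \<cdot> (Id C X \<otimes> (can u ?V \<cdot> (Id C Y \<otimes> can v R))) \<cdot>
          ((Id C X \<otimes> assoc C Y Z R) \<cdot> assoc C X (Y \<boxtimes> Z) R \<cdot> (assoc C X Y Z \<otimes> Id C R))"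
      by simp
    also have "(Id C X \<otimes> assoc C Y Z R) \<cdot> assoc C X (Y \<boxtimes> Z) R \<cdot> (assoc C X Y Z \<otimes> Id C R)
        = assoc C X Y (Z \<boxtimes> R) \<cdot> assoc C (X \<boxtimes> Y) Z R"
      by (rule pentagon) simp_all
    also have "can t (act (flat u) ?V) \<cdot> (Id C X \<otimes> (can u ?V \<cdot> (Id C Y \<otimes> can v R))) \<cdot> \<dots>
       = can t (act (flat u) ?V) \<cdot> (Id C X \<otimes> can u ?V) \<cdot> (Id C X \<otimes> (Id C Y \<otimes> can v R)) \<cdot> \<dots>"
      by simp
    also have "(Id C X \<otimes> (Id C Y \<otimes> can v R)) \<cdot> assoc C X Y (Z \<boxtimes> R) \<cdot> assoc C (X \<boxtimes> Y) Z R
       = (assoc C X Y ?V \<cdot> ((Id C X \<otimes> Id C Y) \<otimes> can v R)) \<cdot> assoc C (X \<boxtimes> Y) Z R"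
      by (rule comp_cong) (simp_all add: assoc_nat del: tensor_id)
    finally show ?thesis by simp
  qed
  then show ?thesis by (simp add: den_def hom_iff)
qed

lemma den_lunit: "X = tob t \<Longrightarrow> den (Unit \<diamondop> t) t (lunit C X) []"
proof -
  assume [simp]: "X = tob t"
  have "can t R \<cdot> (lunit C X \<otimes> Id C R) = can (Unit \<diamondop> t) R" if [simp]: "R \<in> Obj C" for R
  proof -
    have "can t R \<cdot> (lunit C X \<otimes> Id C R) = (can t R \<cdot> lunit C (X \<boxtimes> R)) \<cdot> assoc C \<one> X R"
      by (simp add: lunit_tensor)
    also have "can t R \<cdot> lunit C (X \<boxtimes> R) = lunit C (act (flat t) R) \<cdot> (Id C \<one> \<otimes> can t R)"
      using lunit_nat[of "can t R"] by simp
    finally show ?thesis by simp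
  qed
  then show ?thesis by (simp add: den_def hom_iff)
qed

lemma den_runit: "X = tob t \<Longrightarrow> den (t \<diamondop> Unit) t (runit C X) []"
  by (simp add: den_def hom_iff triangle)

lemma den_cinv_coherence:
  assumes "den t u f []" "is_iso C f"
  shows "den u t (cinv C f) []"
proof -
  have f: "f \<in> Arr C" "Dom C f = tob t" "Cod C f = tob u" "flat u = flat t"
    using assms by (auto simp: den_def hom_iff)
  have "can t R \<cdot> (cinv C f \<otimes> Id C R) = can u R" if [simp]: "R \<in> Obj C" for R
  proof -
    have "can t R = can u R \<cdot> (f \<otimes> Id C R)" using assms(1) by (simp add: den_def)
    then show ?thesis using f assms(2) by simp
  qed
  then show ?thesis using f assms(2) by (simp add: den_def hom_iff)
qed

lemma den_coherence:
  assumes "X = tob t" "Y = tob u" "Z = tob v"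
  shows "den (t \<diamondop> (u \<diamondop> v)) ((t \<diamondop> u) \<diamondop> v) (cinv C (assoc C X Y Z)) []"
    and "den t (Unit \<diamondop> t) (cinv C (lunit C X)) []"
    and "den t (t \<diamondop> Unit) (cinv C (runit C X)) []"
  using assms by (auto intro!: den_cinv_coherence den_assoc den_lunit den_runit)

lemma den_gen: "den (src g) (tgt g) (ar g) [(g, 0)]"
  by (auto simp: den_def fam_def ar_hom)

lemma den_braid: "X = tob t \<Longrightarrow> Y = tob u \<Longrightarrow> den (t \<diamondop> u) (u \<diamondop> t) (braid C X Y) [(Br t u, 0)]"
  using den_gen[of "Br t u"] by (simp add: ar_Br)

lemma weq_den:
  assumes "den t u f p" "den t u f q"
  shows "p \<approx>\<langle>flat t\<rangle> q"
proof -
  have w: "wcod (flat t) p = Some (flat u)" "wcod (flat t) q = Some (flat u)"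
    using assms by (auto simp: den_def)
  have "run (flat t) p R = run (flat t) q R" if [simp]: "R \<in> Obj C" for R
  proof (rule iso_cancel_right[of "can t R"])
    show "run (flat t) p R \<cdot> can t R = run (flat t) q R \<cdot> can t R"
      using assms by (simp add: den_def)
  qed (use run_Arr[OF that w(1)] run_Arr[OF that w(2)] in simp_all)
  then show ?thesis using w by (simp add: weq_def)
qed

text \<open>The component at the unit object determines the arrow, because tensoring with the unit
  object is faithful.\<close>

lemma den_eqI:
  assumes "den t u f p" "den t u g q" "p \<approx>\<langle>flat t\<rangle> q"
  shows "f = g"
proof -
  have hom: "f \<in> hom C (tob t) (tob u)" "g \<in> hom C (tob t) (tob u)"
    using assms by (auto simp: den_def)
  have "can u \<one> \<cdot> (f \<otimes> Id C \<one>) = can u \<one> \<cdot> (g \<otimes> Id C \<one>)"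
    using assms by (simp add: den_def weq_def)
  then have "f \<otimes> Id C \<one> = g \<otimes> Id C \<one>"
    by (rule iso_cancel_left[rotated -1]) (use hom in \<open>auto simp: hom_iff\<close>)
  with hom show ?thesis by (rule tensor_unit_faithful)
qed

lemmas den_intros = den_comp den_tensor den_id den_assoc den_coherence den_lunit den_runit den_braid


subsection \<open>The braiding\<close>

lemma Br_inv_right: "[(Br t u, 0), (Br_inv t u, 0)] \<approx>\<langle>flat t @ flat u\<rangle> []"
proof -
  have "den (t \<diamondop> u) (t \<diamondop> u) (ar (Br_inv t u) \<cdot> ar (Br t u)) [(Br t u, 0), (Br_inv t u, 0)]"
    using den_comp[OF den_gen[of "Br t u"]] den_gen[of "Br_inv t u"] by fastforce
  moreover have "ar (Br_inv t u) \<cdot> ar (Br t u) = Id C (tob (t \<diamondop> u))"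
    using ar_Arr[of "Br t u"] braid_iso[of "tob t" "tob u"] by (simp add: ar_Br ar_Br_inv)
  ultimately show ?thesis using weq_den[OF _ den_id, of "t \<diamondop> u"] by fastforce
qed

lemma Br_inv_left: "[(Br_inv t u, 0), (Br t u, 0)] \<approx>\<langle>flat u @ flat t\<rangle> []"
proof -
  have "den (u \<diamondop> t) (u \<diamondop> t) (ar (Br t u) \<cdot> ar (Br_inv t u)) [(Br_inv t u, 0), (Br t u, 0)]"
    using den_comp[OF den_gen[of "Br_inv t u"]] den_gen[of "Br t u"] by fastforce
  moreover have "ar (Br t u) \<cdot> ar (Br_inv t u) = Id C (tob (u \<diamondop> t))"
    using ar_Arr[of "Br t u"] braid_iso[of "tob t" "tob u"] by (simp add: ar_Br ar_Br_inv)
  ultimately show ?thesis using weq_den[OF _ den_id, of "u \<diamondop> t"] by fastforce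
qed

lemma Br_nat:
  assumes "den t t' f p" "den u u' g q"
  shows "p @ shift (length (flat t')) q @ [(Br t' u', 0)]
    \<approx>\<langle>flat t @ flat u\<rangle> [(Br t u, 0)] @ q @ shift (length (flat u')) p"
proof -
  have "f \<in> hom C (tob t) (tob t')" "g \<in> hom C (tob u) (tob u')"
    using assms by (auto simp: den_def)
  then have "braid C (tob t') (tob u') \<cdot> (f \<otimes> g) = (g \<otimes> f) \<cdot> braid C (tob t) (tob u)"
    by (rule braid_natural)
  moreover have "den (t \<diamondop> u) (u' \<diamondop> t') (braid C (tob t') (tob u') \<cdot> (f \<otimes> g))
      ((p @ shift (length (flat t')) q) @ [(Br t' u', 0)])"
    by (rule den_comp den_tensor den_braid assms refl)+
  moreover have "den (t \<diamondop> u) (u' \<diamondop> t') ((g \<otimes> f) \<cdot> braid C (tob t) (tob u))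
      ([(Br t u, 0)] @ q @ shift (length (flat u')) p)"
    by (rule den_comp den_tensor den_braid assms refl)+
  ultimately show ?thesis using weq_den by fastforce
qed

text \<open>The hexagon, with its associators denoting empty words.\<close>

lemma Br_Node_right: "[(Br t (u \<diamondop> v), 0)] \<approx>\<langle>flat t @ flat u @ flat v\<rangle> [(Br t u, 0), (Br t v, length (flat u))]"
proof -
  have "den ((t \<diamondop> u) \<diamondop> v) (u \<diamondop> (v \<diamondop> t))
      (assoc C (tob u) (tob v) (tob t) \<cdot> braid C (tob t) (tob (u \<diamondop> v)) \<cdot> assoc C (tob t) (tob u) (tob v))
      (([] @ [(Br t (u \<diamondop> v), 0)]) @ [])"
    by (rule den_comp den_assoc den_braid refl)+
  moreover have "den ((t \<diamondop> u) \<diamondop> v) (u \<diamondop> (v \<diamondop> t))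
      ((Id C (tob u) \<otimes> braid C (tob t) (tob v)) \<cdot> assoc C (tob u) (tob t) (tob v) \<cdot> (braid C (tob t) (tob u) \<otimes> Id C (tob v)))
      ((([(Br t u, 0)] @ shift (length (flat (u \<diamondop> t))) []) @ []) @ ([] @ shift (length (flat u)) [(Br t v, 0)]))"
    by (rule den_comp den_assoc den_tensor den_id den_braid refl)+
  ultimately show ?thesis
    using hexagon[of "tob t" "tob u" "tob v"] weq_den by fastforce
qed

lemma Br_Node_left: "[(Br (t \<diamondop> u) v, 0)] \<approx>\<langle>flat t @ flat u @ flat v\<rangle> [(Br u v, length (flat t)), (Br t v, 0)]"
proof -
  have "den (t \<diamondop> (u \<diamondop> v)) ((v \<diamondop> t) \<diamondop> u)
      (cinv C (assoc C (tob v) (tob t) (tob u)) \<cdot> braid C (tob (t \<diamondop> u)) (tob v) \<cdot> cinv C (assoc C (tob t) (tob u) (tob v)))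
      (([] @ [(Br (t \<diamondop> u) v, 0)]) @ [])"
    by (rule den_comp den_coherence(1) den_braid refl)+
  moreover have "den (t \<diamondop> (u \<diamondop> v)) ((v \<diamondop> t) \<diamondop> u)
      ((braid C (tob t) (tob v) \<otimes> Id C (tob u)) \<cdot> cinv C (assoc C (tob t) (tob v) (tob u)) \<cdot> (Id C (tob t) \<otimes> braid C (tob u) (tob v)))
      ((([] @ shift (length (flat t)) [(Br u v, 0)]) @ []) @ ([(Br t v, 0)] @ shift (length (flat (v \<diamondop> t))) []))"
    by (rule den_comp den_coherence(1) den_tensor den_id den_braid refl)+
  ultimately show ?thesis
    using hexagon_inv[of "tob t" "tob u" "tob v"] weq_den by fastforce
qed

text \<open>Naturality along the unit constraint for two copies of the unit object, together with
  the hexagon, makes this braiding idempotent; an invertible idempotent is the identity.\<close>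

lemma Br_Unit_right: "[(Br t Unit, 0)] \<approx>\<langle>flat t\<rangle> []"
proof -
  let ?b = "[(Br t Unit, 0)]" and ?i = "[(Br_inv t Unit, 0)]"
  have "den (Unit \<diamondop> Unit) Unit (lunit C \<one>) []" by (rule den_lunit) simp
  from Br_nat[OF den_id[OF refl, of t] this] have "?b \<approx>\<langle>flat t\<rangle> [(Br t (Unit \<diamondop> Unit), 0)]" by simp
  also have "\<dots> \<approx>\<langle>flat t\<rangle> ?b @ ?b" using Br_Node_right[of t Unit Unit] by simp
  finally have b: "?b \<approx>\<langle>flat t\<rangle> ?b @ ?b" .
  have i: "?b @ ?i \<approx>\<langle>flat t\<rangle> []" using Br_inv_right[of t Unit] by simp
  have w: "wcod (flat t) ?b = Some (flat t)" "wcod (flat t) ?i = Some (flat t)" by simp_all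
  have "[] \<approx>\<langle>flat t\<rangle> ?b @ ?i" by (rule weq_sym[OF i])
  also have "\<dots> \<approx>\<langle>flat t\<rangle> (?b @ ?b) @ ?i" by (rule weq_append[OF b w(1) weq_refl]) (simp add: w)
  also have "(?b @ ?b) @ ?i = ?b @ (?b @ ?i)" by simp
  also have "\<dots> \<approx>\<langle>flat t\<rangle> ?b @ []" by (rule weq_append[OF weq_refl w(1) i]) (simp add: w)
  finally show ?thesis by (auto dest: weq_sym)
qed

lemma Br_Unit_left: "[(Br Unit t, 0)] \<approx>\<langle>flat t\<rangle> []"
proof -
  let ?b = "[(Br Unit t, 0)]" and ?i = "[(Br_inv Unit t, 0)]"
  have "den (Unit \<diamondop> Unit) Unit (lunit C \<one>) []" by (rule den_lunit) simp
  from Br_nat[OF this den_id[OF refl, of t]] have "?b \<approx>\<langle>flat t\<rangle> [(Br (Unit \<diamondop> Unit) t, 0)]" by simp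
  also have "\<dots> \<approx>\<langle>flat t\<rangle> ?b @ ?b" using Br_Node_left[of Unit Unit t] by simp
  finally have b: "?b \<approx>\<langle>flat t\<rangle> ?b @ ?b" .
  have i: "?b @ ?i \<approx>\<langle>flat t\<rangle> []" using Br_inv_right[of Unit t] by simp
  have w: "wcod (flat t) ?b = Some (flat t)" "wcod (flat t) ?i = Some (flat t)" by simp_all
  have "[] \<approx>\<langle>flat t\<rangle> ?b @ ?i" by (rule weq_sym[OF i])
  also have "\<dots> \<approx>\<langle>flat t\<rangle> (?b @ ?b) @ ?i" by (rule weq_append[OF b w(1) weq_refl]) (simp add: w)
  also have "(?b @ ?b) @ ?i = ?b @ (?b @ ?i)" by simp
  also have "\<dots> \<approx>\<langle>flat t\<rangle> ?b @ []" by (rule weq_append[OF weq_refl w(1) i]) (simp add: w)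
  finally show ?thesis by (auto dest: weq_sym)
qed

lemma Br_inv_Node_left:
  "[(Br_inv (t \<diamondop> u) v, 0)]
    \<approx>\<langle>flat v @ flat t @ flat u\<rangle> [(Br_inv t v, 0),
    (Br_inv u v, length (flat t))]"
proof (rule weq_inverse_unique[OF Br_Node_left])
  let ?t = "flat t" and ?u = "flat u" and ?v = "flat v"
  let ?p = "[(Br t v, 0), (Br_inv t v, 0)]"
  have p: "?p \<approx>\<langle>?t @ ?v @ ?u\<rangle> []"
    using weq_shift[OF Br_inv_right[of t v], of "[]" ?u] by simp
  have "[(Br u v, length ?t)] @ ?p @ [(Br_inv u v, length ?t)]
      \<approx>\<langle>?t @ ?u @ ?v\<rangle> [(Br u v, length ?t)] @ [] @ [(Br_inv u v, length ?t)]"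
    by (rule weq_append[OF weq_refl _ weq_append[OF p _ weq_refl]]) simp+
  also have "\<dots> \<approx>\<langle>?t @ ?u @ ?v\<rangle> []"
    using weq_shift[OF Br_inv_right[of u v], of ?t "[]"] by simp
  finally show "[(Br u v, length ?t), (Br t v, 0)] @ [(Br_inv t v, 0), (Br_inv u v, length ?t)]
      \<approx>\<langle>?t @ ?u @ ?v\<rangle> []"
    by simp
qed (use Br_inv_left[of "t \<diamondop> u" v] in simp_all)

lemma Br_inv_Node_right:
  "[(Br_inv t (u \<diamondop> v), 0)]
    \<approx>\<langle>flat u @ flat v @ flat t\<rangle> [(Br_inv t v, length (flat u)),
    (Br_inv t u, 0)]"
proof (rule weq_inverse_unique[OF Br_Node_right])
  let ?t = "flat t" and ?u = "flat u" and ?v = "flat v"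
  let ?p = "[(Br t v, length ?u), (Br_inv t v, length ?u)]"
  have p: "?p \<approx>\<langle>?u @ ?t @ ?v\<rangle> []"
    using weq_shift[OF Br_inv_right[of t v], of ?u "[]"] by simp
  have "[(Br t u, 0)] @ ?p @ [(Br_inv t u, 0)] \<approx>\<langle>?t @ ?u @ ?v\<rangle> [(Br t u, 0)] @ [] @ [(Br_inv t u, 0)]"
    by (rule weq_append[OF weq_refl _ weq_append[OF p _ weq_refl]]) simp+
  also have "\<dots> \<approx>\<langle>?t @ ?u @ ?v\<rangle> []"
    using weq_shift[OF Br_inv_right[of t u], of "[]" ?v] by simp
  finally show "[(Br t u, 0), (Br t v, length ?u)] @ [(Br_inv t v, length ?u), (Br_inv t u, 0)]
      \<approx>\<langle>?t @ ?u @ ?v\<rangle> []"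
    by simp
qed (use Br_inv_left[of t "u \<diamondop> v"] in simp_all)

lemma Br_inv_Unit_right: "[(Br_inv t Unit, 0)] \<approx>\<langle>flat t\<rangle> []"
  by (rule weq_inverse_unique[OF Br_Unit_right, where q' = "[]"])
    (use Br_inv_left[of t Unit] in \<open>simp_all add: weq_refl\<close>)

lemma Br_inv_Unit_left: "[(Br_inv Unit t, 0)] \<approx>\<langle>flat t\<rangle> []"
  by (rule weq_inverse_unique[OF Br_Unit_left, where q' = "[]"])
    (use Br_inv_left[of Unit t] in \<open>simp_all add: weq_refl\<close>)

lemma Br_over: "[(Br t u, 0)] \<approx>\<langle>flat t @ flat u\<rangle> over t u"
proof (induction u)
  case (Node u v)
  let ?t = "flat t" and ?u = "flat u" and ?v = "flat v"
  have 1: "[(Br t u, 0)] \<approx>\<langle>?t @ ?u @ ?v\<rangle> over t u"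
    using weq_shift[OF Node.IH(1), of "[]" ?v] by simp
  have 2: "[(Br t v, length ?u)] \<approx>\<langle>?u @ ?t @ ?v\<rangle> shift (length ?u) (over t v)"
    using weq_shift[OF Node.IH(2), of ?u "[]"] by simp
  show ?case using weq_trans[OF Br_Node_right weq_append[OF 1 _ 2, simplified]] by simp
qed (auto simp: weq_refl Br_Unit_right)

lemma Br_under: "[(Br u t, 0)] \<approx>\<langle>flat u @ flat t\<rangle> under t u"
proof (induction u)
  case (Node u v)
  let ?t = "flat t" and ?u = "flat u" and ?v = "flat v"
  have 1: "[(Br v t, length ?u)] \<approx>\<langle>?u @ ?v @ ?t\<rangle> shift (length ?u) (under t v)"
    using weq_shift[OF Node.IH(2), of ?u "[]"] by simp
  have 2: "[(Br u t, 0)] \<approx>\<langle>?u @ ?t @ ?v\<rangle> under t u"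
    using weq_shift[OF Node.IH(1), of "[]" ?v] by simp
  show ?case using weq_trans[OF Br_Node_left weq_append[OF 1 _ 2, simplified]] by simp
qed (auto simp: weq_refl Br_Unit_left)

lemma Br_over_inv: "[(Br_inv u t, 0)] \<approx>\<langle>flat t @ flat u\<rangle> over_inv t u"
proof (induction u)
  case (Node u v)
  let ?t = "flat t" and ?u = "flat u" and ?v = "flat v"
  have 1: "[(Br_inv u t, 0)] \<approx>\<langle>?t @ ?u @ ?v\<rangle> over_inv t u"
    using weq_shift[OF Node.IH(1), of "[]" ?v] by simp
  have 2: "[(Br_inv v t, length ?u)] \<approx>\<langle>?u @ ?t @ ?v\<rangle> shift (length ?u) (over_inv t v)"
    using weq_shift[OF Node.IH(2), of ?u "[]"] by simp
  show ?case using weq_trans[OF Br_inv_Node_left weq_append[OF 1 _ 2, simplified]] by simp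
qed (auto simp: weq_refl Br_inv_Unit_left Br_inv_Unit_right)

lemma Br_under_inv: "[(Br_inv t u, 0)] \<approx>\<langle>flat u @ flat t\<rangle> under_inv t u"
proof (induction u)
  case (Node u v)
  let ?t = "flat t" and ?u = "flat u" and ?v = "flat v"
  have 1: "[(Br_inv t v, length ?u)] \<approx>\<langle>?u @ ?v @ ?t\<rangle> shift (length ?u) (under_inv t v)"
    using weq_shift[OF Node.IH(2), of ?u "[]"] by simp
  have 2: "[(Br_inv t u, 0)] \<approx>\<langle>?u @ ?t @ ?v\<rangle> under_inv t u"
    using weq_shift[OF Node.IH(1), of "[]" ?v] by simp
  show ?case using weq_trans[OF Br_inv_Node_right weq_append[OF 1 _ 2, simplified]] by simp
qed (auto simp: weq_refl Br_inv_Unit_left Br_inv_Unit_right)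

lemma Br_gen_right: "[(g, length (flat t)), (Br t (tgt g), 0)] \<approx>\<langle>flat t @ ins g\<rangle> [(Br t (src g), 0), (g, 0)]"
  using Br_nat[OF den_id[OF refl, of t] den_gen[of g]] by simp

lemma Br_gen_left: "[(g, 0), (Br (tgt g) t, 0)] \<approx>\<langle>ins g @ flat t\<rangle> [(Br (src g) t, 0), (g, length (flat t))]"
  using Br_nat[OF den_gen[of g] den_id[OF refl, of t]] by simp

text \<open>Compose the naturality square with the inverse crossings at both ends. The layers
  \<open>s\<close> and \<open>s'\<close> are left abstract so that the lemma serves generators on
  either side of the strand.\<close>

lemma Br_inv_gen:
  assumes "[s, (Br t u, 0)] \<approx>\<langle>flat t' @ flat u'\<rangle> [(Br t' u', 0), s']"
    and w: "wcod (flat t' @ flat u') [s] = Some (flat t @ flat u)"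
      "wcod (flat u' @ flat t') [s'] = Some (flat u @ flat t)"
  shows "[s', (Br_inv t u, 0)] \<approx>\<langle>flat u' @ flat t'\<rangle> [(Br_inv t' u', 0), s]"
proof -
  let ?i = "(Br_inv t' u', 0)" and ?b = "(Br t u, 0)" and ?b' = "(Br t' u', 0)" and ?j = "(Br_inv t u, 0)"
  have wi: "wcod (flat u' @ flat t') [?i] = Some (flat t' @ flat u')"
    and wj: "wcod (flat u @ flat t) [?j] = Some (flat t @ flat u)"
    using wcod_at'[of "[]" 0 "Br_inv t' u'" "[]" "[]"] wcod_at'[of "[]" 0 "Br_inv t u" "[]" "[]"] by simp_all
  have "[] @ [s', ?j] \<approx>\<langle>flat u' @ flat t'\<rangle> [?i, ?b'] @ [s', ?j]"
    by (rule weq_append[OF weq_sym[OF Br_inv_left] _ weq_refl])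
      (use w wj wcod_append[of "flat u' @ flat t'" "[s']" "[?j]"] in auto)
  also have "[?i, ?b'] @ [s', ?j] = [?i] @ [?b', s'] @ [?j]" by simp
  also have "\<dots> \<approx>\<langle>flat u' @ flat t'\<rangle> [?i] @ [s, ?b] @ [?j]"
    by (rule weq_append[OF weq_refl wi weq_append[OF weq_sym[OF assms(1)] _ weq_refl]])
      (use w wi wj assms(1) wcod_append[of "flat t' @ flat u'" "[?b']" "[s']"] in \<open>auto simp: weq_def\<close>)
  also have "\<dots> = [?i, s] @ [?b, ?j]" by simp
  also have "\<dots> \<approx>\<langle>flat u' @ flat t'\<rangle> [?i, s] @ []"
    by (rule weq_append[OF weq_refl _ Br_inv_right])
      (use w wi wcod_append[of "flat u' @ flat t'" "[?i]" "[s]"] in auto)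
  finally show ?thesis by simp
qed

text \<open>Naturality of the braiding in terms of crossings of the bundle strand by strand, the
  form in which it matches concrete words. For \<open>g\<close> a crossing it is the braid
  relation.\<close>

lemma slide_over: "(g, length (flat t)) # over t (tgt g) \<approx>\<langle>flat t @ ins g\<rangle> over t (src g) @ [(g, 0)]"
proof -
  have "[(g, length (flat t))] @ over t (tgt g) \<approx>\<langle>flat t @ ins g\<rangle> [(g, length (flat t))] @ [(Br t (tgt g), 0)]"
    by (rule weq_append[OF weq_refl _ weq_sym[OF Br_over]]) simp+
  also have "\<dots>
    \<approx>\<langle>flat t @ ins g\<rangle> [(Br t (src g), 0)] @ [(g, 0)]" using Br_gen_right by simp
  also have "\<dots> \<approx>\<langle>flat t @ ins g\<rangle> over t (src g) @ [(g, 0)]"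
    by (rule weq_append[OF Br_over _ weq_refl]) simp+
  finally show ?thesis by simp
qed

lemma slide_under: "(g, 0) # under t (tgt g) \<approx>\<langle>ins g @ flat t\<rangle> under t (src g) @ [(g, length (flat t))]"
proof -
  have "[(g, 0)] @ under t (tgt g) \<approx>\<langle>ins g @ flat t\<rangle> [(g, 0)] @ [(Br (tgt g) t, 0)]"
    by (rule weq_append[OF weq_refl _ weq_sym[OF Br_under]]) simp+
  also have "\<dots>
    \<approx>\<langle>ins g @ flat t\<rangle> [(Br (src g) t, 0)] @ [(g, length (flat t))]" using Br_gen_left by simp
  also have "\<dots> \<approx>\<langle>ins g @ flat t\<rangle> under t (src g) @ [(g, length (flat t))]"
    by (rule weq_append[OF Br_under _ weq_refl]) simp+
  finally show ?thesis by simp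
qed

lemma slide_over_inv:
  "(g, length (flat t)) # over_inv t (tgt g) \<approx>\<langle>flat t @ ins g\<rangle> over_inv t (src g) @ [(g, 0)]"
proof -
  have "[(g, length (flat t))] @ over_inv t (tgt g)
      \<approx>\<langle>flat t @ ins g\<rangle> [(g, length (flat t))] @ [(Br_inv (tgt g) t, 0)]"
    by (rule weq_append[OF weq_refl _ weq_sym[OF Br_over_inv]]) simp+
  also have "\<dots> \<approx>\<langle>flat t @ ins g\<rangle> [(Br_inv (src g) t, 0)] @ [(g, 0)]"
    using Br_inv_gen[OF Br_gen_left[of g t]] by simp
  also have "\<dots> \<approx>\<langle>flat t @ ins g\<rangle> over_inv t (src g) @ [(g, 0)]"
    by (rule weq_append[OF Br_over_inv _ weq_refl]) simp+
  finally show ?thesis by simp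
qed

lemma slide_under_inv:
  "(g, 0) # under_inv t (tgt g) \<approx>\<langle>ins g @ flat t\<rangle> under_inv t (src g) @ [(g, length (flat t))]"
proof -
  have "[(g, 0)] @ under_inv t (tgt g) \<approx>\<langle>ins g @ flat t\<rangle> [(g, 0)] @ [(Br_inv t (tgt g), 0)]"
    by (rule weq_append[OF weq_refl _ weq_sym[OF Br_under_inv]]) simp+
  also have "\<dots>
    \<approx>\<langle>ins g @ flat t\<rangle> [(Br_inv t (src g), 0)] @ [(g, length (flat t))]"
    using Br_inv_gen[OF Br_gen_right[of g t]] by simp
  also have "\<dots> \<approx>\<langle>ins g @ flat t\<rangle> under_inv t (src g) @ [(g, length (flat t))]"
    by (rule weq_append[OF Br_under_inv _ weq_refl]) simp+
  finally show ?thesis by simp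
qed

end


section \<open>Diagrammatic calculus in a braided Hopf algebra\<close>

abbreviation B :: gen where "B \<equiv> Br (Leaf Hc) (Leaf Hc)"
abbreviation B' :: gen where "B' \<equiv> Br_inv (Leaf Hc) (Leaf Hc)"

context diagram
begin

lemma den_gens:
  "den (Leaf Hc \<diamondop> Leaf Hc) (Leaf Hc) (ar Mu) [(Mu, 0)]"
  "den Unit (Leaf Hc) (ar Eta) [(Eta, 0)]"
  "den (Leaf Hc) (Leaf Hc \<diamondop> Leaf Hc) (ar Delta) [(Delta, 0)]"
  "den (Leaf Hc) Unit (ar Eps) [(Eps, 0)]"
  "den (Leaf Hc) (Leaf Hc) (ar Ant) [(Ant, 0)]"
  "den (Leaf Hc) (Leaf Hc) (ar Ant_inv) [(Ant_inv, 0)]"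
  "den Unit (Leaf Hc) (ar Lam) [(Lam, 0)]"
  "den (Leaf Hc) Unit (ar Itg) [(Itg, 0)]"
  "den (Leaf c \<diamondop> Leaf Hc) Unit (ar (Ev c)) [(Ev c, 0)]"
  "den Unit (Leaf Hc \<diamondop> Leaf c) (ar (Coev c)) [(Coev c, 0)]"
  using den_gen[of Mu] den_gen[of Eta] den_gen[of Delta] den_gen[of Eps] den_gen[of Ant]
    den_gen[of Ant_inv] den_gen[of Lam] den_gen[of Itg] den_gen[of "Ev c"] den_gen[of "Coev c"]
  by simp_all

lemma den_cong: "den t u f p \<Longrightarrow> p = q \<Longrightarrow> den t u f q"
  by simp

text \<open>The words \<open>p\<close> and \<open>q\<close> are synthesised from the shape of the
  two arrows by the introduction rules for \<open>den\<close>, and come with shifts and empty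
  pieces; the separate equations to \<open>p'\<close> and \<open>q'\<close> let them be simplified
  afterwards.\<close>

lemma weq_of_eq:
  assumes "f = g" "den t u f p" "den t u g q" "flat t = xs" "p = p'" "q = q'"
  shows "p' \<approx>\<langle>xs\<rangle> q'"
  using assms weq_den by blast

lemma den_middle_braid:
  assumes "X = ob c"
  shows "den ((Leaf c \<diamondop> Leaf c) \<diamondop> (Leaf c \<diamondop> Leaf c)) ((Leaf c \<diamondop> Leaf c) \<diamondop> (Leaf c \<diamondop> Leaf c))
    (middle_braid C X) [(Br (Leaf c) (Leaf c), 1)]"
  unfolding middle_braid_def assms
  by (rule den_cong, (rule den_intros | (simp; fail))+)

end

locale hopf_diagram = diagram +
  assumes hopf: "hopf_algebra C \<lparr>hobj = ob Hc, hmult = ar Mu, hunit = ar Eta, hcomult = ar Delta,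
    hcounit = ar Eps, hantipode = ar Ant\<rparr>"
begin

lemmas hopf_axioms = hopf[unfolded hopf_algebra_def Let_def algebra_def coalgebra_def, simplified]

text \<open>The axioms of a Hopf algebra are translated into words, here and in the next lemmas;
  associators and unit constraints disappear in the process.\<close>

lemma
  shows mu_assoc: "[(Mu, 0), (Mu, 0)] \<approx>\<langle>[Hc, Hc, Hc]\<rangle> [(Mu, 1), (Mu, 0)]"
    and eta_left: "[(Eta, 0), (Mu, 0)] \<approx>\<langle>[Hc]\<rangle> []"
    and eta_right: "[(Eta, 1), (Mu, 0)] \<approx>\<langle>[Hc]\<rangle> []"
proof -
  let ?h = "Leaf Hc" and ?X = "ob Hc"
  have "ar Mu \<cdot> (ar Mu \<otimes> Id C ?X) = ar Mu \<cdot> (Id C ?X \<otimes> ar Mu) \<cdot> assoc C ?X ?X ?X"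
    using hopf_axioms by simp
  from weq_of_eq[OF this, where t = "(?h \<diamondop> ?h) \<diamondop> ?h"]
  show "[(Mu, 0), (Mu, 0)] \<approx>\<langle>[Hc, Hc, Hc]\<rangle> [(Mu, 1), (Mu, 0)]"
    by this ((rule den_intros den_gens | (simp; fail))+)
  have "ar Mu \<cdot> (ar Eta \<otimes> Id C ?X) = lunit C ?X"
    using hopf_axioms by simp
  from weq_of_eq[OF this, where t = "Unit \<diamondop> ?h"]
  show "[(Eta, 0), (Mu, 0)] \<approx>\<langle>[Hc]\<rangle> []"
    by this ((rule den_intros den_gens | (simp; fail))+)
  have "ar Mu \<cdot> (Id C ?X \<otimes> ar Eta) = runit C ?X"
    using hopf_axioms by simp
  from weq_of_eq[OF this, where t = "?h \<diamondop> Unit"]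
  show "[(Eta, 1), (Mu, 0)] \<approx>\<langle>[Hc]\<rangle> []"
    by this ((rule den_intros den_gens | (simp; fail))+)
qed

lemma
  shows delta_coassoc: "[(Delta, 0), (Delta, 0)] \<approx>\<langle>[Hc]\<rangle> [(Delta, 0), (Delta, 1)]"
    and eps_left: "[(Delta, 0), (Eps, 0)] \<approx>\<langle>[Hc]\<rangle> []"
    and eps_right: "[(Delta, 0), (Eps, 1)] \<approx>\<langle>[Hc]\<rangle> []"
proof -
  let ?h = "Leaf Hc" and ?X = "ob Hc"
  have "assoc C ?X ?X ?X \<cdot> (ar Delta \<otimes> Id C ?X) \<cdot> ar Delta = (Id C ?X \<otimes> ar Delta) \<cdot> ar Delta"
    using hopf_axioms by simp
  from weq_of_eq[OF this, where t = ?h]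
  show "[(Delta, 0), (Delta, 0)] \<approx>\<langle>[Hc]\<rangle> [(Delta, 0), (Delta, 1)]"
    by this ((rule den_intros den_gens | (simp; fail))+)
  have "lunit C ?X \<cdot> (ar Eps \<otimes> Id C ?X) \<cdot> ar Delta = Id C ?X"
    using hopf_axioms by simp
  from weq_of_eq[OF this, where t = ?h]
  show "[(Delta, 0), (Eps, 0)] \<approx>\<langle>[Hc]\<rangle> []"
    by this ((rule den_intros den_gens | (simp; fail))+)
  have "runit C ?X \<cdot> (Id C ?X \<otimes> ar Eps) \<cdot> ar Delta = Id C ?X"
    using hopf_axioms by simp
  from weq_of_eq[OF this, where t = ?h]
  show "[(Delta, 0), (Eps, 1)] \<approx>\<langle>[Hc]\<rangle> []"
    by this ((rule den_intros den_gens | (simp; fail))+)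
qed

lemma
  shows delta_mu: "[(Mu, 0), (Delta, 0)] \<approx>\<langle>[Hc, Hc]\<rangle> [(Delta, 0), (Delta, 2), (B, 1), (Mu, 0), (Mu, 1)]"
    and delta_eta: "[(Eta, 0), (Delta, 0)] \<approx>\<langle>[]\<rangle> [(Eta, 0), (Eta, 1)]"
    and eps_mu: "[(Mu, 0), (Eps, 0)] \<approx>\<langle>[Hc, Hc]\<rangle> [(Eps, 0), (Eps, 0)]"
    and eps_eta: "[(Eta, 0), (Eps, 0)] \<approx>\<langle>[]\<rangle> []"
proof -
  let ?h = "Leaf Hc" and ?X = "ob Hc"
  have "ar Delta \<cdot> ar Mu = (ar Mu \<otimes> ar Mu) \<cdot> middle_braid C ?X \<cdot> (ar Delta \<otimes> ar Delta)"
    using hopf_axioms by simp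
  from weq_of_eq[OF this, where t = "?h \<diamondop> ?h"]
  show "[(Mu, 0), (Delta, 0)] \<approx>\<langle>[Hc, Hc]\<rangle> [(Delta, 0), (Delta, 2), (B, 1), (Mu, 0), (Mu, 1)]"
    by this ((rule den_intros den_gens den_middle_braid | (simp; fail))+)
  have "ar Delta \<cdot> ar Eta = (ar Eta \<otimes> ar Eta) \<cdot> cinv C (lunit C \<one>)"
    using hopf_axioms by simp
  from weq_of_eq[OF this, where t = Unit]
  show "[(Eta, 0), (Delta, 0)] \<approx>\<langle>[]\<rangle> [(Eta, 0), (Eta, 1)]"
    by this ((rule den_intros den_gens | (simp; fail))+)
  have "ar Eps \<cdot> ar Mu = lunit C \<one> \<cdot> (ar Eps \<otimes> ar Eps)"
    using hopf_axioms by simp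
  from weq_of_eq[OF this, where t = "?h \<diamondop> ?h"]
  show "[(Mu, 0), (Eps, 0)] \<approx>\<langle>[Hc, Hc]\<rangle> [(Eps, 0), (Eps, 0)]"
    by this ((rule den_intros den_gens | (simp; fail))+)
  have "ar Eps \<cdot> ar Eta = Id C \<one>"
    using hopf_axioms by simp
  from weq_of_eq[OF this, where t = Unit]
  show "[(Eta, 0), (Eps, 0)] \<approx>\<langle>[]\<rangle> []"
    by this ((rule den_intros den_gens | (simp; fail))+)
qed

lemma
  shows ant_left: "[(Delta, 0), (Ant, 0), (Mu, 0)] \<approx>\<langle>[Hc]\<rangle> [(Eps, 0), (Eta, 0)]"
    and ant_right: "[(Delta, 0), (Ant, 1), (Mu, 0)] \<approx>\<langle>[Hc]\<rangle> [(Eps, 0), (Eta, 0)]"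
proof -
  let ?h = "Leaf Hc" and ?X = "ob Hc"
  have "ar Mu \<cdot> (ar Ant \<otimes> Id C ?X) \<cdot> ar Delta = ar Eta \<cdot> ar Eps"
    using hopf_axioms by simp
  from weq_of_eq[OF this, where t = ?h]
  show "[(Delta, 0), (Ant, 0), (Mu, 0)] \<approx>\<langle>[Hc]\<rangle> [(Eps, 0), (Eta, 0)]"
    by this ((rule den_intros den_gens | (simp; fail))+)
  have "ar Mu \<cdot> (Id C ?X \<otimes> ar Ant) \<cdot> ar Delta = ar Eta \<cdot> ar Eps"
    using hopf_axioms by simp
  from weq_of_eq[OF this, where t = ?h]
  show "[(Delta, 0), (Ant, 1), (Mu, 0)] \<approx>\<langle>[Hc]\<rangle> [(Eps, 0), (Eta, 0)]"
    by this ((rule den_intros den_gens | (simp; fail))+)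
qed

section \<open>The antipode reverses products and coproducts\<close>

lemma ant_conv_mu:
  "[(Delta, 0), (Delta, 2), (B, 1), (Mu, 0), (Ant, 0), (Mu, 1), (Mu, 0)]
    \<approx>\<langle>[Hc, Hc]\<rangle> [(Eps, 0), (Eps, 0), (Eta, 0)]"
  (is "?p \<approx>\<langle>?xs\<rangle> ?q")
proof -
  have "?p \<approx>\<langle>?xs\<rangle> [(Delta, 0), (Delta, 2), (B, 1), (Mu, 0), (Mu, 1),
    (Ant, 0), (Mu, 0)]"
    by (rule weq_isotopic; code_simp)
  also have "\<dots> \<approx>\<langle>?xs\<rangle> [(Mu, 0), (Delta, 0), (Ant, 0), (Mu, 0)]"
    by (rule rw_sym[OF delta_mu], code_simp)
  also have "\<dots> \<approx>\<langle>?xs\<rangle> [(Mu, 0), (Eps, 0), (Eta, 0)]"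
    by (rule rw[OF ant_left], code_simp)
  also have "\<dots> \<approx>\<langle>?xs\<rangle> ?q"
    by (rule rw[OF eps_mu], code_simp)
  finally show ?thesis .
qed

text \<open>By \<open>ant_conv_mu\<close> the arrow S(xy) is a left convolution inverse of the
  multiplication, where \<open>H \<otimes> H\<close> carries the braided tensor coalgebra. Here the
  braided form of S(y) S(x) is shown to be a right one, by contracting first y and then x.\<close>

lemma mu_conv_ant:
  "[(Delta, 0), (Delta, 2), (B, 1), (Mu, 0), (B, 1), (Ant, 1), (Ant, 2), (Mu, 1), (Mu, 0)]
    \<approx>\<langle>[Hc, Hc]\<rangle> [(Eps, 0), (Eps, 0), (Eta, 0)]"
  (is "?p \<approx>\<langle>?xs\<rangle> ?q")
proof -
  have "?p \<approx>\<langle>?xs\<rangle> [(Delta, 0), (Delta, 2), (B, 1), (B, 2), (Ant, 3),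
    (Ant, 2), (Mu, 2), (Mu, 0), (Mu, 0)]"
    by (rule weq_isotopic; code_simp)
  also have "\<dots> \<approx>\<langle>?xs\<rangle> [(Delta, 0), (Delta, 2), (B, 1), (B, 2),
    (Ant, 2), (Ant, 3), (Mu, 2), (Mu, 1), (Mu, 0)]"
    by (rule rw[OF mu_assoc], code_simp)
  also have "\<dots> \<approx>\<langle>?xs\<rangle> [(Delta, 0), (Delta, 2), (B, 1), (B, 2),
    (Ant, 2), (Mu, 1), (Ant, 2), (Mu, 1), (Mu, 0)]"
    by (rule rw_sym[OF mu_assoc], code_simp)
  also have "\<dots> \<approx>\<langle>?xs\<rangle> [(Delta, 0), (B, 1), (Delta, 1), (Ant, 2),
    (Mu, 1), (Ant, 2), (Mu, 1), (Mu, 0)]"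
    by (rule rw[OF slide_over[of Delta "Leaf Hc"]], code_simp)
  also have "\<dots> \<approx>\<langle>?xs\<rangle> [(Delta, 0), (B, 1), (Eps, 1), (Ant, 1),
    (Eta, 1), (Mu, 1), (Mu, 0)]"
    by (rule rw[OF ant_right], code_simp)
  also have "\<dots> \<approx>\<langle>?xs\<rangle> [(Delta, 0), (B, 1), (Eps, 1), (Ant, 1), (Mu, 0)]"
    by (rule rw[OF eta_left], code_simp)
  also have "\<dots> \<approx>\<langle>?xs\<rangle> [(Delta, 0), (Ant, 1), (Mu, 0), (Eps, 1)]"
    by (rule rw_sym[OF slide_over[of Eps "Leaf Hc"]], code_simp)
  also have "\<dots> \<approx>\<langle>?xs\<rangle> ?q"
    by (rule rw[OF ant_right], code_simp)
  finally show ?thesis .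
qed

text \<open>Both sides are convolution inverse to the multiplication.\<close>

lemma ant_mu:
  "[(Mu, 0), (Ant, 0)] \<approx>\<langle>[Hc, Hc]\<rangle> [(B, 0), (Ant, 0), (Ant, 1), (Mu, 0)]"
  (is "?p \<approx>\<langle>?xs\<rangle> ?q")
proof -
  have "?p \<approx>\<langle>?xs\<rangle> [(Delta, 0), (Eps, 1), (Mu, 0), (Ant, 0)]"
    by (rule rw_sym[OF eps_right], code_simp)
  also have "\<dots> \<approx>\<langle>?xs\<rangle> [(Delta, 0), (B, 1), (Mu, 0), (Ant, 0), (Eps, 1)]"
    by (rule rw[OF slide_under[of Eps "Leaf Hc"]], code_simp)
  also have "\<dots> \<approx>\<langle>?xs\<rangle> [(Delta, 0), (B, 1), (Mu, 0), (Ant, 0),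
    (Eps, 1), (Eta, 1), (Mu, 0)]"
    by (rule rw_sym[OF eta_right], code_simp)
  also have "\<dots> \<approx>\<langle>?xs\<rangle> [(Delta, 0), (Delta, 2), (B, 1), (Mu, 0),
    (Ant, 0), (Eps, 1), (Eps, 1), (Eta, 1), (Mu, 0)]"
    by (rule rw_sym[OF eps_right], code_simp)
  \<comment> \<open>The counits created so far form a convolution unit to the right of S(xy); it is
    expanded as the multiplication times its right inverse. Until the next contraction only
    coassociativity of the braided tensor coalgebra is used, together with associativity.\<close>
  also have "\<dots> \<approx>\<langle>?xs\<rangle> [(Delta, 0), (Delta, 2), (B, 1), (Delta, 2),
    (Mu, 0), (Ant, 0), (Delta, 3), (B, 2), (Mu, 1), (B, 2), (Ant, 2), (Ant, 3), (Mu, 2), (Mu, 1),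
    (Mu, 0)]"
    by (rule rw_sym[OF mu_conv_ant], code_simp)
  also have "\<dots> \<approx>\<langle>?xs\<rangle> [(Delta, 0), (Delta, 1), (Delta, 3), (B, 2),
    (B, 1), (Mu, 0), (Ant, 0), (Delta, 3), (B, 2), (Mu, 1), (B, 2), (Ant, 2), (Ant, 3), (Mu, 2),
    (Mu, 1), (Mu, 0)]"
    by (rule rw_sym[OF slide_under[of Delta "Leaf Hc"]], code_simp)
  also have "\<dots> \<approx>\<langle>?xs\<rangle> [(Delta, 0), (Delta, 1), (Delta, 3), (Delta, 4),
    (B, 2), (B, 1), (Mu, 0), (Ant, 0), (B, 2), (Mu, 1), (Mu, 0), (B, 1), (Ant, 1), (Ant, 2),
    (Mu, 1), (Mu, 0)]"
    by (rule rw_sym[OF mu_assoc], code_simp)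
  also have "\<dots> \<approx>\<langle>?xs\<rangle> [(Delta, 0), (Delta, 1), (Delta, 3), (Delta, 3),
    (B, 2), (B, 3), (B, 1), (Mu, 0), (Ant, 0), (Mu, 1), (Mu, 0), (B, 1), (Ant, 1), (Ant, 2),
    (Mu, 1), (Mu, 0)]"
    by (rule rw_sym[OF delta_coassoc], code_simp)
  also have "\<dots> \<approx>\<langle>?xs\<rangle> [(Delta, 0), (Delta, 1), (Delta, 3), (B, 2),
    (Delta, 2), (B, 1), (Mu, 0), (Ant, 0), (Mu, 1), (Mu, 0), (B, 1), (Ant, 1), (Ant, 2), (Mu, 1),
    (Mu, 0)]"
    by (rule rw[OF slide_over[of Delta "Leaf Hc"]], code_simp)
  also have "\<dots> \<approx>\<langle>?xs\<rangle> [(Delta, 0), (Delta, 2), (B, 1), (Delta, 0),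
    (Delta, 2), (B, 1), (Mu, 0), (Ant, 0), (Mu, 1), (Mu, 0), (B, 1), (Ant, 1), (Ant, 2), (Mu, 1),
    (Mu, 0)]"
    by (rule rw_sym[OF delta_coassoc], code_simp)
  \<comment> \<open>After rebracketing, S(xy) stands next to the multiplication and cancels it; the
    right inverse survives.\<close>
  also have "\<dots> \<approx>\<langle>?xs\<rangle> [(Delta, 0), (Eps, 0), (Eta, 0), (Delta, 2),
    (B, 1), (Eps, 1), (B, 1), (Ant, 1), (Ant, 2), (Mu, 1), (Mu, 0)]"
    by (rule rw[OF ant_conv_mu], code_simp)
  also have "\<dots> \<approx>\<langle>?xs\<rangle> [(Delta, 0), (Eps, 0), (Eta, 0), (Delta, 2),
    (Eps, 2), (B, 1), (Ant, 1), (Ant, 2), (Mu, 1), (Mu, 0)]"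
    by (rule rw_sym[OF slide_over[of Eps "Leaf Hc"]], code_simp)
  also have "\<dots> \<approx>\<langle>?xs\<rangle> [(Eta, 0), (Delta, 2), (Eps, 2), (B, 1),
    (Ant, 1), (Ant, 2), (Mu, 1), (Mu, 0)]"
    by (rule rw[OF eps_left], code_simp)
  also have "\<dots> \<approx>\<langle>?xs\<rangle> [(B, 0), (Ant, 0), (Ant, 1), (Mu, 0), (Eta, 0),
    (Mu, 0)]"
    by (rule rw[OF eps_left], code_simp)
  also have "\<dots> \<approx>\<langle>?xs\<rangle> ?q"
    by (rule rw[OF eta_left], code_simp)
  finally show ?thesis .
qed

lemma ant_eta:
  "[(Eta, 0), (Ant, 0)] \<approx>\<langle>[]\<rangle> [(Eta, 0)]"
  (is "?p \<approx>\<langle>?xs\<rangle> ?q")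
proof -
  have "?p \<approx>\<langle>?xs\<rangle> [(Eta, 0), (Eta, 1), (Ant, 0), (Mu, 0)]"
    by (rule rw_sym[OF eta_right], code_simp)
  also have "\<dots> \<approx>\<langle>?xs\<rangle> [(Eta, 0), (Delta, 0), (Ant, 0), (Mu, 0)]"
    by (rule rw_sym[OF delta_eta], code_simp)
  also have "\<dots> \<approx>\<langle>?xs\<rangle> [(Eta, 0), (Eps, 0), (Eta, 0)]"
    by (rule rw[OF ant_left], code_simp)
  also have "\<dots> \<approx>\<langle>?xs\<rangle> ?q"
    by (rule rw[OF eps_eta], code_simp)
  finally show ?thesis .
qed

lemma ant_eps:
  "[(Ant, 0), (Eps, 0)] \<approx>\<langle>[Hc]\<rangle> [(Eps, 0)]"
  (is "?p \<approx>\<langle>?xs\<rangle> ?q")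
proof -
  have "?p \<approx>\<langle>?xs\<rangle> [(Delta, 0), (Ant, 0), (Eps, 0), (Eps, 0)]"
    by (rule rw_sym[OF eps_right], code_simp)
  also have "\<dots> \<approx>\<langle>?xs\<rangle> [(Delta, 0), (Ant, 0), (Mu, 0), (Eps, 0)]"
    by (rule rw_sym[OF eps_mu], code_simp)
  also have "\<dots> \<approx>\<langle>?xs\<rangle> [(Eps, 0), (Eta, 0), (Eps, 0)]"
    by (rule rw[OF ant_left], code_simp)
  also have "\<dots> \<approx>\<langle>?xs\<rangle> ?q"
    by (rule rw[OF eps_eta], code_simp)
  finally show ?thesis .
qed

lemma ant_conv_delta:
  "[(Delta, 0), (Ant, 0), (Delta, 0), (Delta, 2), (B, 1), (Mu, 0), (Mu, 1)]
    \<approx>\<langle>[Hc]\<rangle> [(Eps, 0), (Eta, 0), (Eta, 1)]"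
  (is "?p \<approx>\<langle>?xs\<rangle> ?q")
proof -
  have "?p \<approx>\<langle>?xs\<rangle> [(Delta, 0), (Ant, 0), (Mu, 0), (Delta, 0)]"
    by (rule rw_sym[OF delta_mu], code_simp)
  also have "\<dots> \<approx>\<langle>?xs\<rangle> [(Eps, 0), (Eta, 0), (Delta, 0)]"
    by (rule rw[OF ant_left], code_simp)
  also have "\<dots> \<approx>\<langle>?xs\<rangle> ?q"
    by (rule rw[OF delta_eta], code_simp)
  finally show ?thesis .
qed

text \<open>Convolution now takes place among arrows from \<open>H\<close> to the braided tensor
  algebra \<open>H \<otimes> H\<close>. The word is
  \<open>h\<^sub>1 S(h\<^sub>4) \<otimes> h\<^sub>2 S(h\<^sub>3)\<close>, which collapses from the
  inside.\<close>

lemma delta_conv_ant: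
  "[(Delta, 0), (Delta, 0), (Delta, 2), (Ant, 2), (Ant, 3), (B, 2), (B, 1), (Mu, 0), (Mu, 1)]
    \<approx>\<langle>[Hc]\<rangle> [(Eps, 0), (Eta, 0), (Eta, 1)]"
  (is "?p \<approx>\<langle>?xs\<rangle> ?q")
proof -
  have "?p \<approx>\<langle>?xs\<rangle> [(Delta, 0), (Delta, 1), (Delta, 2), (Ant, 2), (Ant, 3),
    (B, 2), (B, 1), (Mu, 0), (Mu, 1)]"
    by (rule rw[OF delta_coassoc], code_simp)
  also have "\<dots> \<approx>\<langle>?xs\<rangle> [(Delta, 0), (Delta, 1), (Delta, 1), (Ant, 2),
    (Ant, 3), (B, 2), (B, 1), (Mu, 2), (Mu, 0)]"
    by (rule rw_sym[OF delta_coassoc], code_simp)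
  also have "\<dots> \<approx>\<langle>?xs\<rangle> [(Delta, 0), (Delta, 1), (Delta, 1), (Ant, 2),
    (Mu, 1), (Ant, 2), (B, 1), (Mu, 0)]"
    by (rule rw_sym[OF slide_under[of Mu "Leaf Hc"]], code_simp)
  also have "\<dots> \<approx>\<langle>?xs\<rangle> [(Delta, 0), (Delta, 1), (Eps, 1), (Ant, 1),
    (Eta, 1), (B, 1), (Mu, 0)]"
    by (rule rw[OF ant_right], code_simp)
  also have "\<dots> \<approx>\<langle>?xs\<rangle> [(Delta, 0), (Delta, 1), (Eps, 1), (Ant, 1),
    (Mu, 0), (Eta, 1)]"
    by (rule rw[OF slide_under[of Eta "Leaf Hc"]], code_simp)
  also have "\<dots> \<approx>\<langle>?xs\<rangle> [(Delta, 0), (Ant, 1), (Mu, 0), (Eta, 1)]"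
    by (rule rw[OF eps_left], code_simp)
  also have "\<dots> \<approx>\<langle>?xs\<rangle> ?q"
    by (rule rw[OF ant_right], code_simp)
  finally show ?thesis .
qed

text \<open>Both sides are convolution inverse to the comultiplication.\<close>

lemma delta_ant:
  "[(Ant, 0), (Delta, 0)] \<approx>\<langle>[Hc]\<rangle> [(Delta, 0), (Ant, 0), (Ant, 1), (B, 0)]"
  (is "?p \<approx>\<langle>?xs\<rangle> ?q")
proof -
  have "?p \<approx>\<langle>?xs\<rangle> [(Ant, 0), (Delta, 0), (Eta, 2), (Mu, 1)]"
    by (rule rw_sym[OF eta_right], code_simp)
  also have "\<dots> \<approx>\<langle>?xs\<rangle> [(Ant, 0), (Delta, 0), (Eta, 2), (Eta, 1),
    (Mu, 0), (Mu, 1)]"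
    by (rule rw_sym[OF eta_right], code_simp)
  also have "\<dots> \<approx>\<langle>?xs\<rangle> [(Ant, 0), (Delta, 0), (Eta, 2), (Eta, 2),
    (B, 1), (Mu, 0), (Mu, 1)]"
    by (rule rw_sym[OF slide_over[of Eta "Leaf Hc"]], code_simp)
  also have "\<dots> \<approx>\<langle>?xs\<rangle> [(Delta, 0), (Ant, 0), (Delta, 0), (Eps, 2),
    (Eta, 2), (Eta, 3), (B, 1), (Mu, 0), (Mu, 1)]"
    by (rule rw_sym[OF eps_right], code_simp)
  \<comment> \<open>The inserted convolution unit becomes the comultiplication times its right
    inverse; what follows rebrackets the product in the braided tensor algebra.\<close>
  also have "\<dots> \<approx>\<langle>?xs\<rangle> [(Delta, 0), (Ant, 0), (Delta, 0), (Delta, 2),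
    (Delta, 2), (Delta, 4), (Ant, 4), (Ant, 5), (B, 4), (B, 3), (Mu, 2), (B, 1), (Mu, 0), (Mu, 2),
    (Mu, 1)]"
    by (rule rw_sym[OF delta_conv_ant], code_simp)
  also have "\<dots> \<approx>\<langle>?xs\<rangle> [(Delta, 0), (Delta, 1), (Ant, 0), (Delta, 0),
    (Delta, 2), (Delta, 4), (Ant, 4), (Ant, 5), (B, 4), (B, 3), (Mu, 2), (B, 1), (Mu, 0), (Mu, 1),
    (Mu, 1)]"
    by (rule rw_sym[OF mu_assoc], code_simp)
  also have "\<dots> \<approx>\<langle>?xs\<rangle> [(Delta, 0), (Delta, 0), (Ant, 0), (Delta, 0),
    (Delta, 2), (Delta, 4), (Ant, 4), (Ant, 5), (B, 4), (B, 3), (Mu, 2), (B, 1), (Mu, 0), (Mu, 1),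
    (Mu, 1)]"
    by (rule rw_sym[OF delta_coassoc], code_simp)
  also have "\<dots> \<approx>\<langle>?xs\<rangle> [(Delta, 0), (Delta, 0), (Ant, 0), (Delta, 0),
    (Delta, 2), (B, 1), (Delta, 4), (Ant, 5), (Ant, 4), (B, 4), (B, 3), (B, 2), (Mu, 3), (Mu, 1),
    (Mu, 0), (Mu, 1)]"
    by (rule rw[OF slide_over[of Mu "Leaf Hc"]], code_simp)
  also have "\<dots> \<approx>\<langle>?xs\<rangle> [(Delta, 0), (Delta, 0), (Ant, 0), (Delta, 0),
    (Delta, 2), (B, 1), (Delta, 4), (Ant, 5), (Ant, 4), (B, 4), (Mu, 2), (B, 2), (Mu, 1), (Mu, 0),
    (Mu, 1)]"
    by (rule rw_sym[OF slide_under[of Mu "Leaf Hc"]], code_simp)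
  also have "\<dots> \<approx>\<langle>?xs\<rangle> [(Delta, 0), (Delta, 0), (Ant, 0), (Delta, 0),
    (Delta, 2), (B, 1), (Mu, 0), (Mu, 1), (Delta, 2), (Ant, 2), (Ant, 3), (B, 2), (B, 1), (Mu, 0),
    (Mu, 1)]"
    by (rule rw_sym[OF mu_assoc], code_simp)
  \<comment> \<open>The left inverse cancels the comultiplication.\<close>
  also have "\<dots> \<approx>\<langle>?xs\<rangle> [(Delta, 0), (Eps, 0), (Delta, 0), (Ant, 0),
    (Ant, 1), (B, 0), (Eta, 0), (B, 0), (Eta, 0), (Mu, 0), (Mu, 1)]"
    by (rule rw[OF ant_conv_delta], code_simp)
  also have "\<dots> \<approx>\<langle>?xs\<rangle> [(Delta, 0), (Eps, 0), (Delta, 0), (Ant, 0),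
    (Eta, 0), (Ant, 2), (B, 1), (Mu, 0), (Eta, 1), (Mu, 1)]"
    by (rule rw[OF slide_under[of Eta "Leaf Hc"]], code_simp)
  also have "\<dots> \<approx>\<langle>?xs\<rangle> [(Delta, 0), (Ant, 0), (Ant, 1), (B, 0),
    (Eta, 0), (Mu, 0), (Eta, 1), (Mu, 1)]"
    by (rule rw[OF eps_left], code_simp)
  also have "\<dots> \<approx>\<langle>?xs\<rangle> [(Delta, 0), (Ant, 0), (Ant, 1), (B, 0),
    (Eta, 1), (Mu, 1)]"
    by (rule rw[OF eta_left], code_simp)
  also have "\<dots> \<approx>\<langle>?xs\<rangle> ?q"
    by (rule rw[OF eta_left], code_simp)
  finally show ?thesis .
qed

end

section \<open>Words for dual pairings and adjoints\<close>

context diagram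
begin

lemma den_braid_inv:
  assumes "X = tob t" "Y = tob u"
  shows "den (u \<diamondop> t) (t \<diamondop> u) (cinv C (braid C X Y)) [(Br_inv t u, 0)]"
  using den_gen[of "Br_inv t u"] assms by (simp add: ar_Br_inv)

lemma eq_of_weq:
  assumes "p' \<approx>\<langle>xs\<rangle> q'" "den t u f p" "den t u g q" "flat t = xs" "p = p'" "q = q'"
  shows "f = g"
  using assms den_eqI by blast

lemma dual_zigzags:
  assumes "dual_pairing C (ob b) (ob c) ev coev"
    and "den (Leaf c \<diamondop> Leaf b) Unit ev e" "den Unit (Leaf b \<diamondop> Leaf c) coev k"
  shows "shift 1 k @ e \<approx>\<langle>[c]\<rangle> []" and "k @ shift 1 e \<approx>\<langle>[b]\<rangle> []"
proof -
  let ?X = "ob b" and ?D = "ob c"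
  have "lunit C ?D \<cdot> (ev \<otimes> Id C ?D) \<cdot> cinv C (assoc C ?D ?X ?D) \<cdot> (Id C ?D \<otimes> coev) \<cdot> cinv C (runit C ?D) = Id C ?D"
    using assms(1) by (simp add: dual_pairing_def)
  from weq_of_eq[OF this, where t = "Leaf c"]
  show "shift 1 k @ e \<approx>\<langle>[c]\<rangle> []"
    by this ((rule den_intros assms(2,3) | (simp; fail))+)
  have "runit C ?X \<cdot> (Id C ?X \<otimes> ev) \<cdot> assoc C ?X ?D ?X \<cdot> (coev \<otimes> Id C ?X) \<cdot> cinv C (lunit C ?X) = Id C ?X"
    using assms(1) by (simp add: dual_pairing_def)
  from weq_of_eq[OF this, where t = "Leaf b"]
  show "k @ shift 1 e \<approx>\<langle>[b]\<rangle> []"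
    by this ((rule den_intros assms(2,3) | (simp; fail))+)
qed

lemma dual_pairingI:
  assumes "den (Leaf c \<diamondop> Leaf b) Unit ev e" "den Unit (Leaf b \<diamondop> Leaf c) coev k"
    and "shift 1 k @ e \<approx>\<langle>[c]\<rangle> []" and "k @ shift 1 e \<approx>\<langle>[b]\<rangle> []"
    and "X = ob b" "D = ob c"
  shows "dual_pairing C X D ev coev"
proof -
  have "lunit C D \<cdot> (ev \<otimes> Id C D) \<cdot> cinv C (assoc C D X D) \<cdot> (Id C D \<otimes> coev) \<cdot> cinv C (runit C D) = Id C D"
    by (rule eq_of_weq[OF assms(3), where t = "Leaf c"])
      (rule den_intros assms(1,2) | (simp add: assms(5,6); fail))+
  moreover have "runit C X \<cdot> (Id C X \<otimes> ev) \<cdot> assoc C X D X \<cdot> (coev \<otimes> Id C X) \<cdot> cinv C (lunit C X) = Id C X"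
    by (rule eq_of_weq[OF assms(4), where t = "Leaf b"])
      (rule den_intros assms(1,2) | (simp add: assms(5,6); fail))+
  ultimately show ?thesis
    using assms(1,2,5,6) by (auto simp: dual_pairing_def den_def)
qed

lemma den_nested_ev:
  assumes "den (d \<diamondop> x) Unit ev e" "X = tob x" "D = tob d"
  shows "den ((d \<diamondop> d) \<diamondop> (x \<diamondop> x)) Unit (nested_ev C X D ev) (shift (length (flat d)) e @ e)"
  unfolding nested_ev_def assms(2,3)
  by (rule den_cong, (rule den_intros assms(1) | (simp; fail))+)

lemma den_nested_coev:
  assumes "den Unit (x \<diamondop> d) coev k" "X = tob x" "D = tob d"
  shows "den Unit ((x \<diamondop> x) \<diamondop> (d \<diamondop> d)) (nested_coev C X D coev) (k @ shift (length (flat x)) k)"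
  unfolding nested_coev_def assms(2,3)
  by (rule den_cong, (rule den_intros assms(1) | (simp; fail))+)

lemma den_adjoint:
  assumes "den x y f p" "den Unit (x \<diamondop> dx) coev k" "den (dy \<diamondop> y) Unit ev e"
    and "X = tob x" "DX = tob dx" "DY = tob dy"
  shows "den dy dx (adjoint C X DX coev DY ev f) (shift (length (flat dy)) (k @ p) @ e)"
  unfolding adjoint_def assms(4-6)
  by (rule den_cong, (rule den_intros assms(1-3) | (simp; fail))+)

end

section \<open>Integrals and the Frobenius zigzag identities\<close>

locale integral_diagram = hopf_diagram +
  assumes ant_iso: "is_iso C (ar Ant)" and ar_Ant_inv: "ar Ant_inv = cinv C (ar Ant)"
    and left_integral: "left_integral C \<lparr>hobj = ob Hc, hmult = ar Mu, hunit = ar Eta, hcomult = ar Delta,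
      hcounit = ar Eps, hantipode = ar Ant\<rparr> (ar Lam)"
    and right_integral: "right_integral C \<lparr>hobj = ob Hc, hmult = ar Mu, hunit = ar Eta, hcomult = ar Delta,
      hcounit = ar Eps, hantipode = ar Ant\<rparr> (ar Itg)"
    and itg_lam_id: "ar Itg \<cdot> ar Lam = Id C \<one>"
begin

lemma
  shows ant_inv_right: "[(Ant, 0), (Ant_inv, 0)] \<approx>\<langle>[Hc]\<rangle> []"
    and ant_inv_left: "[(Ant_inv, 0), (Ant, 0)] \<approx>\<langle>[Hc]\<rangle> []"
    and lam_left: "[(Lam, 1), (Mu, 0)] \<approx>\<langle>[Hc]\<rangle> [(Eps, 0), (Lam, 0)]"
    and itg_right: "[(Delta, 0), (Itg, 0)] \<approx>\<langle>[Hc]\<rangle> [(Itg, 0), (Eta, 0)]"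
    and itg_lam: "[(Lam, 0), (Itg, 0)] \<approx>\<langle>[]\<rangle> []"
proof -
  let ?h = "Leaf Hc" and ?X = "ob Hc"
  have "ar Ant_inv \<cdot> ar Ant = Id C ?X"
    using ant_iso ar_Arr[of Ant] by (simp add: ar_Ant_inv)
  from weq_of_eq[OF this, where t = ?h]
  show "[(Ant, 0), (Ant_inv, 0)] \<approx>\<langle>[Hc]\<rangle> []"
    by this ((rule den_intros den_gens | (simp; fail))+)
  have "ar Ant \<cdot> ar Ant_inv = Id C ?X"
    using ant_iso ar_Arr[of Ant] by (simp add: ar_Ant_inv)
  from weq_of_eq[OF this, where t = ?h]
  show "[(Ant_inv, 0), (Ant, 0)] \<approx>\<langle>[Hc]\<rangle> []"
    by this ((rule den_intros den_gens | (simp; fail))+)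
  have "ar Mu \<cdot> (Id C ?X \<otimes> ar Lam) = ar Lam \<cdot> ar Eps \<cdot> runit C ?X"
    using left_integral by (simp add: left_integral_def)
  from weq_of_eq[OF this, where t = "?h \<diamondop> Unit"]
  show "[(Lam, 1), (Mu, 0)] \<approx>\<langle>[Hc]\<rangle> [(Eps, 0), (Lam, 0)]"
    by this ((rule den_intros den_gens | (simp; fail))+)
  have "lunit C ?X \<cdot> (ar Itg \<otimes> Id C ?X) \<cdot> ar Delta = ar Eta \<cdot> ar Itg"
    using right_integral by (simp add: right_integral_def)
  from weq_of_eq[OF this, where t = ?h]
  show "[(Delta, 0), (Itg, 0)] \<approx>\<langle>[Hc]\<rangle> [(Itg, 0), (Eta, 0)]"
    by this ((rule den_intros den_gens | (simp; fail))+)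
  from weq_of_eq[OF itg_lam_id, where t = Unit]
  show "[(Lam, 0), (Itg, 0)] \<approx>\<langle>[]\<rangle> []"
    by this ((rule den_intros den_gens | (simp; fail))+)
qed

lemma ant_inv_eta:
  "[(Eta, 0), (Ant_inv, 0)] \<approx>\<langle>[]\<rangle> [(Eta, 0)]"
  (is "?p \<approx>\<langle>?xs\<rangle> ?q")
proof -
  have "?p \<approx>\<langle>?xs\<rangle> [(Eta, 0), (Ant, 0), (Ant_inv, 0)]"
    by (rule rw_sym[OF ant_eta], code_simp)
  also have "\<dots> \<approx>\<langle>?xs\<rangle> ?q"
    by (rule rw[OF ant_inv_right], code_simp)
  finally show ?thesis .
qed

text \<open>In Sweedler notation \<open>\<Lambda>\<^sub>1 \<otimes> h \<Lambda>\<^sub>2 = S(h) \<Lambda>\<^sub>1 \<otimes> \<Lambda>\<^sub>2\<close>; insert \<open>S(h\<^sub>1) h\<^sub>2\<close> in front of \<open>\<Lambda>\<^sub>1\<close>.\<close>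

lemma lam_slide:
  "[(Lam, 1), (Delta, 1), (B, 0), (Mu, 1)] \<approx>\<langle>[Hc]\<rangle> [(Ant, 0), (Lam, 1),
    (Delta, 1), (Mu, 0)]"
  (is "?p \<approx>\<langle>?xs\<rangle> ?q")
proof -
  have "?p \<approx>\<langle>?xs\<rangle> [(Eta, 0), (Lam, 2), (Delta, 2), (B, 1), (Mu, 0), (Mu, 1)]"
    by (rule rw_sym[OF eta_left], code_simp)
  also have "\<dots> \<approx>\<langle>?xs\<rangle> [(Delta, 0), (Eps, 0), (Eta, 0), (Lam, 2),
    (Delta, 2), (B, 1), (Mu, 0), (Mu, 1)]"
    by (rule rw_sym[OF eps_left], code_simp)
  also have "\<dots> \<approx>\<langle>?xs\<rangle> [(Delta, 0), (Delta, 0), (Ant, 0), (Mu, 0),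
    (Lam, 2), (Delta, 2), (B, 1), (Mu, 0), (Mu, 1)]"
    by (rule rw_sym[OF ant_left], code_simp)
  also have "\<dots> \<approx>\<langle>?xs\<rangle> [(Delta, 0), (Ant, 0), (Delta, 1), (Lam, 3),
    (Delta, 3), (B, 2), (Mu, 0), (Mu, 0), (Mu, 1)]"
    by (rule rw[OF delta_coassoc], code_simp)
  also have "\<dots> \<approx>\<langle>?xs\<rangle> [(Delta, 0), (Ant, 0), (Lam, 2), (Delta, 1),
    (Delta, 3), (B, 2), (Mu, 1), (Mu, 2), (Mu, 0)]"
    by (rule rw[OF mu_assoc], code_simp)
  also have "\<dots> \<approx>\<langle>?xs\<rangle> [(Delta, 0), (Ant, 0), (Lam, 2), (Mu, 1),
    (Delta, 1), (Mu, 0)]"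
    by (rule rw_sym[OF delta_mu], code_simp)
  also have "\<dots> \<approx>\<langle>?xs\<rangle> [(Delta, 0), (Eps, 1), (Ant, 0), (Lam, 1),
    (Delta, 1), (Mu, 0)]"
    by (rule rw[OF lam_left], code_simp)
  also have "\<dots> \<approx>\<langle>?xs\<rangle> ?q"
    by (rule rw[OF eps_right], code_simp)
  finally show ?thesis .
qed

text \<open>Writing h as S(S^-1(h)), \<open>lam_slide\<close> moves S^-1(h) in front of
  \<open>\<Lambda>\<^sub>2\<close>, and the antipode turns it into a right factor h. The crossing
  from the first move and the one from the antipode let the strand pass the whole copairing, so no
  braiding remains.\<close>

lemma metric_central:
  "[(Lam, 1), (Delta, 1), (Ant, 2), (Mu, 0)] \<approx>\<langle>[Hc]\<rangle> [(Lam, 0), (Delta, 0),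
    (Ant, 1), (Mu, 1)]"
  (is "?p \<approx>\<langle>?xs\<rangle> ?q")
proof -
  have "?p \<approx>\<langle>?xs\<rangle> [(Lam, 1), (Delta, 1), (Mu, 0), (Ant, 1)]"
    by (rule weq_isotopic; code_simp)
  also have "\<dots> \<approx>\<langle>?xs\<rangle> [(Ant_inv, 0), (Ant, 0), (Lam, 1), (Delta, 1),
    (Mu, 0), (Ant, 1)]"
    by (rule rw_sym[OF ant_inv_left], code_simp)
  also have "\<dots> \<approx>\<langle>?xs\<rangle> [(Ant_inv, 0), (Lam, 1), (Delta, 1), (B, 0),
    (Mu, 1), (Ant, 1)]"
    by (rule rw_sym[OF lam_slide], code_simp)
  also have "\<dots> \<approx>\<langle>?xs\<rangle> [(Ant_inv, 0), (Lam, 1), (Delta, 1), (B, 0),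
    (B, 1), (Ant, 1), (Ant, 2), (Mu, 1)]"
    by (rule rw[OF ant_mu], code_simp)
  also have "\<dots> \<approx>\<langle>?xs\<rangle> [(Ant_inv, 0), (Lam, 1), (B, 0), (Delta, 0),
    (Ant, 1), (Ant, 2), (Mu, 1)]"
    by (rule rw[OF slide_over[of Delta "Leaf Hc"]], code_simp)
  also have "\<dots> \<approx>\<langle>?xs\<rangle> [(Ant_inv, 0), (Ant, 0), (Lam, 0), (Delta, 0),
    (Ant, 1), (Mu, 1)]"
    by (rule rw[OF slide_over[of Lam "Leaf Hc"]], code_simp)
  also have "\<dots> \<approx>\<langle>?xs\<rangle> ?q"
    by (rule rw[OF ant_inv_left], code_simp)
  finally show ?thesis .
qed

text \<open>Centrality moves h to the other leg, so that the integral meets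
  \<open>\<Lambda>\<^sub>1\<close> alone: \<open>I(h \<Lambda>\<^sub>1) S(\<Lambda>\<^sub>2) =
  I(\<Lambda>\<^sub>1) S(\<Lambda>\<^sub>2) h\<close>, and the right integral leaves S(1) h.\<close>

lemma metric_zigzag_left:
  "[(Lam, 1), (Delta, 1), (Ant, 2), (Mu, 0), (Itg, 0)] \<approx>\<langle>[Hc]\<rangle> []"
  (is "?p \<approx>\<langle>?xs\<rangle> ?q")
proof -
  have "?p \<approx>\<langle>?xs\<rangle> [(Lam, 0), (Delta, 0), (Itg, 0), (Ant, 0), (Mu, 0)]"
    by (rule rw[OF metric_central], code_simp)
  also have "\<dots> \<approx>\<langle>?xs\<rangle> [(Lam, 0), (Itg, 0), (Eta, 0), (Ant, 0), (Mu, 0)]"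
    by (rule rw[OF itg_right], code_simp)
  also have "\<dots> \<approx>\<langle>?xs\<rangle> [(Eta, 0), (Ant, 0), (Mu, 0)]"
    by (rule rw[OF itg_lam], code_simp)
  also have "\<dots> \<approx>\<langle>?xs\<rangle> [(Eta, 0), (Mu, 0)]"
    by (rule rw[OF ant_eta], code_simp)
  also have "\<dots> \<approx>\<langle>?xs\<rangle> ?q"
    by (rule rw[OF eta_left], code_simp)
  finally show ?thesis .
qed

text \<open>The antipode turns the right integral I into the left integral I S, since it exchanges
  the legs of the coproduct. Its inverse strips the antipode from the leg that survives.\<close>

lemma itg_ant_left:
  "[(Delta, 0), (Ant, 1), (Itg, 1)] \<approx>\<langle>[Hc]\<rangle> [(Ant, 0), (Itg, 0), (Eta, 0)]"
  (is "?p \<approx>\<langle>?xs\<rangle> ?q")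
proof -
  have "?p \<approx>\<langle>?xs\<rangle> [(Delta, 0), (Ant, 0), (Ant, 1), (Ant_inv, 0), (Itg, 1)]"
    by (rule rw_sym[OF ant_inv_right], code_simp)
  also have "\<dots> \<approx>\<langle>?xs\<rangle> [(Delta, 0), (Ant, 0), (Ant, 1), (B, 0),
    (B', 0), (Ant_inv, 0), (Itg, 1)]"
    by (rule rw_sym[OF Br_inv_right[of "Leaf Hc" "Leaf Hc", simplified]], code_simp)
  also have "\<dots> \<approx>\<langle>?xs\<rangle> [(Ant, 0), (Delta, 0), (B', 0), (Itg, 1), (Ant_inv, 0)]"
    by (rule rw_sym[OF delta_ant], code_simp)
  also have "\<dots> \<approx>\<langle>?xs\<rangle> [(Ant, 0), (Delta, 0), (Itg, 0), (Ant_inv, 0)]"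
    by (rule rw_sym[OF slide_under_inv[of Itg "Leaf Hc"]], code_simp)
  also have "\<dots> \<approx>\<langle>?xs\<rangle> [(Ant, 0), (Itg, 0), (Eta, 0), (Ant_inv, 0)]"
    by (rule rw[OF itg_right], code_simp)
  also have "\<dots> \<approx>\<langle>?xs\<rangle> ?q"
    by (rule rw[OF ant_inv_eta], code_simp)
  finally show ?thesis .
qed

text \<open>
  Apply the integral to the first zigzag identity at \<open>\<Lambda>\<close>: this multiplies the scalar in question by
  \<open>I \<cdot> \<Lambda> = 1\<close>.
\<close>

lemma itg_ant_lam:
  "[(Lam, 0), (Ant, 0), (Itg, 0)] \<approx>\<langle>[]\<rangle> []"
  (is "?p \<approx>\<langle>?xs\<rangle> ?q")
proof -
  have "?p \<approx>\<langle>?xs\<rangle> [(Lam, 0), (Lam, 0), (Ant, 1), (Itg, 1), (Itg, 0)]"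
    by (rule rw_sym[OF itg_lam], code_simp)
  also have "\<dots> \<approx>\<langle>?xs\<rangle> [(Lam, 0), (Lam, 0), (Ant, 1), (Itg, 1),
    (Eta, 1), (Mu, 0), (Itg, 0)]"
    by (rule rw_sym[OF eta_right], code_simp)
  also have "\<dots> \<approx>\<langle>?xs\<rangle> [(Lam, 0), (Lam, 1), (Delta, 1), (Ant, 2),
    (Mu, 0), (Itg, 0), (Itg, 0)]"
    by (rule rw_sym[OF itg_ant_left], code_simp)
  also have "\<dots> \<approx>\<langle>?xs\<rangle> [(Lam, 0), (Itg, 0)]"
    by (rule rw[OF metric_zigzag_left], code_simp)
  also have "\<dots> \<approx>\<langle>?xs\<rangle> ?q"
    by (rule rw[OF itg_lam], code_simp)
  finally show ?thesis .
qed

text \<open>Centrality in the other direction leaves I S on the second leg of \<Lambda> alone, where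
  it acts as a left integral and produces the scalar I(S(\<Lambda>)). The same word is a zigzag of
  \<open>cup\<^sub>g\<close> and \<open>g\<^sub>g\<close>.\<close>

lemma metric_zigzag_right:
  "[(Lam, 0), (Delta, 0), (Ant, 1), (Mu, 1), (Itg, 1)] \<approx>\<langle>[Hc]\<rangle> []"
  (is "?p \<approx>\<langle>?xs\<rangle> ?q")
proof -
  have "?p \<approx>\<langle>?xs\<rangle> [(Lam, 1), (Delta, 1), (Ant, 2), (Itg, 2), (Mu, 0)]"
    by (rule rw_sym[OF metric_central], code_simp)
  also have "\<dots> \<approx>\<langle>?xs\<rangle> [(Lam, 1), (Ant, 1), (Itg, 1), (Eta, 1), (Mu, 0)]"
    by (rule rw[OF itg_ant_left], code_simp)
  also have "\<dots> \<approx>\<langle>?xs\<rangle> [(Eta, 1), (Mu, 0)]"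
    by (rule rw[OF itg_ant_lam], code_simp)
  also have "\<dots> \<approx>\<langle>?xs\<rangle> ?q"
    by (rule rw[OF eta_right], code_simp)
  finally show ?thesis .
qed

text \<open>The zigzag of the metric at S(h), with S cancelled on the outgoing leg.\<close>

lemma cometric_zigzag_left:
  "[(Lam, 1), (Delta, 1), (Ant, 0), (Mu, 0), (Itg, 0)] \<approx>\<langle>[Hc]\<rangle> []"
  (is "?p \<approx>\<langle>?xs\<rangle> ?q")
proof -
  have "?p \<approx>\<langle>?xs\<rangle> [(Ant, 0), (Lam, 1), (Delta, 1), (Mu, 0), (Itg, 0)]"
    by (rule weq_isotopic; code_simp)
  also have "\<dots> \<approx>\<langle>?xs\<rangle> [(Ant, 0), (Lam, 1), (Delta, 1), (Ant, 2),
    (Mu, 0), (Itg, 0), (Ant_inv, 0)]"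
    by (rule rw_sym[OF ant_inv_right], code_simp)
  also have "\<dots> \<approx>\<langle>?xs\<rangle> [(Ant, 0), (Ant_inv, 0)]"
    by (rule rw[OF metric_zigzag_left], code_simp)
  also have "\<dots> \<approx>\<langle>?xs\<rangle> ?q"
    by (rule rw[OF ant_inv_right], code_simp)
  finally show ?thesis .
qed

section \<open>The two F-algebra structures\<close>

lemma frobenius_comult_coassoc:
  "[(Lam, 0), (Delta, 0), (Ant, 1), (Mu, 1), (Lam, 0), (Delta, 0), (Ant, 1), (Mu, 1)]
    \<approx>\<langle>[Hc]\<rangle> [(Lam, 0), (Delta, 0), (Ant, 1), (Mu, 1), (Lam, 1), (Delta, 1),
    (Ant, 2), (Mu, 2)]"
  (is "?p \<approx>\<langle>?xs\<rangle> ?q")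
proof -
  have "?p \<approx>\<langle>?xs\<rangle> [(Lam, 0), (Delta, 0), (Ant, 1), (Lam, 2), (Delta, 2),
    (Ant, 3), (Mu, 1), (Mu, 2)]"
    by (rule weq_isotopic; code_simp)
  also have "\<dots> \<approx>\<langle>?xs\<rangle> [(Lam, 0), (Delta, 0), (Lam, 1), (Delta, 1),
    (Ant, 2), (Ant, 3), (Mu, 2), (Mu, 2)]"
    by (rule rw[OF metric_central], code_simp)
  also have "\<dots> \<approx>\<langle>?xs\<rangle> ?q"
    by (rule rw[OF mu_assoc], code_simp)
  finally show ?thesis .
qed

lemma frobenius_counit_left:
  "[(Lam, 0), (Delta, 0), (Ant, 1), (Mu, 1), (Eta, 1), (Mu, 0), (Itg, 0)]
    \<approx>\<langle>[Hc]\<rangle> []"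
  (is "?p \<approx>\<langle>?xs\<rangle> ?q")
proof -
  have "?p \<approx>\<langle>?xs\<rangle> [(Lam, 0), (Delta, 0), (Itg, 0), (Ant, 0), (Mu, 0)]"
    by (rule rw[OF eta_right], code_simp)
  also have "\<dots> \<approx>\<langle>?xs\<rangle> [(Lam, 0), (Itg, 0), (Eta, 0), (Ant, 0), (Mu, 0)]"
    by (rule rw[OF itg_right], code_simp)
  also have "\<dots> \<approx>\<langle>?xs\<rangle> [(Eta, 0), (Ant, 0), (Mu, 0)]"
    by (rule rw[OF itg_lam], code_simp)
  also have "\<dots> \<approx>\<langle>?xs\<rangle> [(Eta, 0), (Mu, 0)]"
    by (rule rw[OF ant_eta], code_simp)
  also have "\<dots> \<approx>\<langle>?xs\<rangle> ?q"
    by (rule rw[OF eta_left], code_simp)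
  finally show ?thesis .
qed

lemma frobenius_counit_right:
  "[(Lam, 0), (Delta, 0), (Ant, 1), (Mu, 1), (Eta, 2), (Mu, 1), (Itg, 1)]
    \<approx>\<langle>[Hc]\<rangle> []"
  (is "?p \<approx>\<langle>?xs\<rangle> ?q")
proof -
  have "?p \<approx>\<langle>?xs\<rangle> [(Lam, 0), (Delta, 0), (Ant, 1), (Mu, 1), (Itg, 1)]"
    by (rule rw[OF eta_right], code_simp)
  also have "\<dots> \<approx>\<langle>?xs\<rangle> ?q"
    by (rule rw[OF metric_zigzag_right], code_simp)
  finally show ?thesis .
qed

lemma frobenius_comult_mu:
  "[(Lam, 0), (Delta, 0), (Ant, 1), (Mu, 1), (Mu, 1)] \<approx>\<langle>[Hc, Hc]\<rangle> [(Mu, 0),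
    (Lam, 0), (Delta, 0), (Ant, 1), (Mu, 1)]"
  by (rule rw[OF mu_assoc], code_simp)

text \<open>By centrality the associated coproduct can be written with its argument on either leg of
  the metric, which makes it a map of bimodules.\<close>

lemma mu_frobenius_comult:
  "[(Mu, 0), (Lam, 0), (Delta, 0), (Ant, 1), (Mu, 1)] \<approx>\<langle>[Hc, Hc]\<rangle> [(Lam, 1),
    (Delta, 1), (Ant, 2), (Mu, 2), (Mu, 0)]"
  (is "?p \<approx>\<langle>?xs\<rangle> ?q")
proof -
  have "?p \<approx>\<langle>?xs\<rangle> [(Lam, 0), (Delta, 0), (Ant, 1), (Mu, 2), (Mu, 1)]"
    by (rule weq_isotopic; code_simp)
  also have "\<dots> \<approx>\<langle>?xs\<rangle> [(Lam, 0), (Delta, 0), (Ant, 1), (Mu, 1), (Mu, 1)]"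
    by (rule rw_sym[OF mu_assoc], code_simp)
  also have "\<dots> \<approx>\<langle>?xs\<rangle> ?q"
    by (rule rw_sym[OF metric_central], code_simp)
  finally show ?thesis .
qed

text \<open>The two formulas for the product of a Frobenius coalgebra,
  \<open>a\<^sub>1 I(S(a\<^sub>2) b) = I(S(a) b\<^sub>1) b\<^sub>2\<close>. Both come from the
  twofold coproduct of \<Lambda> with its outer legs contracted against S(a) and b: one zigzag
  recovers a, the other b.\<close>

lemma frobenius_mult_alt:
  "[(Delta, 0), (Ant, 1), (Mu, 1), (Itg, 1)] \<approx>\<langle>[Hc, Hc]\<rangle> [(Delta, 1),
    (Ant, 0), (Mu, 0), (Itg, 0)]"
  (is "?p \<approx>\<langle>?xs\<rangle> ?q")
proof -
  have "?p \<approx>\<langle>?xs\<rangle> [(Ant, 0), (Lam, 1), (Delta, 1), (Delta, 2), (Mu, 0),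
    (Itg, 0), (Ant, 1), (Mu, 1), (Itg, 1)]"
    by (rule rw_sym[OF cometric_zigzag_left], code_simp)
  also have "\<dots> \<approx>\<langle>?xs\<rangle> [(Ant, 0), (Lam, 1), (Delta, 1), (Ant, 2),
    (Mu, 2), (Itg, 2), (Delta, 1), (Mu, 0), (Itg, 0)]"
    by (rule rw_sym[OF delta_coassoc], code_simp)
  also have "\<dots> \<approx>\<langle>?xs\<rangle> ?q"
    by (rule rw[OF metric_zigzag_right], code_simp)
  finally show ?thesis .
qed

lemma frobenius_mult_assoc:
  "[(Delta, 0), (Ant, 1), (Mu, 1), (Itg, 1), (Delta, 0), (Ant, 1), (Mu, 1), (Itg, 1)]
    \<approx>\<langle>[Hc, Hc, Hc]\<rangle> [(Delta, 1), (Ant, 2), (Mu, 2), (Itg, 2), (Delta, 0),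
    (Ant, 1), (Mu, 1), (Itg, 1)]"
  (is "?p \<approx>\<langle>?xs\<rangle> ?q")
proof -
  have "?p \<approx>\<langle>?xs\<rangle> [(Ant, 0), (Delta, 1), (Delta, 2), (Mu, 0), (Itg, 0),
    (Ant, 1), (Mu, 1), (Itg, 1)]"
    by (rule rw[OF frobenius_mult_alt], code_simp)
  also have "\<dots> \<approx>\<langle>?xs\<rangle> [(Delta, 1), (Delta, 1), (Ant, 0), (Mu, 0),
    (Itg, 0), (Ant, 1), (Mu, 1), (Itg, 1)]"
    by (rule rw_sym[OF delta_coassoc], code_simp)
  also have "\<dots> \<approx>\<langle>?xs\<rangle> ?q"
    by (rule rw_sym[OF frobenius_mult_alt], code_simp)
  finally show ?thesis .
qed

lemma frobenius_unit_left:
  "[(Lam, 0), (Delta, 0), (Eps, 1), (Delta, 0), (Ant, 1), (Mu, 1), (Itg, 1)]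
    \<approx>\<langle>[Hc]\<rangle> []"
  (is "?p \<approx>\<langle>?xs\<rangle> ?q")
proof -
  have "?p \<approx>\<langle>?xs\<rangle> [(Lam, 0), (Delta, 0), (Ant, 1), (Mu, 1), (Itg, 1)]"
    by (rule rw[OF eps_right], code_simp)
  also have "\<dots> \<approx>\<langle>?xs\<rangle> ?q"
    by (rule rw[OF metric_zigzag_right], code_simp)
  finally show ?thesis .
qed

lemma frobenius_unit_right:
  "[(Lam, 1), (Delta, 1), (Eps, 2), (Delta, 0), (Ant, 1), (Mu, 1), (Itg, 1)]
    \<approx>\<langle>[Hc]\<rangle> []"
  (is "?p \<approx>\<langle>?xs\<rangle> ?q")
proof -
  have "?p \<approx>\<langle>?xs\<rangle> [(Delta, 0), (Ant, 1), (Lam, 2), (Delta, 2), (Eps, 3),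
    (Mu, 1), (Itg, 1)]"
    by (rule weq_isotopic; code_simp)
  also have "\<dots> \<approx>\<langle>?xs\<rangle> [(Lam, 1), (Delta, 0), (Ant, 1), (Mu, 1), (Itg, 1)]"
    by (rule rw[OF eps_right], code_simp)
  also have "\<dots> \<approx>\<langle>?xs\<rangle> [(Lam, 1), (Delta, 1), (Ant, 0), (Mu, 0), (Itg, 0)]"
    by (rule rw[OF frobenius_mult_alt], code_simp)
  also have "\<dots> \<approx>\<langle>?xs\<rangle> ?q"
    by (rule rw[OF cometric_zigzag_left], code_simp)
  finally show ?thesis .
qed

lemma delta_frobenius_mult:
  "[(Delta, 0), (Delta, 1), (Ant, 2), (Mu, 2), (Itg, 2)]
    \<approx>\<langle>[Hc, Hc]\<rangle> [(Delta, 0), (Ant, 1), (Mu, 1), (Itg, 1), (Delta, 0)]"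
  by (rule rw_sym[OF delta_coassoc], code_simp)

lemma frobenius_mult_delta:
  "[(Delta, 0), (Ant, 1), (Mu, 1), (Itg, 1), (Delta, 0)]
    \<approx>\<langle>[Hc, Hc]\<rangle> [(Delta, 1), (Delta, 0), (Ant, 1), (Mu, 1), (Itg, 1)]"
  (is "?p \<approx>\<langle>?xs\<rangle> ?q")
proof -
  have "?p \<approx>\<langle>?xs\<rangle> [(Ant, 0), (Delta, 1), (Delta, 2), (Mu, 0), (Itg, 0)]"
    by (rule rw[OF frobenius_mult_alt], code_simp)
  also have "\<dots> \<approx>\<langle>?xs\<rangle> [(Delta, 1), (Delta, 1), (Ant, 0), (Mu, 0), (Itg, 0)]"
    by (rule rw_sym[OF delta_coassoc], code_simp)
  also have "\<dots> \<approx>\<langle>?xs\<rangle> ?q"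
    by (rule rw_sym[OF frobenius_mult_alt], code_simp)
  finally show ?thesis .
qed

section \<open>The pairing of the Hopf algebra with itself and the dual structure along it\<close>

lemma pairing_zigzag_left:
  "[(Lam, 1), (Delta, 1), (Ant, 2), (B', 1), (Ant_inv, 1), (Ant_inv, 1), (B, 0), (Ant, 0), (Ant, 0),
    (Mu, 0), (Itg, 0)] \<approx>\<langle>[Hc]\<rangle> []"
  (is "?p \<approx>\<langle>?xs\<rangle> ?q")
proof -
  have "?p \<approx>\<langle>?xs\<rangle> [(Lam, 1), (Delta, 1), (Ant, 2), (B', 1), (Ant_inv, 1),
    (B, 0), (Ant_inv, 0), (Ant, 0), (Ant, 0), (Mu, 0), (Itg, 0)]"
    by (rule rw[OF slide_over[of Ant_inv "Leaf Hc"]], code_simp)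
  also have "\<dots> \<approx>\<langle>?xs\<rangle> [(Lam, 1), (Delta, 1), (Ant, 2), (B', 1),
    (Ant_inv, 1), (B, 0), (Ant, 0), (Mu, 0), (Itg, 0)]"
    by (rule rw[OF ant_inv_left], code_simp)
  also have "\<dots> \<approx>\<langle>?xs\<rangle> [(Lam, 1), (Delta, 1), (Ant, 2), (B', 1),
    (Ant_inv, 1), (Ant, 1), (B, 0), (Mu, 0), (Itg, 0)]"
    by (rule rw_sym[OF slide_over[of Ant "Leaf Hc"]], code_simp)
  also have "\<dots> \<approx>\<langle>?xs\<rangle> [(Lam, 1), (Delta, 1), (Ant, 2), (B', 1),
    (B, 0), (Mu, 0), (Itg, 0)]"
    by (rule rw[OF ant_inv_left], code_simp)
  \<comment> \<open>Two cancelling pairs of crossings are created here and in the next step, so that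
    the whole metric can slide across the incoming strand to its left, where the zigzag of
    \<open>cup\<^sub>r\<close> applies.\<close>
  also have "\<dots> \<approx>\<langle>?xs\<rangle> [(Lam, 1), (Delta, 1), (B, 0), (Ant, 2),
    (B', 0), (B', 1), (B, 0), (Mu, 0), (Itg, 0)]"
    by (rule rw_sym[OF Br_inv_right[of "Leaf Hc" "Leaf Hc", simplified]], code_simp)
  also have "\<dots> \<approx>\<langle>?xs\<rangle> [(Lam, 1), (Delta, 1), (B, 0), (Ant, 2), (B, 1),
    (B', 1), (B', 0), (B', 1), (B, 0), (Mu, 0), (Itg, 0)]"
    by (rule rw_sym[OF Br_inv_right[of "Leaf Hc" "Leaf Hc", simplified]], code_simp)
  also have "\<dots> \<approx>\<langle>?xs\<rangle> [(Lam, 1), (Delta, 1), (B, 0), (B, 1), (Ant, 1),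
    (B', 1), (B', 0), (B', 1), (B, 0), (Mu, 0), (Itg, 0)]"
    by (rule rw[OF slide_over[of Ant "Leaf Hc"]], code_simp)
  also have "\<dots> \<approx>\<langle>?xs\<rangle> [(Lam, 1), (B, 0), (Delta, 0), (Ant, 1),
    (B', 1), (B', 0), (B', 1), (B, 0), (Mu, 0), (Itg, 0)]"
    by (rule rw[OF slide_over[of Delta "Leaf Hc"]], code_simp)
  also have "\<dots> \<approx>\<langle>?xs\<rangle> [(Lam, 0), (Delta, 0), (Ant, 1), (B', 1),
    (B', 0), (B', 1), (B, 0), (Mu, 0), (Itg, 0)]"
    by (rule rw[OF slide_over[of Lam "Leaf Hc"]], code_simp)
  \<comment> \<open>The braid relation for inverse crossings puts one of them next to the crossing
    of the pairing.\<close>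
  also have "\<dots> \<approx>\<langle>?xs\<rangle> [(Lam, 0), (Delta, 0), (Ant, 1), (B', 0),
    (B', 1), (B', 0), (B, 0), (Mu, 0), (Itg, 0)]"
    by (rule rw[OF slide_over_inv[of B' "Leaf Hc"]], code_simp)
  also have "\<dots> \<approx>\<langle>?xs\<rangle> [(Lam, 0), (Delta, 0), (Ant, 1), (B', 0),
    (B', 1), (Mu, 0), (Itg, 0)]"
    by (rule rw[OF Br_inv_left[of "Leaf Hc" "Leaf Hc", simplified]], code_simp)
  also have "\<dots> \<approx>\<langle>?xs\<rangle> [(Lam, 0), (Delta, 0), (Ant, 1), (Mu, 1),
    (B', 0), (Itg, 0)]"
    by (rule rw_sym[OF slide_over_inv[of Mu "Leaf Hc"]], code_simp)
  also have "\<dots> \<approx>\<langle>?xs\<rangle> [(Lam, 0), (Delta, 0), (Ant, 1), (Mu, 1), (Itg, 1)]"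
    by (rule rw_sym[OF slide_over_inv[of Itg "Leaf Hc"]], code_simp)
  also have "\<dots> \<approx>\<langle>?xs\<rangle> ?q"
    by (rule rw[OF metric_zigzag_right], code_simp)
  finally show ?thesis .
qed

lemma pairing_zigzag_right:
  "[(Lam, 0), (Delta, 0), (Ant, 1), (B', 0), (Ant_inv, 0), (Ant_inv, 0), (B, 1), (Ant, 1), (Ant, 1),
    (Mu, 1), (Itg, 1)] \<approx>\<langle>[Hc]\<rangle> []"
  (is "?p \<approx>\<langle>?xs\<rangle> ?q")
proof -
  \<comment> \<open>Here the metric moves to the right of the incoming strand; the inverse crossings
    involved later meet the crossing of the pairing.\<close>
  have "?p \<approx>\<langle>?xs\<rangle> [(Lam, 1), (B', 0), (Delta, 0), (Ant, 1), (B', 0),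
    (Ant_inv, 0), (Ant_inv, 0), (B, 1), (Ant, 1), (Ant, 1), (Mu, 1), (Itg, 1)]"
    by (rule rw_sym[OF slide_over_inv[of Lam "Leaf Hc"]], code_simp)
  also have "\<dots> \<approx>\<langle>?xs\<rangle> [(Lam, 1), (Delta, 1), (B', 0), (B', 1),
    (Ant, 1), (B', 0), (Ant_inv, 0), (Ant_inv, 0), (B, 1), (Ant, 1), (Ant, 1), (Mu, 1), (Itg, 1)]"
    by (rule rw_sym[OF slide_over_inv[of Delta "Leaf Hc"]], code_simp)
  also have "\<dots> \<approx>\<langle>?xs\<rangle> [(Lam, 1), (Delta, 1), (Ant, 2), (B', 0),
    (B', 1), (B', 0), (Ant_inv, 0), (Ant_inv, 0), (B, 1), (Ant, 1), (Ant, 1), (Mu, 1), (Itg, 1)]"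
    by (rule rw_sym[OF slide_over_inv[of Ant "Leaf Hc"]], code_simp)
  also have "\<dots> \<approx>\<langle>?xs\<rangle> [(Lam, 1), (Delta, 1), (Ant, 2), (B', 1),
    (B', 0), (Ant_inv, 0), (Ant_inv, 0), (B', 1), (B, 1), (Ant, 1), (Ant, 1), (Mu, 1), (Itg, 1)]"
    by (rule rw_sym[OF slide_over_inv[of B' "Leaf Hc"]], code_simp)
  also have "\<dots> \<approx>\<langle>?xs\<rangle> [(Lam, 1), (Delta, 1), (Ant, 2), (B', 1),
    (B', 0), (Ant, 1), (Ant_inv, 0), (Ant_inv, 0), (Ant, 1), (Mu, 1), (Itg, 1)]"
    by (rule rw[OF Br_inv_left[of "Leaf Hc" "Leaf Hc", simplified]], code_simp)
  also have "\<dots> \<approx>\<langle>?xs\<rangle> [(Ant, 0), (Lam, 1), (Delta, 1), (Ant, 2),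
    (B', 1), (B', 0), (Ant, 1), (Ant_inv, 0), (Ant_inv, 0), (Mu, 1), (Itg, 1)]"
    by (rule rw_sym[OF slide_under_inv[of Ant "Leaf Hc"]], code_simp)
  also have "\<dots> \<approx>\<langle>?xs\<rangle> [(Ant, 0), (Ant, 0), (Lam, 1), (Delta, 1),
    (Ant, 2), (B', 1), (B', 0), (Mu, 1), (Ant_inv, 0), (Ant_inv, 0), (Itg, 1)]"
    by (rule rw_sym[OF slide_under_inv[of Ant "Leaf Hc"]], code_simp)
  also have "\<dots> \<approx>\<langle>?xs\<rangle> [(Ant, 0), (Ant, 0), (Lam, 1), (Delta, 1),
    (Mu, 0), (Ant, 1), (B', 0), (Itg, 1), (Ant_inv, 0), (Ant_inv, 0)]"
    by (rule rw_sym[OF slide_under_inv[of Mu "Leaf Hc"]], code_simp)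
  also have "\<dots> \<approx>\<langle>?xs\<rangle> [(Ant, 0), (Ant, 0), (Lam, 1), (Delta, 1),
    (Ant, 2), (Mu, 0), (Itg, 0), (Ant_inv, 0), (Ant_inv, 0)]"
    by (rule rw_sym[OF slide_under_inv[of Itg "Leaf Hc"]], code_simp)
  also have "\<dots> \<approx>\<langle>?xs\<rangle> [(Ant, 0), (Ant, 0), (Ant_inv, 0), (Ant_inv, 0)]"
    by (rule rw[OF metric_zigzag_left], code_simp)
  also have "\<dots> \<approx>\<langle>?xs\<rangle> [(Ant, 0), (Ant_inv, 0)]"
    by (rule rw[OF ant_inv_right], code_simp)
  also have "\<dots> \<approx>\<langle>?xs\<rangle> ?q"
    by (rule rw[OF ant_inv_right], code_simp)
  finally show ?thesis .
qed

text \<open>The antipode reverses products along the braiding, so I(S(S(h)) a) equals I(S(S^-1(a)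
  S(h))) and the crossing is absorbed. The calculations with the pairing use this planar
  form.\<close>

lemma pairing_planar:
  "[(B, 0), (Ant, 0), (Ant, 0), (Mu, 0), (Itg, 0)]
    \<approx>\<langle>[Hc, Hc]\<rangle> [(Ant_inv, 0), (Ant, 1), (Mu, 0), (Ant, 0), (Itg, 0)]"
  (is "?p \<approx>\<langle>?xs\<rangle> ?q")
proof -
  have "?p \<approx>\<langle>?xs\<rangle> [(B, 0), (Ant, 0), (Ant, 0), (Ant_inv, 1), (Ant, 1),
    (Mu, 0), (Itg, 0)]"
    by (rule rw_sym[OF ant_inv_left], code_simp)
  also have "\<dots> \<approx>\<langle>?xs\<rangle> [(Ant, 1), (B, 0), (Ant_inv, 1), (Ant, 0),
    (Ant, 1), (Mu, 0), (Itg, 0)]"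
    by (rule rw_sym[OF slide_over[of Ant "Leaf Hc"]], code_simp)
  also have "\<dots> \<approx>\<langle>?xs\<rangle> [(Ant_inv, 0), (Ant, 1), (B, 0), (Ant, 0),
    (Ant, 1), (Mu, 0), (Itg, 0)]"
    by (rule rw_sym[OF slide_under[of Ant_inv "Leaf Hc"]], code_simp)
  also have "\<dots> \<approx>\<langle>?xs\<rangle> ?q"
    by (rule rw_sym[OF ant_mu], code_simp)
  finally show ?thesis .
qed

text \<open>With the left integral J = I S this is
  \<open>x\<^sub>1 J(x\<^sub>2 S(y)) = J(x S(y\<^sub>1)) y\<^sub>2\<close>: insert
  \<open>S(y\<^sub>2) y\<^sub>3\<close> behind \<open>x\<^sub>1\<close>, recognise the coproduct of
  \<open>x S(y\<^sub>1)\<close>, and integrate.\<close>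

lemma itg_ant_slide:
  "[(Delta, 0), (Ant, 2), (Mu, 1), (Ant, 1), (Itg, 1)]
    \<approx>\<langle>[Hc, Hc]\<rangle> [(Delta, 1), (Ant, 1), (Mu, 0), (Ant, 0), (Itg, 0)]"
  (is "?p \<approx>\<langle>?xs\<rangle> ?q")
proof -
  have "?p \<approx>\<langle>?xs\<rangle> [(Delta, 0), (Eta, 1), (Mu, 0), (Ant, 2), (Mu, 1),
    (Ant, 1), (Itg, 1)]"
    by (rule rw_sym[OF eta_right], code_simp)
  also have "\<dots> \<approx>\<langle>?xs\<rangle> [(Delta, 0), (Delta, 2), (Ant, 2), (Mu, 1),
    (Ant, 1), (Itg, 1), (Eps, 1), (Eta, 1), (Mu, 0)]"
    by (rule rw_sym[OF eps_right], code_simp)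
  also have "\<dots> \<approx>\<langle>?xs\<rangle> [(Delta, 0), (Delta, 2), (Ant, 2), (Mu, 1),
    (Ant, 1), (Delta, 2), (Ant, 2), (Itg, 1), (Mu, 1), (Mu, 0)]"
    by (rule rw_sym[OF ant_left], code_simp)
  also have "\<dots> \<approx>\<langle>?xs\<rangle> [(Delta, 0), (Delta, 2), (Ant, 2), (Mu, 1),
    (Delta, 2), (Ant, 2), (Ant, 1), (B, 1), (Itg, 2), (Mu, 1), (Mu, 0)]"
    by (rule rw[OF slide_under[of Itg "Leaf Hc"]], code_simp)
  also have "\<dots> \<approx>\<langle>?xs\<rangle> [(Delta, 0), (Delta, 2), (Ant, 2), (Delta, 3),
    (Ant, 3), (Mu, 1), (B, 1), (Ant, 2), (Itg, 2), (Mu, 1), (Mu, 0)]"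
    by (rule rw[OF slide_under[of Ant "Leaf Hc"]], code_simp)
  also have "\<dots> \<approx>\<langle>?xs\<rangle> [(Delta, 0), (Delta, 2), (Delta, 3), (Ant, 2),
    (Ant, 3), (B, 2), (B, 1), (Mu, 2), (Ant, 2), (Itg, 2), (Mu, 1), (Mu, 0)]"
    by (rule rw[OF slide_under[of Mu "Leaf Hc"]], code_simp)
  also have "\<dots> \<approx>\<langle>?xs\<rangle> [(Delta, 0), (Delta, 2), (Delta, 2), (Ant, 2),
    (Ant, 3), (B, 2), (B, 1), (Mu, 2), (Ant, 2), (Itg, 2), (Mu, 1), (Mu, 0)]"
    by (rule rw_sym[OF delta_coassoc], code_simp)
  also have "\<dots> \<approx>\<langle>?xs\<rangle> [(Delta, 0), (Delta, 2), (Ant, 2), (Delta, 2),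
    (B, 1), (Mu, 2), (Ant, 2), (Itg, 2), (Mu, 1), (Mu, 0)]"
    by (rule rw_sym[OF delta_ant], code_simp)
  also have "\<dots> \<approx>\<langle>?xs\<rangle> [(Delta, 1), (Ant, 1), (Delta, 0), (Delta, 2),
    (B, 1), (Mu, 0), (Mu, 1), (Ant, 1), (Itg, 1), (Mu, 0)]"
    by (rule rw_sym[OF mu_assoc], code_simp)
  also have "\<dots> \<approx>\<langle>?xs\<rangle> [(Delta, 1), (Ant, 1), (Mu, 0), (Delta, 0),
    (Ant, 1), (Itg, 1), (Mu, 0)]"
    by (rule rw_sym[OF delta_mu], code_simp)
  also have "\<dots> \<approx>\<langle>?xs\<rangle> [(Delta, 1), (Ant, 1), (Mu, 0), (Ant, 0),
    (Itg, 0), (Eta, 0), (Mu, 0)]"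
    by (rule rw[OF itg_ant_left], code_simp)
  also have "\<dots> \<approx>\<langle>?xs\<rangle> ?q"
    by (rule rw[OF eta_left], code_simp)
  finally show ?thesis .
qed

lemma ant_times:
  "[(Ant, 0), (Mu, 0)] \<approx>\<langle>[Hc, Hc]\<rangle> [(B', 0), (Ant_inv, 0), (Mu, 0), (Ant, 0)]"
  (is "?p \<approx>\<langle>?xs\<rangle> ?q")
proof -
  have "?p \<approx>\<langle>?xs\<rangle> [(B', 0), (B, 0), (Ant, 0), (Mu, 0)]"
    by (rule rw_sym[OF Br_inv_left[of "Leaf Hc" "Leaf Hc", simplified]], code_simp)
  also have "\<dots> \<approx>\<langle>?xs\<rangle> [(B', 0), (B, 0), (Ant_inv, 1), (Ant, 0),
    (Ant, 1), (Mu, 0)]"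
    by (rule rw_sym[OF ant_inv_left], code_simp)
  also have "\<dots> \<approx>\<langle>?xs\<rangle> [(B', 0), (Ant_inv, 0), (B, 0), (Ant, 0),
    (Ant, 1), (Mu, 0)]"
    by (rule rw_sym[OF slide_under[of Ant_inv "Leaf Hc"]], code_simp)
  also have "\<dots> \<approx>\<langle>?xs\<rangle> ?q"
    by (rule rw_sym[OF ant_mu], code_simp)
  finally show ?thesis .
qed

text \<open>The product of the second Hopf algebra, followed by the inverse antipode with which the
  planar pairing begins. For J = I S and c = S^-1(b) it is
  \<open>J(S^-1(a) S(c\<^sub>1)) c\<^sub>2\<close>, without crossings and ready for
  \<open>itg_ant_slide\<close>.\<close>

lemma pairing_mult_ant:
  "[(B, 0), (Delta, 0), (Ant, 1), (Mu, 1), (Itg, 1), (Ant_inv, 0)]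
    \<approx>\<langle>[Hc, Hc]\<rangle> [(Ant_inv, 0), (Ant_inv, 1), (Delta, 1), (Ant, 1), (Mu, 0),
    (Ant, 0), (Itg, 0)]"
  (is "?p \<approx>\<langle>?xs\<rangle> ?q")
proof -
  have "?p \<approx>\<langle>?xs\<rangle> [(B, 0), (Delta, 0), (Ant_inv, 0), (Ant, 1), (Mu, 1), (Itg, 1)]"
    by (rule weq_isotopic; code_simp)
  also have "\<dots> \<approx>\<langle>?xs\<rangle> [(B, 0), (Delta, 0), (Ant_inv, 0), (B', 1),
    (Ant_inv, 1), (Mu, 1), (Ant, 1), (Itg, 1)]"
    by (rule rw[OF ant_times], code_simp)
  also have "\<dots> \<approx>\<langle>?xs\<rangle> [(B, 0), (Ant_inv, 0), (Ant, 0), (Delta, 0),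
    (Ant_inv, 0), (B', 1), (Ant_inv, 1), (Mu, 1), (Ant, 1), (Itg, 1)]"
    by (rule rw_sym[OF ant_inv_left], code_simp)
  also have "\<dots> \<approx>\<langle>?xs\<rangle> [(B, 0), (Ant_inv, 0), (Delta, 0), (Ant, 1),
    (Ant, 0), (B, 0), (Ant_inv, 0), (B', 1), (Ant_inv, 1), (Mu, 1), (Ant, 1), (Itg, 1)]"
    by (rule rw[OF delta_ant], code_simp)
  also have "\<dots> \<approx>\<langle>?xs\<rangle> [(B, 0), (Ant_inv, 0), (Delta, 0), (Ant, 1),
    (B, 0), (Ant_inv, 0), (Ant, 1), (B', 1), (Ant_inv, 1), (Mu, 1), (Ant, 1), (Itg, 1)]"
    by (rule rw[OF slide_under[of Ant "Leaf Hc"]], code_simp)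
  also have "\<dots> \<approx>\<langle>?xs\<rangle> [(B, 0), (Ant_inv, 0), (Delta, 0), (B, 0),
    (Ant, 0), (Ant_inv, 0), (Ant, 1), (B', 1), (Ant_inv, 1), (Mu, 1), (Ant, 1), (Itg, 1)]"
    by (rule rw[OF slide_over[of Ant "Leaf Hc"]], code_simp)
  also have "\<dots> \<approx>\<langle>?xs\<rangle> [(B, 0), (Ant_inv, 0), (Delta, 0), (B, 0),
    (Ant, 1), (B', 1), (Ant_inv, 1), (Mu, 1), (Ant, 1), (Itg, 1)]"
    by (rule rw[OF ant_inv_right], code_simp)
  also have "\<dots> \<approx>\<langle>?xs\<rangle> [(B, 0), (Ant_inv, 0), (Delta, 0), (B, 0),
    (B', 1), (Ant_inv, 1), (Ant, 2), (Mu, 1), (Ant, 1), (Itg, 1)]"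
    by (rule rw[OF slide_under_inv[of Ant "Leaf Hc"]], code_simp)
  also have "\<dots> \<approx>\<langle>?xs\<rangle> [(Ant_inv, 1), (B, 0), (Delta, 0), (B, 0),
    (B', 1), (Ant_inv, 1), (Ant, 2), (Mu, 1), (Ant, 1), (Itg, 1)]"
    by (rule rw_sym[OF slide_over[of Ant_inv "Leaf Hc"]], code_simp)
  also have "\<dots> \<approx>\<langle>?xs\<rangle> [(Ant_inv, 1), (Delta, 1), (B, 0), (B, 1),
    (B, 0), (B', 1), (Ant_inv, 1), (Ant, 2), (Mu, 1), (Ant, 1), (Itg, 1)]"
    by (rule rw_sym[OF slide_over[of Delta "Leaf Hc"]], code_simp)
  \<comment> \<open>The braid relation brings a crossing next to the inverse one left by
    \<open>ant_times\<close>.\<close>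
  also have "\<dots> \<approx>\<langle>?xs\<rangle> [(Ant_inv, 1), (Delta, 1), (B, 1), (B, 0),
    (B, 1), (B', 1), (Ant_inv, 1), (Ant, 2), (Mu, 1), (Ant, 1), (Itg, 1)]"
    by (rule rw_sym[OF slide_over[of B "Leaf Hc"]], code_simp)
  also have "\<dots> \<approx>\<langle>?xs\<rangle> [(Ant_inv, 1), (Delta, 1), (B, 1), (B, 0),
    (Ant_inv, 1), (Ant, 2), (Mu, 1), (Ant, 1), (Itg, 1)]"
    by (rule rw[OF Br_inv_right[of "Leaf Hc" "Leaf Hc", simplified]], code_simp)
  also have "\<dots> \<approx>\<langle>?xs\<rangle> [(Ant_inv, 0), (Ant_inv, 1), (Delta, 1), (B, 1),
    (Ant, 2), (B, 0), (Mu, 1), (Ant, 1), (Itg, 1)]"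
    by (rule rw_sym[OF slide_under[of Ant_inv "Leaf Hc"]], code_simp)
  also have "\<dots> \<approx>\<langle>?xs\<rangle> [(Ant_inv, 0), (Ant_inv, 1), (Delta, 1),
    (Ant, 1), (B, 1), (B, 0), (Mu, 1), (Ant, 1), (Itg, 1)]"
    by (rule rw_sym[OF slide_under[of Ant "Leaf Hc"]], code_simp)
  also have "\<dots> \<approx>\<langle>?xs\<rangle> [(Ant_inv, 0), (Ant_inv, 1), (Delta, 1),
    (Ant, 1), (Mu, 0), (B, 0), (Ant, 1), (Itg, 1)]"
    by (rule rw_sym[OF slide_under[of Mu "Leaf Hc"]], code_simp)
  also have "\<dots> \<approx>\<langle>?xs\<rangle> [(Ant_inv, 0), (Ant_inv, 1), (Delta, 1),
    (Ant, 1), (Mu, 0), (Ant, 0), (B, 0), (Itg, 1)]"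
    by (rule rw_sym[OF slide_under[of Ant "Leaf Hc"]], code_simp)
  also have "\<dots> \<approx>\<langle>?xs\<rangle> ?q"
    by (rule rw_sym[OF slide_under[of Itg "Leaf Hc"]], code_simp)
  finally show ?thesis .
qed

text \<open>Adjointness of the second product and the given coproduct in the nested order,
  \<open><ab, h> = <a, h\<^sub>2> <b, h\<^sub>1>\<close>. In planar form both sides differ only by
  moving a left integral across a coproduct.\<close>

lemma pairing_mult_eval:
  "[(B, 0), (Delta, 0), (Ant, 1), (Mu, 1), (Itg, 1), (B, 0), (Ant, 0), (Ant, 0), (Mu, 0), (Itg, 0)]
    \<approx>\<langle>[Hc, Hc, Hc]\<rangle> [(Delta, 2), (B, 1), (Ant, 1), (Ant, 1), (Mu, 1),
    (Itg, 1), (B, 0), (Ant, 0), (Ant, 0), (Mu, 0), (Itg, 0)]"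
  (is "?p \<approx>\<langle>?xs\<rangle> ?q")
proof -
  have "?p \<approx>\<langle>?xs\<rangle> [(B, 0), (Delta, 0), (Ant, 1), (Mu, 1), (Itg, 1),
    (Ant_inv, 0), (Ant, 1), (Mu, 0), (Ant, 0), (Itg, 0)]"
    by (rule rw[OF pairing_planar], code_simp)
  also have "\<dots> \<approx>\<langle>?xs\<rangle> [(Ant_inv, 0), (Ant_inv, 1), (Delta, 1),
    (Ant, 3), (Mu, 2), (Ant, 2), (Itg, 2), (Ant, 1), (Mu, 0), (Ant, 0), (Itg, 0)]"
    by (rule rw[OF pairing_mult_ant], code_simp)
  also have "\<dots> \<approx>\<langle>?xs\<rangle> [(Delta, 2), (Ant, 2), (Ant_inv, 1), (Mu, 1),
    (Ant, 1), (Itg, 1), (Ant_inv, 0), (Ant, 1), (Mu, 0), (Ant, 0), (Itg, 0)]"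
    by (rule rw[OF itg_ant_slide], code_simp)
  also have "\<dots> \<approx>\<langle>?xs\<rangle> [(Delta, 2), (Ant_inv, 1), (Ant, 2), (Mu, 1),
    (Ant, 1), (Itg, 1), (B, 0), (Ant, 0), (Ant, 0), (Mu, 0), (Itg, 0)]"
    by (rule rw_sym[OF pairing_planar], code_simp)
  also have "\<dots> \<approx>\<langle>?xs\<rangle> ?q"
    by (rule rw_sym[OF pairing_planar], code_simp)
  finally show ?thesis .
qed

text \<open>The left-hand word is the multiplication of the dual along the pairing. Equality after
  pairing suffices, because the copairing is inverse to it.\<close>

lemma pairing_mult:
  "[(Lam, 2), (Delta, 2), (Ant, 3), (B', 2), (Ant_inv, 2), (Ant_inv, 2), (Delta, 2), (B, 1),
    (Ant, 1), (Ant, 1), (Mu, 1), (Itg, 1), (B, 0), (Ant, 0), (Ant, 0), (Mu, 0), (Itg, 0)]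
    \<approx>\<langle>[Hc, Hc]\<rangle> [(B, 0), (Delta, 0), (Ant, 1), (Mu, 1), (Itg, 1)]"
  (is "?p \<approx>\<langle>?xs\<rangle> ?q")
proof -
  have "?p \<approx>\<langle>?xs\<rangle> [(B, 0), (Delta, 0), (Ant, 1), (Mu, 1), (Itg, 1),
    (Lam, 1), (Delta, 1), (Ant, 2), (B', 1), (Ant_inv, 1), (Ant_inv, 1), (B, 0), (Ant, 0), (Ant, 0),
    (Mu, 0), (Itg, 0)]"
    by (rule rw_sym[OF pairing_mult_eval], code_simp)
  also have "\<dots> \<approx>\<langle>?xs\<rangle> ?q"
    by (rule rw[OF pairing_zigzag_left], code_simp)
  finally show ?thesis .
qed

lemma ant_inv_eps:
  "[(Ant_inv, 0), (Eps, 0)] \<approx>\<langle>[Hc]\<rangle> [(Eps, 0)]"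
  (is "?p \<approx>\<langle>?xs\<rangle> ?q")
proof -
  have "?p \<approx>\<langle>?xs\<rangle> [(Ant_inv, 0), (Ant, 0), (Eps, 0)]"
    by (rule rw_sym[OF ant_eps], code_simp)
  also have "\<dots> \<approx>\<langle>?xs\<rangle> ?q"
    by (rule rw[OF ant_inv_left], code_simp)
  finally show ?thesis .
qed

lemma pairing_unit:
  "[(Lam, 0), (Delta, 0), (Ant, 1), (B', 0), (Ant_inv, 0), (Ant_inv, 0), (Eps, 0)]
    \<approx>\<langle>[]\<rangle> [(Lam, 0), (Delta, 0), (Eps, 1)]"
  (is "?p \<approx>\<langle>?xs\<rangle> ?q")
proof -
  have "?p \<approx>\<langle>?xs\<rangle> [(Lam, 0), (Delta, 0), (Ant, 1), (B', 0), (Ant_inv, 0), (Eps, 0)]"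
    by (rule rw[OF ant_inv_eps], code_simp)
  also have "\<dots> \<approx>\<langle>?xs\<rangle> [(Lam, 0), (Delta, 0), (Ant, 1), (B', 0), (Eps, 0)]"
    by (rule rw[OF ant_inv_eps], code_simp)
  also have "\<dots> \<approx>\<langle>?xs\<rangle> [(Lam, 0), (Delta, 0), (Ant, 1), (Eps, 1)]"
    by (rule rw_sym[OF slide_over_inv[of Eps "Leaf Hc"]], code_simp)
  also have "\<dots> \<approx>\<langle>?xs\<rangle> ?q"
    by (rule rw[OF ant_eps], code_simp)
  finally show ?thesis .
qed

lemma pairing_counit:
  "[(Eta, 1), (B, 0), (Ant, 0), (Ant, 0), (Mu, 0), (Itg, 0)]
    \<approx>\<langle>[Hc]\<rangle> [(Eta, 1), (Mu, 0), (Itg, 0)]"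
  (is "?p \<approx>\<langle>?xs\<rangle> ?q")
proof -
  have "?p \<approx>\<langle>?xs\<rangle> [(Eta, 0), (Ant, 0), (Ant, 0), (Mu, 0), (Itg, 0)]"
    by (rule rw[OF slide_over[of Eta "Leaf Hc"]], code_simp)
  also have "\<dots> \<approx>\<langle>?xs\<rangle> [(Eta, 0), (Ant, 0), (Ant, 0), (Mu, 0),
    (Eta, 1), (Mu, 0), (Itg, 0)]"
    by (rule rw_sym[OF eta_right], code_simp)
  also have "\<dots> \<approx>\<langle>?xs\<rangle> [(Eta, 0), (Ant, 0), (Mu, 0), (Eta, 1), (Mu, 0),
    (Itg, 0)]"
    by (rule rw[OF ant_eta], code_simp)
  also have "\<dots> \<approx>\<langle>?xs\<rangle> [(Eta, 0), (Mu, 0), (Eta, 1), (Mu, 0), (Itg, 0)]"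
    by (rule rw[OF ant_eta], code_simp)
  also have "\<dots> \<approx>\<langle>?xs\<rangle> ?q"
    by (rule rw[OF eta_left], code_simp)
  finally show ?thesis .
qed

lemma ant_inv_mu:
  "[(Mu, 0), (Ant_inv, 0)] \<approx>\<langle>[Hc, Hc]\<rangle> [(B', 0), (Ant_inv, 0), (Ant_inv, 1),
    (Mu, 0)]"
  (is "?p \<approx>\<langle>?xs\<rangle> ?q")
proof -
  have "?p \<approx>\<langle>?xs\<rangle> [(B', 0), (B, 0), (Mu, 0), (Ant_inv, 0)]"
    by (rule rw_sym[OF Br_inv_left[of "Leaf Hc" "Leaf Hc", simplified]], code_simp)
  also have "\<dots> \<approx>\<langle>?xs\<rangle> [(B', 0), (B, 0), (Ant_inv, 1), (Ant, 1),
    (Mu, 0), (Ant_inv, 0)]"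
    by (rule rw_sym[OF ant_inv_left], code_simp)
  also have "\<dots> \<approx>\<langle>?xs\<rangle> [(B', 0), (Ant_inv, 0), (B, 0), (Ant, 1),
    (Mu, 0), (Ant_inv, 0)]"
    by (rule rw_sym[OF slide_under[of Ant_inv "Leaf Hc"]], code_simp)
  also have "\<dots> \<approx>\<langle>?xs\<rangle> [(B', 0), (Ant_inv, 0), (B, 0), (Ant_inv, 0),
    (Ant, 0), (Ant, 1), (Mu, 0), (Ant_inv, 0)]"
    by (rule rw_sym[OF ant_inv_left], code_simp)
  also have "\<dots> \<approx>\<langle>?xs\<rangle> [(B', 0), (Ant_inv, 0), (Ant_inv, 1), (B, 0),
    (Ant, 0), (Ant, 1), (Mu, 0), (Ant_inv, 0)]"
    by (rule rw_sym[OF slide_over[of Ant_inv "Leaf Hc"]], code_simp)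
  also have "\<dots> \<approx>\<langle>?xs\<rangle> [(B', 0), (Ant_inv, 0), (Ant_inv, 1), (Mu, 0),
    (Ant, 0), (Ant_inv, 0)]"
    by (rule rw_sym[OF ant_mu], code_simp)
  also have "\<dots> \<approx>\<langle>?xs\<rangle> ?q"
    by (rule rw[OF ant_inv_right], code_simp)
  finally show ?thesis .
qed

lemma cometric_eval:
  "[(Lam, 1), (Delta, 1), (Mu, 0), (Itg, 0)] \<approx>\<langle>[Hc]\<rangle> [(Ant_inv, 0)]"
  (is "?p \<approx>\<langle>?xs\<rangle> ?q")
proof -
  have "?p \<approx>\<langle>?xs\<rangle> [(Lam, 1), (Delta, 1), (Ant, 2), (Mu, 0), (Itg, 0), (Ant_inv, 0)]"
    by (rule rw_sym[OF ant_inv_right], code_simp)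
  also have "\<dots> \<approx>\<langle>?xs\<rangle> ?q"
    by (rule rw[OF metric_zigzag_left], code_simp)
  finally show ?thesis .
qed

lemma itg_ant_times:
  "[(Ant_inv, 0), (Mu, 0), (Ant, 0), (Itg, 0)] \<approx>\<langle>[Hc, Hc]\<rangle> [(Ant, 1),
    (B, 0), (Mu, 0), (Itg, 0)]"
  (is "?p \<approx>\<langle>?xs\<rangle> ?q")
proof -
  have "?p \<approx>\<langle>?xs\<rangle> [(Ant_inv, 0), (B, 0), (Ant, 0), (Ant, 1), (Mu, 0), (Itg, 0)]"
    by (rule rw[OF ant_mu], code_simp)
  also have "\<dots> \<approx>\<langle>?xs\<rangle> [(B, 0), (Ant, 0), (Ant_inv, 1), (Ant, 1),
    (Mu, 0), (Itg, 0)]"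
    by (rule rw[OF slide_under[of Ant_inv "Leaf Hc"]], code_simp)
  also have "\<dots> \<approx>\<langle>?xs\<rangle> [(B, 0), (Ant, 0), (Mu, 0), (Itg, 0)]"
    by (rule rw[OF ant_inv_left], code_simp)
  also have "\<dots> \<approx>\<langle>?xs\<rangle> ?q"
    by (rule rw_sym[OF slide_over[of Ant "Leaf Hc"]], code_simp)
  finally show ?thesis .
qed

text \<open>With J = I S the left side is \<open>J(S^-1(a) \<Lambda>\<^sub>2 S(h)) I(S(S(k))
  \<Lambda>\<^sub>1)\<close>, up to braidings. By \<open>cometric_eval\<close> the contraction with
  I replaces \<open>\<Lambda>\<^sub>2\<close> by S(k), and S(k) S(h) is S(h k) with its
  crossing.\<close>

lemma pairing_comult_eval:
  "[(Lam, 0), (Delta, 0), (Ant, 1), (Mu, 1), (B, 1), (Ant, 1), (Ant, 1), (Mu, 1), (Itg, 1), (B, 0),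
    (Ant, 0), (Ant, 0), (Mu, 0), (Itg, 0)] \<approx>\<langle>[Hc, Hc, Hc]\<rangle> [(Mu, 1), (B, 0),
    (Ant, 0), (Ant, 0), (Mu, 0), (Itg, 0)]"
  (is "?p \<approx>\<langle>?xs\<rangle> ?q")
proof -
  have "?p \<approx>\<langle>?xs\<rangle> [(Lam, 0), (Delta, 0), (Ant, 3), (Ant, 1), (Mu, 1),
    (Ant_inv, 1), (Mu, 1), (Ant, 1), (Itg, 1), (B, 0), (Ant, 0), (Ant, 0), (Mu, 0), (Itg, 0)]"
    by (rule rw[OF pairing_planar], code_simp)
  also have "\<dots> \<approx>\<langle>?xs\<rangle> [(Lam, 0), (Delta, 0), (Ant_inv, 0), (Ant, 1),
    (Mu, 1), (Ant_inv, 1), (Ant, 2), (Mu, 1), (Ant, 1), (Itg, 1), (Ant, 1), (Mu, 0), (Ant, 0),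
    (Itg, 0)]"
    by (rule rw[OF pairing_planar], code_simp)
  also have "\<dots> \<approx>\<langle>?xs\<rangle> [(Lam, 0), (Delta, 0), (Ant, 4), (Ant, 3),
    (Ant, 1), (B', 1), (Ant_inv, 2), (Ant_inv, 1), (Mu, 1), (Mu, 1), (Ant, 1), (Itg, 1),
    (Ant_inv, 0), (Mu, 0), (Ant, 0), (Itg, 0)]"
    by (rule rw[OF ant_inv_mu], code_simp)
  also have "\<dots> \<approx>\<langle>?xs\<rangle> [(Lam, 0), (Delta, 0), (Ant, 1), (B', 1),
    (Ant_inv, 1), (Ant_inv, 2), (Mu, 1), (Ant, 2), (Mu, 1), (Ant, 1), (Itg, 1), (Ant, 1), (Ant, 1),
    (B, 0), (Mu, 0), (Itg, 0)]"
    by (rule rw[OF itg_ant_times], code_simp)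
  also have "\<dots> \<approx>\<langle>?xs\<rangle> [(Lam, 0), (Delta, 0), (B', 1), (Ant, 2),
    (Ant_inv, 2), (Ant_inv, 1), (Mu, 1), (Ant, 2), (Mu, 1), (Ant, 1), (Itg, 1), (Ant, 1), (Ant, 1),
    (B, 0), (Mu, 0), (Itg, 0)]"
    by (rule rw[OF slide_under_inv[of Ant "Leaf Hc"]], code_simp)
  also have "\<dots> \<approx>\<langle>?xs\<rangle> [(Lam, 0), (Delta, 0), (B', 1), (Ant_inv, 1),
    (Mu, 1), (Ant, 2), (Mu, 1), (Ant, 1), (Itg, 1), (Ant, 1), (Ant, 1), (B, 0), (Mu, 0), (Itg, 0)]"
    by (rule rw[OF ant_inv_right], code_simp)
  also have "\<dots> \<approx>\<langle>?xs\<rangle> [(Lam, 1), (B, 0), (Delta, 0), (B', 1),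
    (Ant_inv, 1), (Mu, 1), (Ant, 2), (Mu, 1), (Ant, 1), (Itg, 1), (Ant, 1), (Ant, 1), (B, 0),
    (Mu, 0), (Itg, 0)]"
    by (rule rw_sym[OF slide_over[of Lam "Leaf Hc"]], code_simp)
  also have "\<dots> \<approx>\<langle>?xs\<rangle> [(Lam, 1), (Delta, 1), (B, 0), (B, 1), (B', 1),
    (Ant_inv, 1), (Mu, 1), (Ant, 2), (Mu, 1), (Ant, 1), (Itg, 1), (Ant, 1), (Ant, 1), (B, 0),
    (Mu, 0), (Itg, 0)]"
    by (rule rw_sym[OF slide_over[of Delta "Leaf Hc"]], code_simp)
  also have "\<dots> \<approx>\<langle>?xs\<rangle> [(Lam, 1), (Delta, 1), (B, 0), (Ant_inv, 1),
    (Mu, 1), (Ant, 2), (Mu, 1), (Ant, 1), (Ant, 2), (Ant, 2), (Itg, 1), (B, 0), (Mu, 0), (Itg, 0)]"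
    by (rule rw[OF Br_inv_right[of "Leaf Hc" "Leaf Hc", simplified]], code_simp)
  also have "\<dots> \<approx>\<langle>?xs\<rangle> [(Lam, 1), (Delta, 1), (B, 0), (Ant_inv, 1),
    (Mu, 1), (Ant, 2), (Mu, 1), (Ant, 2), (Ant, 2), (Ant, 1), (B, 1), (B, 0), (Mu, 0), (Itg, 0),
    (Itg, 0)]"
    by (rule rw[OF slide_under[of Itg "Leaf Hc"]], code_simp)
  also have "\<dots> \<approx>\<langle>?xs\<rangle> [(Lam, 1), (Delta, 1), (B, 0), (Ant_inv, 1),
    (Mu, 1), (Ant, 2), (Ant, 3), (Ant, 3), (Mu, 1), (B, 1), (B, 0), (Mu, 0), (Itg, 0), (Ant, 0),
    (Itg, 0)]"
    by (rule rw[OF slide_under[of Ant "Leaf Hc"]], code_simp)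
  also have "\<dots> \<approx>\<langle>?xs\<rangle> [(Lam, 1), (Delta, 1), (B, 0), (Ant_inv, 1),
    (Ant, 4), (Ant, 4), (Ant, 3), (B, 3), (Mu, 1), (B, 1), (B, 0), (Mu, 0), (Itg, 0), (Mu, 0),
    (Ant, 0), (Itg, 0)]"
    by (rule rw[OF slide_under[of Mu "Leaf Hc"]], code_simp)
  also have "\<dots> \<approx>\<langle>?xs\<rangle> [(Lam, 1), (Delta, 1), (B, 0), (Ant_inv, 1),
    (Ant, 3), (Ant, 4), (Ant, 4), (B, 3), (B, 2), (B, 1), (B, 0), (Mu, 0), (Itg, 0), (Mu, 0),
    (Mu, 0), (Ant, 0), (Itg, 0)]"
    by (rule rw[OF slide_under[of Mu "Leaf Hc"]], code_simp)
  also have "\<dots> \<approx>\<langle>?xs\<rangle> [(Ant_inv, 0), (Lam, 1), (Delta, 1), (Ant, 4),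
    (Ant, 4), (Ant, 3), (B, 3), (B, 2), (B, 0), (B, 1), (B, 0), (Mu, 0), (Itg, 0), (Mu, 0), (Mu, 0),
    (Ant, 0), (Itg, 0)]"
    by (rule rw_sym[OF slide_under[of Ant_inv "Leaf Hc"]], code_simp)
  \<comment> \<open>The braid relation reorders the crossings so that both legs of the coproduct
    cross the strand of k together; \<open>Delta\<close> and \<open>Lam\<close> can then be pulled
    through it.\<close>
  also have "\<dots> \<approx>\<langle>?xs\<rangle> [(Ant_inv, 0), (Lam, 1), (Ant, 3), (Ant, 3),
    (Ant, 2), (B, 2), (Delta, 1), (B, 2), (B, 1), (B, 0), (B, 1), (Mu, 0), (Itg, 0), (Mu, 0),
    (Mu, 0), (Ant, 0), (Itg, 0)]"
    by (rule rw_sym[OF slide_over[of B "Leaf Hc"]], code_simp)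
  also have "\<dots> \<approx>\<langle>?xs\<rangle> [(Ant_inv, 0), (Ant, 2), (Ant, 2), (Ant, 1),
    (B, 1), (Lam, 1), (B, 1), (B, 0), (Delta, 2), (B, 1), (Mu, 0), (Itg, 0), (Mu, 0), (Mu, 0),
    (Ant, 0), (Itg, 0)]"
    by (rule rw[OF slide_under[of Delta "Leaf Hc"]], code_simp)
  also have "\<dots> \<approx>\<langle>?xs\<rangle> [(Ant_inv, 0), (Ant, 1), (Ant, 2), (Ant, 2),
    (B, 1), (Lam, 2), (Delta, 2), (B, 0), (B, 1), (Mu, 0), (Itg, 0), (Mu, 0), (Mu, 0), (Ant, 0),
    (Itg, 0)]"
    by (rule rw[OF slide_under[of Lam "Leaf Hc"]], code_simp)
  also have "\<dots> \<approx>\<langle>?xs\<rangle> [(Ant_inv, 0), (Ant, 1), (Ant, 2), (Ant, 2),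
    (B, 1), (Lam, 2), (Delta, 2), (Mu, 1), (B, 0), (Itg, 0), (Mu, 0), (Mu, 0), (Ant, 0), (Itg, 0)]"
    by (rule rw_sym[OF slide_over[of Mu "Leaf Hc"]], code_simp)
  also have "\<dots> \<approx>\<langle>?xs\<rangle> [(Ant_inv, 0), (Ant, 1), (Ant, 2), (Ant, 2),
    (B, 1), (Lam, 2), (Delta, 2), (Mu, 1), (Itg, 1), (Mu, 0), (Mu, 0), (Ant, 0), (Itg, 0)]"
    by (rule rw_sym[OF slide_over[of Itg "Leaf Hc"]], code_simp)
  also have "\<dots> \<approx>\<langle>?xs\<rangle> [(Ant_inv, 0), (Ant, 1), (Ant, 2), (Ant, 2),
    (B, 1), (Ant_inv, 1), (Mu, 0), (Mu, 0), (Ant, 0), (Itg, 0)]"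
    by (rule rw[OF cometric_eval], code_simp)
  also have "\<dots> \<approx>\<langle>?xs\<rangle> [(Ant_inv, 0), (Ant, 1), (Ant, 2), (Ant, 2),
    (B, 1), (Ant_inv, 1), (Mu, 1), (Mu, 0), (Ant, 0), (Itg, 0)]"
    by (rule rw[OF mu_assoc], code_simp)
  also have "\<dots> \<approx>\<langle>?xs\<rangle> [(Ant_inv, 0), (Ant, 1), (Ant, 2), (Ant, 2),
    (Ant_inv, 2), (B, 1), (Mu, 1), (Mu, 0), (Ant, 0), (Itg, 0)]"
    by (rule rw_sym[OF slide_over[of Ant_inv "Leaf Hc"]], code_simp)
  also have "\<dots> \<approx>\<langle>?xs\<rangle> [(Ant_inv, 0), (Ant, 1), (Ant, 2), (B, 1),
    (Mu, 1), (Mu, 0), (Ant, 0), (Itg, 0)]"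
    by (rule rw[OF ant_inv_right], code_simp)
  also have "\<dots> \<approx>\<langle>?xs\<rangle> [(Ant_inv, 0), (Ant, 1), (B, 1), (Ant, 1),
    (Mu, 1), (Mu, 0), (Ant, 0), (Itg, 0)]"
    by (rule rw[OF slide_over[of Ant "Leaf Hc"]], code_simp)
  also have "\<dots> \<approx>\<langle>?xs\<rangle> [(Ant_inv, 0), (B, 1), (Ant, 1), (Ant, 2),
    (Mu, 1), (Mu, 0), (Ant, 0), (Itg, 0)]"
    by (rule rw[OF slide_under[of Ant "Leaf Hc"]], code_simp)
  also have "\<dots> \<approx>\<langle>?xs\<rangle> [(Mu, 1), (Ant_inv, 0), (Ant, 1), (Mu, 0),
    (Ant, 0), (Itg, 0)]"
    by (rule rw_sym[OF ant_mu], code_simp)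
  also have "\<dots> \<approx>\<langle>?xs\<rangle> ?q"
    by (rule rw_sym[OF pairing_planar], code_simp)
  finally show ?thesis .
qed

lemma pairing_comult:
  "[(Lam, 1), (Delta, 1), (Ant, 2), (B', 1), (Ant_inv, 1), (Ant_inv, 1), (Lam, 2), (Delta, 2),
    (Ant, 3), (B', 2), (Ant_inv, 2), (Ant_inv, 2), (Mu, 1), (B, 0), (Ant, 0), (Ant, 0), (Mu, 0),
    (Itg, 0)] \<approx>\<langle>[Hc]\<rangle> [(Lam, 0), (Delta, 0), (Ant, 1), (Mu, 1)]"
  (is "?p \<approx>\<langle>?xs\<rangle> ?q")
proof -
  have "?p \<approx>\<langle>?xs\<rangle> [(Lam, 0), (Delta, 0), (Ant, 1), (Mu, 1), (Lam, 2),
    (Delta, 2), (Ant, 3), (B', 2), (Ant_inv, 2), (Ant_inv, 2), (B, 1), (Ant, 1), (Ant, 1), (Mu, 1),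
    (Itg, 1), (Lam, 1), (Delta, 1), (Ant, 2), (B', 1), (Ant_inv, 1), (Ant_inv, 1), (B, 0), (Ant, 0),
    (Ant, 0), (Mu, 0), (Itg, 0)]"
    by (rule rw_sym[OF pairing_comult_eval], code_simp)
  also have "\<dots> \<approx>\<langle>?xs\<rangle> [(Lam, 0), (Delta, 0), (Lam, 1), (Delta, 1),
    (Ant, 2), (B', 1), (Ant_inv, 1), (Ant_inv, 1), (B, 0), (Ant, 0), (Ant, 0), (Mu, 0), (Itg, 0),
    (Ant, 1), (Mu, 1)]"
    by (rule rw[OF pairing_zigzag_left], code_simp)
  also have "\<dots> \<approx>\<langle>?xs\<rangle> ?q"
    by (rule rw[OF pairing_zigzag_left], code_simp)
  finally show ?thesis .
qed

end

section \<open>The Hopf algebra on a left dual\<close>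

locale dual_diagram = hopf_diagram +
  assumes dual: "dual_pairing C (ob Hc) (ob Dc) (ar (Ev Dc)) (ar (Coev Dc))"
begin

lemma dual_zigzag: "[(Coev Dc, 1), (Ev Dc, 0)] \<approx>\<langle>[Dc]\<rangle> []"
  and dual_zigzag_H: "[(Coev Dc, 0), (Ev Dc, 1)] \<approx>\<langle>[Hc]\<rangle> []"
  using dual_zigzags[OF dual den_gens(9,10)] by simp_all

lemma dual_mu_assoc:
  "[(Coev Dc, 2), (Delta, 2), (Ev Dc, 1), (Ev Dc, 0), (Coev Dc, 2), (Delta, 2), (Ev Dc, 1),
    (Ev Dc, 0)] \<approx>\<langle>[Dc, Dc, Dc]\<rangle> [(Coev Dc, 3), (Delta, 3), (Ev Dc, 2),
    (Ev Dc, 1), (Coev Dc, 2), (Delta, 2), (Ev Dc, 1), (Ev Dc, 0)]"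
  (is "?p \<approx>\<langle>?xs\<rangle> ?q")
proof -
  have "?p \<approx>\<langle>?xs\<rangle> [(Coev Dc, 3), (Delta, 3), (Ev Dc, 2), (Coev Dc, 2),
    (Ev Dc, 3), (Delta, 2), (Ev Dc, 1), (Ev Dc, 0)]"
    by (rule weq_isotopic; code_simp)
  also have "\<dots> \<approx>\<langle>?xs\<rangle> [(Coev Dc, 3), (Delta, 3), (Delta, 4),
    (Ev Dc, 2), (Ev Dc, 1), (Ev Dc, 0)]"
    by (rule rw[OF dual_zigzag_H], code_simp)
  also have "\<dots> \<approx>\<langle>?xs\<rangle> [(Coev Dc, 3), (Delta, 3), (Delta, 3),
    (Ev Dc, 2), (Ev Dc, 1), (Ev Dc, 0)]"
    by (rule rw_sym[OF delta_coassoc], code_simp)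
  also have "\<dots> \<approx>\<langle>?xs\<rangle> ?q"
    by (rule rw_sym[OF dual_zigzag_H], code_simp)
  finally show ?thesis .
qed

text \<open>The nested pairing reverses tensor factors, so a left law of the dual comes from the
  right law of the Hopf algebra. The same exchange occurs for the counit and for the
  antipode.\<close>

lemma dual_eta_left:
  "[(Coev Dc, 0), (Eps, 0), (Coev Dc, 2), (Delta, 2), (Ev Dc, 1), (Ev Dc, 0)]
    \<approx>\<langle>[Dc]\<rangle> []"
  (is "?p \<approx>\<langle>?xs\<rangle> ?q")
proof -
  have "?p \<approx>\<langle>?xs\<rangle> [(Coev Dc, 1), (Delta, 1), (Ev Dc, 0), (Coev Dc, 0),
    (Ev Dc, 1), (Eps, 0)]"
    by (rule weq_isotopic; code_simp)
  also have "\<dots> \<approx>\<langle>?xs\<rangle> [(Coev Dc, 1), (Delta, 1), (Eps, 2), (Ev Dc, 0)]"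
    by (rule rw[OF dual_zigzag_H], code_simp)
  also have "\<dots> \<approx>\<langle>?xs\<rangle> [(Coev Dc, 1), (Ev Dc, 0)]"
    by (rule rw[OF eps_right], code_simp)
  also have "\<dots> \<approx>\<langle>?xs\<rangle> ?q"
    by (rule rw[OF dual_zigzag], code_simp)
  finally show ?thesis .
qed

lemma dual_eta_right:
  "[(Coev Dc, 1), (Eps, 1), (Coev Dc, 2), (Delta, 2), (Ev Dc, 1), (Ev Dc, 0)]
    \<approx>\<langle>[Dc]\<rangle> []"
  (is "?p \<approx>\<langle>?xs\<rangle> ?q")
proof -
  have "?p \<approx>\<langle>?xs\<rangle> [(Coev Dc, 1), (Delta, 1), (Coev Dc, 1), (Ev Dc, 2),
    (Eps, 1), (Ev Dc, 0)]"
    by (rule weq_isotopic; code_simp)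
  also have "\<dots> \<approx>\<langle>?xs\<rangle> [(Coev Dc, 1), (Delta, 1), (Eps, 1), (Ev Dc, 0)]"
    by (rule rw[OF dual_zigzag_H], code_simp)
  also have "\<dots> \<approx>\<langle>?xs\<rangle> [(Coev Dc, 1), (Ev Dc, 0)]"
    by (rule rw[OF eps_left], code_simp)
  also have "\<dots> \<approx>\<langle>?xs\<rangle> ?q"
    by (rule rw[OF dual_zigzag], code_simp)
  finally show ?thesis .
qed

lemma dual_delta_coassoc:
  "[(Coev Dc, 1), (Coev Dc, 2), (Mu, 1), (Ev Dc, 0), (Coev Dc, 1), (Coev Dc, 2), (Mu, 1),
    (Ev Dc, 0)] \<approx>\<langle>[Dc]\<rangle> [(Coev Dc, 1), (Coev Dc, 2), (Mu, 1), (Ev Dc, 0),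
    (Coev Dc, 2), (Coev Dc, 3), (Mu, 2), (Ev Dc, 1)]"
  (is "?p \<approx>\<langle>?xs\<rangle> ?q")
proof -
  have "?p \<approx>\<langle>?xs\<rangle> [(Coev Dc, 1), (Coev Dc, 2), (Coev Dc, 3), (Mu, 2),
    (Coev Dc, 2), (Ev Dc, 3), (Mu, 1), (Ev Dc, 0)]"
    by (rule weq_isotopic; code_simp)
  also have "\<dots> \<approx>\<langle>?xs\<rangle> [(Coev Dc, 1), (Coev Dc, 2), (Coev Dc, 3),
    (Mu, 2), (Mu, 1), (Ev Dc, 0)]"
    by (rule rw[OF dual_zigzag_H], code_simp)
  also have "\<dots> \<approx>\<langle>?xs\<rangle> [(Coev Dc, 1), (Coev Dc, 2), (Mu, 1),
    (Coev Dc, 2), (Mu, 1), (Ev Dc, 0)]"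
    by (rule rw_sym[OF mu_assoc], code_simp)
  also have "\<dots> \<approx>\<langle>?xs\<rangle> ?q"
    by (rule rw_sym[OF dual_zigzag_H], code_simp)
  finally show ?thesis .
qed

lemma dual_eps_left:
  "[(Coev Dc, 1), (Coev Dc, 2), (Mu, 1), (Ev Dc, 0), (Eta, 1), (Ev Dc, 0)]
    \<approx>\<langle>[Dc]\<rangle> []"
  (is "?p \<approx>\<langle>?xs\<rangle> ?q")
proof -
  have "?p \<approx>\<langle>?xs\<rangle> [(Coev Dc, 1), (Eta, 2), (Coev Dc, 2), (Ev Dc, 3),
    (Mu, 1), (Ev Dc, 0)]"
    by (rule weq_isotopic; code_simp)
  also have "\<dots> \<approx>\<langle>?xs\<rangle> [(Coev Dc, 1), (Eta, 2), (Mu, 1), (Ev Dc, 0)]"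
    by (rule rw[OF dual_zigzag_H], code_simp)
  also have "\<dots> \<approx>\<langle>?xs\<rangle> [(Coev Dc, 1), (Ev Dc, 0)]"
    by (rule rw[OF eta_right], code_simp)
  also have "\<dots> \<approx>\<langle>?xs\<rangle> ?q"
    by (rule rw[OF dual_zigzag], code_simp)
  finally show ?thesis .
qed

lemma dual_eps_right:
  "[(Coev Dc, 1), (Coev Dc, 2), (Mu, 1), (Ev Dc, 0), (Eta, 2), (Ev Dc, 1)]
    \<approx>\<langle>[Dc]\<rangle> []"
  (is "?p \<approx>\<langle>?xs\<rangle> ?q")
proof -
  have "?p \<approx>\<langle>?xs\<rangle> [(Eta, 1), (Coev Dc, 1), (Ev Dc, 2), (Coev Dc, 2),
    (Mu, 1), (Ev Dc, 0)]"
    by (rule weq_isotopic; code_simp)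
  also have "\<dots> \<approx>\<langle>?xs\<rangle> [(Coev Dc, 1), (Eta, 1), (Mu, 1), (Ev Dc, 0)]"
    by (rule rw[OF dual_zigzag_H], code_simp)
  also have "\<dots> \<approx>\<langle>?xs\<rangle> [(Coev Dc, 1), (Ev Dc, 0)]"
    by (rule rw[OF eta_left], code_simp)
  also have "\<dots> \<approx>\<langle>?xs\<rangle> ?q"
    by (rule rw[OF dual_zigzag], code_simp)
  finally show ?thesis .
qed

lemma dual_delta_eta:
  "[(Coev Dc, 0), (Eps, 0), (Coev Dc, 1), (Coev Dc, 2), (Mu, 1), (Ev Dc, 0)]
    \<approx>\<langle>[]\<rangle> [(Coev Dc, 0), (Eps, 0), (Coev Dc, 1), (Eps, 1)]"
  (is "?p \<approx>\<langle>?xs\<rangle> ?q")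
proof -
  have "?p \<approx>\<langle>?xs\<rangle> [(Coev Dc, 0), (Coev Dc, 1), (Mu, 0), (Coev Dc, 0),
    (Ev Dc, 1), (Eps, 0)]"
    by (rule weq_isotopic; code_simp)
  also have "\<dots> \<approx>\<langle>?xs\<rangle> [(Coev Dc, 0), (Coev Dc, 1), (Mu, 0), (Eps, 0)]"
    by (rule rw[OF dual_zigzag_H], code_simp)
  also have "\<dots> \<approx>\<langle>?xs\<rangle> [(Coev Dc, 0), (Eps, 0), (Coev Dc, 0), (Eps, 0)]"
    by (rule rw[OF eps_mu], code_simp)
  also have "\<dots> \<approx>\<langle>?xs\<rangle> ?q"
    by (rule weq_isotopic; code_simp)
  finally show ?thesis .
qed

lemma dual_eps_mu:
  "[(Coev Dc, 2), (Delta, 2), (Ev Dc, 1), (Ev Dc, 0), (Eta, 1), (Ev Dc, 0)]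
    \<approx>\<langle>[Dc, Dc]\<rangle> [(Eta, 1), (Ev Dc, 0), (Eta, 1), (Ev Dc, 0)]"
  (is "?p \<approx>\<langle>?xs\<rangle> ?q")
proof -
  have "?p \<approx>\<langle>?xs\<rangle> [(Eta, 2), (Coev Dc, 2), (Ev Dc, 3), (Delta, 2),
    (Ev Dc, 1), (Ev Dc, 0)]"
    by (rule weq_isotopic; code_simp)
  also have "\<dots> \<approx>\<langle>?xs\<rangle> [(Eta, 2), (Delta, 2), (Ev Dc, 1), (Ev Dc, 0)]"
    by (rule rw[OF dual_zigzag_H], code_simp)
  also have "\<dots> \<approx>\<langle>?xs\<rangle> [(Eta, 2), (Ev Dc, 1), (Eta, 1), (Ev Dc, 0)]"
    by (rule rw[OF delta_eta], code_simp)
  also have "\<dots> \<approx>\<langle>?xs\<rangle> ?q"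
    by (rule weq_isotopic; code_simp)
  finally show ?thesis .
qed

lemma dual_eps_eta:
  "[(Coev Dc, 0), (Eps, 0), (Eta, 1), (Ev Dc, 0)] \<approx>\<langle>[]\<rangle> []"
  (is "?p \<approx>\<langle>?xs\<rangle> ?q")
proof -
  have "?p \<approx>\<langle>?xs\<rangle> [(Eta, 0), (Coev Dc, 0), (Ev Dc, 1), (Eps, 0)]"
    by (rule weq_isotopic; code_simp)
  also have "\<dots> \<approx>\<langle>?xs\<rangle> [(Eta, 0), (Eps, 0)]"
    by (rule rw[OF dual_zigzag_H], code_simp)
  also have "\<dots> \<approx>\<langle>?xs\<rangle> ?q"
    by (rule rw[OF eps_eta], code_simp)
  finally show ?thesis .
qed

lemma dual_ant_left:
  "[(Coev Dc, 1), (Coev Dc, 2), (Mu, 1), (Ev Dc, 0), (Coev Dc, 1), (Ant, 1), (Ev Dc, 0),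
    (Coev Dc, 2), (Delta, 2), (Ev Dc, 1), (Ev Dc, 0)] \<approx>\<langle>[Dc]\<rangle> [(Eta, 1),
    (Ev Dc, 0), (Coev Dc, 0), (Eps, 0)]"
  (is "?p \<approx>\<langle>?xs\<rangle> ?q")
proof -
  have "?p \<approx>\<langle>?xs\<rangle> [(Coev Dc, 1), (Delta, 1), (Coev Dc, 1), (Ev Dc, 2),
    (Coev Dc, 2), (Coev Dc, 2), (Mu, 1), (Ev Dc, 0), (Ant, 1), (Ev Dc, 0), (Ev Dc, 0)]"
    by (rule weq_isotopic; code_simp)
  also have "\<dots> \<approx>\<langle>?xs\<rangle> [(Coev Dc, 1), (Delta, 1), (Coev Dc, 2),
    (Ev Dc, 3), (Coev Dc, 2), (Mu, 1), (Ev Dc, 0), (Ant, 1), (Ev Dc, 0)]"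
    by (rule rw[OF dual_zigzag_H], code_simp)
  also have "\<dots> \<approx>\<langle>?xs\<rangle> [(Coev Dc, 1), (Delta, 1), (Ant, 2),
    (Coev Dc, 2), (Ev Dc, 3), (Mu, 1), (Ev Dc, 0)]"
    by (rule rw[OF dual_zigzag_H], code_simp)
  also have "\<dots> \<approx>\<langle>?xs\<rangle> [(Coev Dc, 1), (Delta, 1), (Ant, 2), (Mu, 1),
    (Ev Dc, 0)]"
    by (rule rw[OF dual_zigzag_H], code_simp)
  also have "\<dots> \<approx>\<langle>?xs\<rangle> ?q"
    by (rule rw[OF ant_right], code_simp)
  finally show ?thesis .
qed

lemma dual_ant_right:
  "[(Coev Dc, 1), (Coev Dc, 2), (Mu, 1), (Ev Dc, 0), (Coev Dc, 2), (Ant, 2), (Ev Dc, 1),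
    (Coev Dc, 2), (Delta, 2), (Ev Dc, 1), (Ev Dc, 0)] \<approx>\<langle>[Dc]\<rangle> [(Eta, 1),
    (Ev Dc, 0), (Coev Dc, 0), (Eps, 0)]"
  (is "?p \<approx>\<langle>?xs\<rangle> ?q")
proof -
  have "?p \<approx>\<langle>?xs\<rangle> [(Coev Dc, 1), (Delta, 1), (Coev Dc, 1), (Ev Dc, 2),
    (Coev Dc, 1), (Coev Dc, 2), (Mu, 1), (Ev Dc, 0), (Ant, 2), (Ev Dc, 1), (Ev Dc, 0)]"
    by (rule weq_isotopic; code_simp)
  also have "\<dots> \<approx>\<langle>?xs\<rangle> [(Coev Dc, 1), (Delta, 1), (Ant, 1),
    (Coev Dc, 1), (Ev Dc, 2), (Coev Dc, 2), (Mu, 1), (Ev Dc, 0), (Ev Dc, 0)]"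
    by (rule rw[OF dual_zigzag_H], code_simp)
  also have "\<dots> \<approx>\<langle>?xs\<rangle> [(Coev Dc, 1), (Delta, 1), (Ant, 1),
    (Coev Dc, 2), (Ev Dc, 3), (Mu, 1), (Ev Dc, 0)]"
    by (rule rw[OF dual_zigzag_H], code_simp)
  also have "\<dots> \<approx>\<langle>?xs\<rangle> [(Coev Dc, 1), (Delta, 1), (Ant, 1), (Mu, 1),
    (Ev Dc, 0)]"
    by (rule rw[OF dual_zigzag_H], code_simp)
  also have "\<dots> \<approx>\<langle>?xs\<rangle> ?q"
    by (rule rw[OF ant_left], code_simp)
  finally show ?thesis .
qed

text \<open>The evaluation of the first dual strand against the inner copy of \<open>Hc\<close> is a
  closed piece of diagram: it can be pulled through the outer copy of \<open>Hc\<close> and through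
  the second dual strand, which replaces one crossing by the other.\<close>

lemma dual_braid_eval:
  "[(Br (Leaf Dc) (Leaf Dc), 0), (Ev Dc, 1), (Ev Dc, 0)]
    \<approx>\<langle>[Dc, Dc, Hc, Hc]\<rangle> [(B, 2), (Ev Dc, 1), (Ev Dc, 0)]"
  (is "?p \<approx>\<langle>?xs\<rangle> ?q")
proof -
  have "?p \<approx>\<langle>?xs\<rangle> [(B, 2), (Br (Leaf Dc) (Leaf Dc), 0),
    (Br (Leaf Dc) (Leaf Hc), 1), (Ev Dc, 0), (Ev Dc, 0)]"
    by (rule rw[OF slide_under[of "Ev Dc" "Leaf Hc"]], code_simp)
  also have "\<dots> \<approx>\<langle>?xs\<rangle> ?q"
    by (rule rw_sym[OF slide_over[of "Ev Dc" "Leaf Dc"]], code_simp)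
  finally show ?thesis .
qed

text \<open>The crossing is its own adjoint under the nested pairing, with the same sign. Hence the
  dual is a Hopf algebra for the given braiding and not for its inverse.\<close>

lemma dual_braid:
  "[(Br (Leaf Dc) (Leaf Dc), 0)] \<approx>\<langle>[Dc, Dc]\<rangle> [(Coev Dc, 2), (Coev Dc, 3),
    (B, 2), (Ev Dc, 1), (Ev Dc, 0)]"
  (is "?p \<approx>\<langle>?xs\<rangle> ?q")
proof -
  have "?p \<approx>\<langle>?xs\<rangle> [(Br (Leaf Dc) (Leaf Dc), 0), (Coev Dc, 1), (Ev Dc, 0)]"
    by (rule rw_sym[OF dual_zigzag], code_simp)
  also have "\<dots> \<approx>\<langle>?xs\<rangle> [(Coev Dc, 2), (Coev Dc, 3),
    (Br (Leaf Dc) (Leaf Dc), 0), (Ev Dc, 1), (Ev Dc, 0)]"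
    by (rule rw_sym[OF dual_zigzag], code_simp)
  also have "\<dots> \<approx>\<langle>?xs\<rangle> ?q"
    by (rule rw[OF dual_braid_eval], code_simp)
  finally show ?thesis .
qed

lemma dual_bialg:
  "[(Coev Dc, 2), (Delta, 2), (Ev Dc, 1), (Ev Dc, 0), (Coev Dc, 1), (Coev Dc, 2), (Mu, 1),
    (Ev Dc, 0)] \<approx>\<langle>[Dc, Dc]\<rangle> [(Coev Dc, 1), (Coev Dc, 2), (Mu, 1),
    (Ev Dc, 0), (Coev Dc, 3), (Coev Dc, 4), (Mu, 3), (Ev Dc, 2), (Br (Leaf Dc) (Leaf Dc), 1),
    (Coev Dc, 2), (Delta, 2), (Ev Dc, 1), (Ev Dc, 0), (Coev Dc, 3), (Delta, 3), (Ev Dc, 2),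
    (Ev Dc, 1)]"
  (is "?p \<approx>\<langle>?xs\<rangle> ?q")
proof -
  have "?p \<approx>\<langle>?xs\<rangle> [(Coev Dc, 2), (Coev Dc, 3), (Mu, 2), (Coev Dc, 2),
    (Ev Dc, 3), (Delta, 2), (Ev Dc, 1), (Ev Dc, 0)]"
    by (rule weq_isotopic; code_simp)
  also have "\<dots> \<approx>\<langle>?xs\<rangle> [(Coev Dc, 2), (Coev Dc, 3), (Mu, 2),
    (Delta, 2), (Ev Dc, 1), (Ev Dc, 0)]"
    by (rule rw[OF dual_zigzag_H], code_simp)
  also have "\<dots> \<approx>\<langle>?xs\<rangle> [(Coev Dc, 2), (Delta, 2), (Coev Dc, 4),
    (Delta, 4), (B, 3), (Mu, 2), (Ev Dc, 1), (Mu, 1), (Ev Dc, 0)]"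
    by (rule rw[OF delta_mu], code_simp)
  \<comment> \<open>From here on zigzags are inserted between the layers of the compatibility law,
    until each layer is enclosed in its own adjoint; the crossing is then in the form of
    \<open>dual_braid\<close>.\<close>
  also have "\<dots> \<approx>\<langle>?xs\<rangle> [(Coev Dc, 2), (Delta, 2), (Coev Dc, 4), (B, 3),
    (Mu, 2), (Ev Dc, 1), (Coev Dc, 3), (Delta, 3), (Ev Dc, 2), (Mu, 1), (Ev Dc, 0)]"
    by (rule rw_sym[OF dual_zigzag_H], code_simp)
  also have "\<dots> \<approx>\<langle>?xs\<rangle> [(Coev Dc, 2), (Delta, 2), (Coev Dc, 4), (B, 3),
    (Mu, 2), (Ev Dc, 1), (Coev Dc, 2), (Mu, 1), (Ev Dc, 0), (Coev Dc, 2), (Delta, 2), (Ev Dc, 1),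
    (Ev Dc, 0)]"
    by (rule rw_sym[OF dual_zigzag_H], code_simp)
  also have "\<dots> \<approx>\<langle>?xs\<rangle> [(Coev Dc, 2), (Delta, 2), (Coev Dc, 3),
    (Mu, 2), (Ev Dc, 1), (Coev Dc, 3), (B, 2), (Ev Dc, 1), (Coev Dc, 2), (Mu, 1), (Ev Dc, 0),
    (Coev Dc, 2), (Delta, 2), (Ev Dc, 1), (Ev Dc, 0)]"
    by (rule rw_sym[OF dual_zigzag_H], code_simp)
  also have "\<dots> \<approx>\<langle>?xs\<rangle> [(Coev Dc, 2), (Delta, 2), (Coev Dc, 3),
    (Coev Dc, 3), (Mu, 2), (Ev Dc, 1), (Coev Dc, 3), (B, 2), (Ev Dc, 1), (Coev Dc, 2), (Mu, 1),
    (Ev Dc, 0), (Coev Dc, 2), (Delta, 2), (Ev Dc, 1), (Ev Dc, 0), (Ev Dc, 1)]"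
    by (rule rw_sym[OF dual_zigzag_H], code_simp)
  also have "\<dots> \<approx>\<langle>?xs\<rangle> [(Coev Dc, 2), (Coev Dc, 3), (Coev Dc, 4),
    (B, 3), (Coev Dc, 3), (Ev Dc, 4), (Mu, 2), (Ev Dc, 1), (Coev Dc, 2), (Mu, 1), (Ev Dc, 0),
    (Coev Dc, 4), (Coev Dc, 2), (Delta, 2), (Ev Dc, 1), (Ev Dc, 0), (Delta, 3), (Ev Dc, 2),
    (Ev Dc, 1)]"
    by (rule rw_sym[OF dual_zigzag_H], code_simp)
  also have "\<dots> \<approx>\<langle>?xs\<rangle> [(Coev Dc, 1), (Coev Dc, 2), (Mu, 1),
    (Ev Dc, 0), (Coev Dc, 3), (Coev Dc, 3), (Coev Dc, 4), (Mu, 3), (Ev Dc, 2), (Coev Dc, 3),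
    (Coev Dc, 4), (B, 3), (Ev Dc, 2), (Ev Dc, 1), (Coev Dc, 2), (Delta, 2), (Ev Dc, 1), (Ev Dc, 0),
    (Delta, 3), (Ev Dc, 2), (Ev Dc, 1)]"
    by (rule rw_sym[OF dual_zigzag_H], code_simp)
  also have "\<dots> \<approx>\<langle>?xs\<rangle> ?q"
    by (rule rw_sym[OF dual_braid], code_simp)
  finally show ?thesis .
qed

end

section \<open>Comparison of two left duals\<close>

locale dual_pair_diagram = dual_diagram +
  assumes dual': "dual_pairing C (ob Hc) (ob Ec) (ar (Ev Ec)) (ar (Coev Ec))"
begin

lemma dual_zigzag': "[(Coev Ec, 1), (Ev Ec, 0)] \<approx>\<langle>[Ec]\<rangle> []"
  and dual_zigzag_H': "[(Coev Ec, 0), (Ev Ec, 1)] \<approx>\<langle>[Hc]\<rangle> []"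
  using dual_zigzags[OF dual' den_gens(9,10)] by simp_all

text \<open>The layers \<open>(Coev Ec, 1), (Ev Dc, 0)\<close> are the canonical map from one dual
  to the other, which coevaluates with the new dual and evaluates with the old one. The lemmas below
  push it through every structure map.\<close>

lemma dual_change_inverse:
  "[(Coev Ec, 1), (Ev Dc, 0), (Coev Dc, 1), (Ev Ec, 0)] \<approx>\<langle>[Dc]\<rangle> []"
  (is "?p \<approx>\<langle>?xs\<rangle> ?q")
proof -
  have "?p \<approx>\<langle>?xs\<rangle> [(Coev Dc, 1), (Coev Ec, 1), (Ev Ec, 2), (Ev Dc, 0)]"
    by (rule weq_isotopic; code_simp)
  also have "\<dots> \<approx>\<langle>?xs\<rangle> [(Coev Dc, 1), (Ev Dc, 0)]"
    by (rule rw[OF dual_zigzag_H'], code_simp)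
  also have "\<dots> \<approx>\<langle>?xs\<rangle> ?q"
    by (rule rw[OF dual_zigzag], code_simp)
  finally show ?thesis .
qed

lemma dual_change_inverse':
  "[(Coev Dc, 1), (Ev Ec, 0), (Coev Ec, 1), (Ev Dc, 0)] \<approx>\<langle>[Ec]\<rangle> []"
  (is "?p \<approx>\<langle>?xs\<rangle> ?q")
proof -
  have "?p \<approx>\<langle>?xs\<rangle> [(Coev Ec, 1), (Coev Dc, 1), (Ev Dc, 2), (Ev Ec, 0)]"
    by (rule weq_isotopic; code_simp)
  also have "\<dots> \<approx>\<langle>?xs\<rangle> [(Coev Ec, 1), (Ev Ec, 0)]"
    by (rule rw[OF dual_zigzag_H], code_simp)
  also have "\<dots> \<approx>\<langle>?xs\<rangle> ?q"
    by (rule rw[OF dual_zigzag'], code_simp)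
  finally show ?thesis .
qed

lemma dual_change_mu:
  "[(Coev Dc, 2), (Delta, 2), (Ev Dc, 1), (Ev Dc, 0), (Coev Ec, 1), (Ev Dc, 0)]
    \<approx>\<langle>[Dc, Dc]\<rangle> [(Coev Ec, 1), (Ev Dc, 0), (Coev Ec, 2), (Ev Dc, 1),
    (Coev Ec, 2), (Delta, 2), (Ev Ec, 1), (Ev Ec, 0)]"
  (is "?p \<approx>\<langle>?xs\<rangle> ?q")
proof -
  have "?p \<approx>\<langle>?xs\<rangle> [(Coev Ec, 2), (Coev Dc, 2), (Ev Dc, 3), (Delta, 2),
    (Ev Dc, 1), (Ev Dc, 0)]"
    by (rule weq_isotopic; code_simp)
  also have "\<dots> \<approx>\<langle>?xs\<rangle> [(Coev Ec, 2), (Delta, 2), (Ev Dc, 1), (Ev Dc, 0)]"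
    by (rule rw[OF dual_zigzag_H], code_simp)
  also have "\<dots> \<approx>\<langle>?xs\<rangle> [(Coev Ec, 2), (Delta, 2), (Coev Ec, 2),
    (Ev Ec, 3), (Ev Dc, 1), (Ev Dc, 0)]"
    by (rule rw_sym[OF dual_zigzag_H'], code_simp)
  also have "\<dots> \<approx>\<langle>?xs\<rangle> ?q"
    by (rule rw_sym[OF dual_zigzag_H'], code_simp)
  finally show ?thesis .
qed

lemma dual_change_eta:
  "[(Coev Dc, 0), (Eps, 0), (Coev Ec, 1), (Ev Dc, 0)] \<approx>\<langle>[]\<rangle> [(Coev Ec, 0),
    (Eps, 0)]"
  (is "?p \<approx>\<langle>?xs\<rangle> ?q")
proof -
  have "?p \<approx>\<langle>?xs\<rangle> [(Coev Ec, 0), (Coev Dc, 0), (Ev Dc, 1), (Eps, 0)]"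
    by (rule weq_isotopic; code_simp)
  also have "\<dots> \<approx>\<langle>?xs\<rangle> ?q"
    by (rule rw[OF dual_zigzag_H], code_simp)
  finally show ?thesis .
qed

lemma dual_change_delta:
  "[(Coev Ec, 1), (Ev Dc, 0), (Coev Ec, 1), (Coev Ec, 2), (Mu, 1), (Ev Ec, 0)]
    \<approx>\<langle>[Dc]\<rangle> [(Coev Dc, 1), (Coev Dc, 2), (Mu, 1), (Ev Dc, 0), (Coev Ec, 1),
    (Ev Dc, 0), (Coev Ec, 2), (Ev Dc, 1)]"
  (is "?p \<approx>\<langle>?xs\<rangle> ?q")
proof -
  have "?p \<approx>\<langle>?xs\<rangle> [(Coev Ec, 1), (Coev Ec, 2), (Mu, 1), (Coev Ec, 1),
    (Ev Ec, 2), (Ev Dc, 0)]"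
    by (rule weq_isotopic; code_simp)
  also have "\<dots> \<approx>\<langle>?xs\<rangle> [(Coev Ec, 1), (Coev Ec, 2), (Mu, 1), (Ev Dc, 0)]"
    by (rule rw[OF dual_zigzag_H'], code_simp)
  also have "\<dots> \<approx>\<langle>?xs\<rangle> [(Coev Dc, 1), (Coev Ec, 2), (Mu, 1),
    (Ev Dc, 0), (Coev Ec, 2), (Ev Dc, 1)]"
    by (rule rw_sym[OF dual_zigzag_H], code_simp)
  also have "\<dots> \<approx>\<langle>?xs\<rangle> ?q"
    by (rule rw_sym[OF dual_zigzag_H], code_simp)
  finally show ?thesis .
qed

lemma dual_change_eps:
  "[(Coev Ec, 1), (Ev Dc, 0), (Eta, 1), (Ev Ec, 0)] \<approx>\<langle>[Dc]\<rangle> [(Eta, 1), (Ev Dc, 0)]"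
  (is "?p \<approx>\<langle>?xs\<rangle> ?q")
proof -
  have "?p \<approx>\<langle>?xs\<rangle> [(Eta, 1), (Coev Ec, 1), (Ev Ec, 2), (Ev Dc, 0)]"
    by (rule weq_isotopic; code_simp)
  also have "\<dots> \<approx>\<langle>?xs\<rangle> ?q"
    by (rule rw[OF dual_zigzag_H'], code_simp)
  finally show ?thesis .
qed

lemma dual_change_ant:
  "[(Coev Dc, 1), (Ant, 1), (Ev Dc, 0), (Coev Ec, 1), (Ev Dc, 0)]
    \<approx>\<langle>[Dc]\<rangle> [(Coev Ec, 1), (Ev Dc, 0), (Coev Ec, 1), (Ant, 1), (Ev Ec, 0)]"
  (is "?p \<approx>\<langle>?xs\<rangle> ?q")
proof -
  have "?p \<approx>\<langle>?xs\<rangle> [(Coev Ec, 1), (Coev Dc, 1), (Ev Dc, 2), (Ant, 1), (Ev Dc, 0)]"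
    by (rule weq_isotopic; code_simp)
  also have "\<dots> \<approx>\<langle>?xs\<rangle> [(Coev Ec, 1), (Ant, 1), (Ev Dc, 0)]"
    by (rule rw[OF dual_zigzag_H], code_simp)
  also have "\<dots> \<approx>\<langle>?xs\<rangle> ?q"
    by (rule rw_sym[OF dual_zigzag_H'], code_simp)
  finally show ?thesis .
qed

end


section \<open>From words back to algebras, coalgebras and Hopf algebras\<close>

context diagram
begin

lemma algebraI:
  assumes "den (Leaf c \<diamondop> Leaf c) (Leaf c) \<mu> m" "den Unit (Leaf c) \<eta> u"
    and "m @ m \<approx>\<langle>[c, c, c]\<rangle> shift 1 m @ m" "u @ m \<approx>\<langle>[c]\<rangle> []" "shift 1 u @ m \<approx>\<langle>[c]\<rangle> []"
  shows "algebra C (ob c) \<mu> \<eta>"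
proof -
  let ?X = "ob c" and ?c = "Leaf c"
  have "\<mu> \<cdot> (\<mu> \<otimes> Id C ?X) = \<mu> \<cdot> (Id C ?X \<otimes> \<mu>) \<cdot> assoc C ?X ?X ?X"
    by (rule eq_of_weq[OF assms(3), where t = "(?c \<diamondop> ?c) \<diamondop> ?c"])
      (rule den_intros assms(1,2) | (simp; fail))+
  moreover have "\<mu> \<cdot> (\<eta> \<otimes> Id C ?X) = lunit C ?X"
    by (rule eq_of_weq[OF assms(4), where t = "Unit \<diamondop> ?c"])
      (rule den_intros assms(1,2) | (simp; fail))+
  moreover have "\<mu> \<cdot> (Id C ?X \<otimes> \<eta>) = runit C ?X"
    by (rule eq_of_weq[OF assms(5), where t = "?c \<diamondop> Unit"])
      (rule den_intros assms(1,2) | (simp; fail))+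
  ultimately show ?thesis
    using assms(1,2) by (auto simp: algebra_def den_def)
qed

lemma coalgebraI:
  assumes "den (Leaf c) (Leaf c \<diamondop> Leaf c) \<Delta> d" "den (Leaf c) Unit \<epsilon> e"
    and "d @ d \<approx>\<langle>[c]\<rangle> d @ shift 1 d" "d @ e \<approx>\<langle>[c]\<rangle> []" "d @ shift 1 e \<approx>\<langle>[c]\<rangle> []"
  shows "coalgebra C (ob c) \<Delta> \<epsilon>"
proof -
  let ?X = "ob c" and ?c = "Leaf c"
  have "assoc C ?X ?X ?X \<cdot> (\<Delta> \<otimes> Id C ?X) \<cdot> \<Delta> = (Id C ?X \<otimes> \<Delta>) \<cdot> \<Delta>"
    by (rule eq_of_weq[OF assms(3), where t = ?c])
      (rule den_intros assms(1,2) | (simp; fail))+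
  moreover have "lunit C ?X \<cdot> (\<epsilon> \<otimes> Id C ?X) \<cdot> \<Delta> = Id C ?X"
    by (rule eq_of_weq[OF assms(4), where t = ?c])
      (rule den_intros assms(1,2) | (simp; fail))+
  moreover have "runit C ?X \<cdot> (Id C ?X \<otimes> \<epsilon>) \<cdot> \<Delta> = Id C ?X"
    by (rule eq_of_weq[OF assms(5), where t = ?c])
      (rule den_intros assms(1,2) | (simp; fail))+
  ultimately show ?thesis
    using assms(1,2) by (auto simp: coalgebra_def den_def)
qed

lemma F_algebraI:
  assumes "algebra C (ob c) \<mu> \<eta>" "coalgebra C (ob c) \<Delta> \<epsilon>"
    and "den (Leaf c \<diamondop> Leaf c) (Leaf c) \<mu> m" "den (Leaf c) (Leaf c \<diamondop> Leaf c) \<Delta> d"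
    and "d @ shift 1 m \<approx>\<langle>[c, c]\<rangle> m @ d" "m @ d \<approx>\<langle>[c, c]\<rangle> shift 1 d @ m"
  shows "F_algebra C (ob c) \<mu> \<eta> \<Delta> \<epsilon>"
proof -
  let ?X = "ob c" and ?c = "Leaf c"
  have "(Id C ?X \<otimes> \<mu>) \<cdot> assoc C ?X ?X ?X \<cdot> (\<Delta> \<otimes> Id C ?X) = \<Delta> \<cdot> \<mu>"
    by (rule eq_of_weq[OF assms(5), where t = "?c \<diamondop> ?c"])
      (rule den_intros assms(3,4) | (simp; fail))+
  moreover have "\<Delta> \<cdot> \<mu> = (\<mu> \<otimes> Id C ?X) \<cdot> cinv C (assoc C ?X ?X ?X) \<cdot> (Id C ?X \<otimes> \<Delta>)"
    by (rule eq_of_weq[OF assms(6), where t = "?c \<diamondop> ?c"])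
      (rule den_intros assms(3,4) | (simp; fail))+
  ultimately show ?thesis
    using assms(1,2) by (simp add: F_algebra_def)
qed

lemma hopf_algebraI:
  assumes "algebra C (ob c) \<mu> \<eta>" "coalgebra C (ob c) \<Delta> \<epsilon>"
    and dens: "den (Leaf c \<diamondop> Leaf c) (Leaf c) \<mu> m" "den Unit (Leaf c) \<eta> u"
      "den (Leaf c) (Leaf c \<diamondop> Leaf c) \<Delta> d" "den (Leaf c) Unit \<epsilon> e" "den (Leaf c) (Leaf c) S s"
    and "m @ d \<approx>\<langle>[c, c]\<rangle> d @ shift 2 d @ [(Br (Leaf c) (Leaf c), 1)] @ m @ shift 1 m"
      "u @ d \<approx>\<langle>[]\<rangle> u @ shift 1 u" "m @ e \<approx>\<langle>[c, c]\<rangle> e @ e" "u @ e \<approx>\<langle>[]\<rangle> []"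
      "d @ s @ m \<approx>\<langle>[c]\<rangle> e @ u" "d @ shift 1 s @ m \<approx>\<langle>[c]\<rangle> e @ u"
  shows "hopf_algebra C \<lparr>hobj = ob c, hmult = \<mu>, hunit = \<eta>, hcomult = \<Delta>, hcounit = \<epsilon>, hantipode = S\<rparr>"
proof -
  let ?X = "ob c" and ?c = "Leaf c"
  have "\<Delta> \<cdot> \<mu> = (\<mu> \<otimes> \<mu>) \<cdot> middle_braid C ?X \<cdot> (\<Delta> \<otimes> \<Delta>)"
    by (rule eq_of_weq[OF assms(8), where t = "?c \<diamondop> ?c"])
      (rule den_intros den_middle_braid dens | (simp add: eval_nat_numeral; fail))+
  moreover have "\<Delta> \<cdot> \<eta> = (\<eta> \<otimes> \<eta>) \<cdot> cinv C (lunit C \<one>)"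
    by (rule eq_of_weq[OF assms(9), where t = Unit])
      (rule den_intros dens | (simp; fail))+
  moreover have "\<epsilon> \<cdot> \<mu> = lunit C \<one> \<cdot> (\<epsilon> \<otimes> \<epsilon>)"
    by (rule eq_of_weq[OF assms(10), where t = "?c \<diamondop> ?c"])
      (rule den_intros dens | (simp; fail))+
  moreover have "\<epsilon> \<cdot> \<eta> = Id C \<one>"
    by (rule eq_of_weq[OF assms(11), where t = Unit])
      (rule den_intros dens | (simp; fail))+
  moreover have "\<mu> \<cdot> (S \<otimes> Id C ?X) \<cdot> \<Delta> = \<eta> \<cdot> \<epsilon>"
    by (rule eq_of_weq[OF assms(12), where t = ?c])
      (rule den_intros dens | (simp; fail))+
  moreover have "\<mu> \<cdot> (Id C ?X \<otimes> S) \<cdot> \<Delta> = \<eta> \<cdot> \<epsilon>"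
    by (rule eq_of_weq[OF assms(13), where t = ?c])
      (rule den_intros dens | (simp; fail))+
  ultimately show ?thesis
    using assms(1,2) dens(5) by (simp add: hopf_algebra_def den_def)
qed

end

context hopf_diagram
begin

abbreviation
  "H \<equiv> \<lparr>hobj = ob Hc, hmult = ar Mu, hunit = ar Eta, hcomult = ar Delta,
    hcounit = ar Eps, hantipode = ar Ant\<rparr>"

text \<open>The evaluation and coevaluation enter as arbitrary words \<open>e\<close> and
  \<open>k\<close>: single generators for an abstract dual, longer words for the concrete pairing of
  the Hopf algebra with itself.\<close>

lemma den_dual_hopf:
  assumes ev: "den (Leaf c \<diamondop> Leaf Hc) Unit ev e" and coev: "den Unit (Leaf Hc \<diamondop> Leaf c) coev k"
  defines "K \<equiv> dual_hopf C H (ob c) ev coev"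
  shows "den (Leaf c \<diamondop> Leaf c) (Leaf c) (hmult K) (shift 2 k @ [(Delta, 2)] @ shift 1 e @ e)"
    and "den Unit (Leaf c) (hunit K) (k @ [(Eps, 0)])"
    and "den (Leaf c) (Leaf c \<diamondop> Leaf c) (hcomult K) (shift 1 k @ shift 2 k @ [(Mu, 1)] @ e)"
    and "den (Leaf c) Unit (hcounit K) ([(Eta, 1)] @ e)"
    and "den (Leaf c) (Leaf c) (hantipode K) (shift 1 k @ [(Ant, 1)] @ e)"
proof -
  let ?c = "Leaf c" and ?h = "Leaf Hc"
  have ev2: "den ((?c \<diamondop> ?c) \<diamondop> (?h \<diamondop> ?h)) Unit (nested_ev C (ob Hc) (ob c) ev) (shift 1 e @ e)"
    and coev2: "den Unit ((?h \<diamondop> ?h) \<diamondop> (?c \<diamondop> ?c)) (nested_coev C (ob Hc) (ob c) coev) (k @ shift 1 k)"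
    using den_nested_ev[OF ev] den_nested_coev[OF coev] by simp_all
  have l: "den (Unit \<diamondop> Unit) Unit (lunit C \<one>) []"
    and l': "den Unit (Unit \<diamondop> Unit) (cinv C (lunit C \<one>)) []"
    by (rule den_lunit den_coherence; simp)+
  show "den (?c \<diamondop> ?c) ?c (hmult K) (shift 2 k @ [(Delta, 2)] @ shift 1 e @ e)"
    unfolding K_def dual_hopf_def Let_def hopf_data.simps
    by (rule den_cong, rule den_adjoint[OF den_gens(3) coev ev2]) (simp_all add: eval_nat_numeral)
  show "den Unit ?c (hunit K) (k @ [(Eps, 0)])"
    unfolding K_def dual_hopf_def Let_def hopf_data.simps
    by (rule den_cong, rule den_adjoint[OF den_gens(4) coev l]) (simp_all add: eval_nat_numeral)
  show "den ?c (?c \<diamondop> ?c) (hcomult K) (shift 1 k @ shift 2 k @ [(Mu, 1)] @ e)"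
    unfolding K_def dual_hopf_def Let_def hopf_data.simps
    by (rule den_cong, rule den_adjoint[OF den_gens(1) coev2 ev]) (simp_all add: eval_nat_numeral)
  show "den ?c Unit (hcounit K) ([(Eta, 1)] @ e)"
    unfolding K_def dual_hopf_def Let_def hopf_data.simps
    by (rule den_cong, rule den_adjoint[OF den_gens(2) l' ev]) (simp_all add: eval_nat_numeral)
  show "den ?c ?c (hantipode K) (shift 1 k @ [(Ant, 1)] @ e)"
    unfolding K_def dual_hopf_def Let_def hopf_data.simps
    by (rule den_cong, rule den_adjoint[OF den_gens(5) coev ev]) (simp_all add: eval_nat_numeral)
qed

end

lemma (in dual_diagram) hopf_algebra_dual_hopf:
  "hopf_algebra C (dual_hopf C H (ob Dc) (ar (Ev Dc)) (ar (Coev Dc)))"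
proof -
  let ?K = "dual_hopf C H (ob Dc) (ar (Ev Dc)) (ar (Coev Dc))"
  note D = den_dual_hopf[OF den_gens(9,10)[of Dc], simplified]
  have K: "?K = \<lparr>hobj = ob Dc, hmult = hmult ?K, hunit = hunit ?K, hcomult = hcomult ?K,
      hcounit = hcounit ?K, hantipode = hantipode ?K\<rparr>"
    by (simp add: dual_hopf_def Let_def)
  have "algebra C (ob Dc) (hmult ?K) (hunit ?K)"
    by (rule algebraI[OF D(1,2)]) (use dual_mu_assoc dual_eta_left dual_eta_right in \<open>simp_all add: eval_nat_numeral\<close>)
  moreover have "coalgebra C (ob Dc) (hcomult ?K) (hcounit ?K)"
    by (rule coalgebraI[OF D(3,4)]) (use dual_delta_coassoc dual_eps_left dual_eps_right in \<open>simp_all add: eval_nat_numeral\<close>)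
  ultimately show ?thesis
    by (subst K, intro hopf_algebraI[OF _ _ D])
      (use dual_bialg dual_delta_eta dual_eps_mu dual_eps_eta dual_ant_left dual_ant_right
        in \<open>simp_all add: eval_nat_numeral\<close>)
qed

lemma (in dual_pair_diagram) hopf_isomorphic_duals:
  "hopf_isomorphic C (dual_hopf C H (ob Dc) (ar (Ev Dc)) (ar (Coev Dc)))
     (dual_hopf C H (ob Ec) (ar (Ev Ec)) (ar (Coev Ec)))"
proof -
  let ?K = "dual_hopf C H (ob Dc) (ar (Ev Dc)) (ar (Coev Dc))"
    and ?L = "dual_hopf C H (ob Ec) (ar (Ev Ec)) (ar (Coev Ec))"
  note D = den_dual_hopf[OF den_gens(9,10)[of Dc], simplified]
    and E = den_dual_hopf[OF den_gens(9,10)[of Ec], simplified]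
  let ?D = "ob Dc" and ?E = "ob Ec" and ?X = "ob Hc"
  define \<theta> where "\<theta> = lunit C ?E \<cdot> (ar (Ev Dc) \<otimes> Id C ?E) \<cdot> cinv C (assoc C ?D ?X ?E)
    \<cdot> (Id C ?D \<otimes> ar (Coev Ec)) \<cdot> cinv C (runit C ?D)"
  define \<phi> where "\<phi> = lunit C ?D \<cdot> (ar (Ev Ec) \<otimes> Id C ?D) \<cdot> cinv C (assoc C ?E ?X ?D)
    \<cdot> (Id C ?E \<otimes> ar (Coev Dc)) \<cdot> cinv C (runit C ?E)"
  have \<theta>: "den (Leaf Dc) (Leaf Ec) \<theta> [(Coev Ec, 1), (Ev Dc, 0)]"
    unfolding \<theta>_def by (rule den_cong, (rule den_intros den_gens | (simp; fail))+)
  have \<phi>: "den (Leaf Ec) (Leaf Dc) \<phi> [(Coev Dc, 1), (Ev Ec, 0)]"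
    unfolding \<phi>_def by (rule den_cong, (rule den_intros den_gens | (simp; fail))+)
  have obs: "hobj ?K = ?D" "hobj ?L = ?E" by (simp_all add: dual_hopf_def Let_def)
  have \<theta>': "\<theta> \<in> hom C ?D ?E" and \<phi>': "\<phi> \<in> hom C ?E ?D"
    using \<theta> \<phi> by (auto simp: den_def)
  have "\<phi> \<cdot> \<theta> = Id C ?D"
    by (rule eq_of_weq[OF dual_change_inverse, where t = "Leaf Dc"])
      (rule den_intros \<theta> \<phi> | (simp; fail))+
  moreover have "\<theta> \<cdot> \<phi> = Id C ?E"
    by (rule eq_of_weq[OF dual_change_inverse', where t = "Leaf Ec"])
      (rule den_intros \<theta> \<phi> | (simp; fail))+
  ultimately have "is_iso C \<theta>"
    using \<theta>' \<phi>' unfolding is_iso_def inverse_arrows_def by (auto simp: hom_iff)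
  moreover have "\<theta> \<cdot> hmult ?K = hmult ?L \<cdot> (\<theta> \<otimes> \<theta>)"
    by (rule eq_of_weq[OF dual_change_mu, where t = "Leaf Dc \<diamondop> Leaf Dc"])
      (rule den_intros \<theta> D E | (simp add: eval_nat_numeral; fail))+
  moreover have "\<theta> \<cdot> hunit ?K = hunit ?L"
    by (rule eq_of_weq[OF dual_change_eta, where t = Unit])
      (rule den_intros \<theta> D E | (simp add: eval_nat_numeral; fail))+
  moreover have "hcomult ?L \<cdot> \<theta> = (\<theta> \<otimes> \<theta>) \<cdot> hcomult ?K"
    by (rule eq_of_weq[OF dual_change_delta, where t = "Leaf Dc"])
      (rule den_intros \<theta> D E | (simp add: eval_nat_numeral; fail))+
  moreover have "hcounit ?L \<cdot> \<theta> = hcounit ?K"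
    by (rule eq_of_weq[OF dual_change_eps, where t = "Leaf Dc"])
      (rule den_intros \<theta> D E | (simp add: eval_nat_numeral; fail))+
  moreover have "\<theta> \<cdot> hantipode ?K = hantipode ?L \<cdot> \<theta>"
    by (rule eq_of_weq[OF dual_change_ant, where t = "Leaf Dc"])
      (rule den_intros \<theta> D E | (simp add: eval_nat_numeral; fail))+
  ultimately show ?thesis
    unfolding hopf_isomorphic_def obs using \<theta>' by blast
qed

section \<open>The Frobenius structures and the second Hopf algebra as arrows\<close>

context integral_diagram
begin

definition "cup\<^sub>r = ar Itg \<cdot> ar Mu"
definition "g\<^sub>r = (Id C (ob Hc) \<otimes> ar Ant) \<cdot> ar Delta \<cdot> ar Lam"
definition "cup\<^sub>g = ar Itg \<cdot> ar Mu \<cdot> (ar Ant \<otimes> Id C (ob Hc))"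
definition "g\<^sub>g = ar Delta \<cdot> ar Lam"

abbreviation "\<Delta>\<^sub>r \<equiv> frobenius_comult C (ob Hc) (ar Mu) g\<^sub>r"
abbreviation "\<epsilon>\<^sub>r \<equiv> frobenius_counit C (ob Hc) (ar Eta) cup\<^sub>r"
abbreviation "\<mu>\<^sub>g \<equiv> frobenius_mult C (ob Hc) (ar Delta) cup\<^sub>g"
abbreviation "\<eta>\<^sub>g \<equiv> frobenius_unit C (ob Hc) (ar Eps) g\<^sub>g"

lemma den_frobenius:
  "den (Leaf Hc \<diamondop> Leaf Hc) Unit cup\<^sub>r [(Mu, 0), (Itg, 0)]"
  "den Unit (Leaf Hc \<diamondop> Leaf Hc) g\<^sub>r [(Lam, 0), (Delta, 0), (Ant, 1)]"
  "den (Leaf Hc \<diamondop> Leaf Hc) Unit cup\<^sub>g [(Ant, 0), (Mu, 0), (Itg, 0)]"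
  "den Unit (Leaf Hc \<diamondop> Leaf Hc) g\<^sub>g [(Lam, 0), (Delta, 0)]"
  unfolding cup\<^sub>r_def g\<^sub>r_def cup\<^sub>g_def g\<^sub>g_def
  by (rule den_cong, (rule den_intros den_gens | (simp; fail))+)+

lemma den_associated:
  "den (Leaf Hc) (Leaf Hc \<diamondop> Leaf Hc) \<Delta>\<^sub>r [(Lam, 0), (Delta, 0), (Ant, 1), (Mu, 1)]"
  "den (Leaf Hc) Unit \<epsilon>\<^sub>r [(Eta, 1), (Mu, 0), (Itg, 0)]"
  "den (Leaf Hc \<diamondop> Leaf Hc) (Leaf Hc) \<mu>\<^sub>g [(Delta, 0), (Ant, 1), (Mu, 1), (Itg, 1)]"
  "den Unit (Leaf Hc) \<eta>\<^sub>g [(Lam, 0), (Delta, 0), (Eps, 1)]"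
  unfolding frobenius_comult_def frobenius_counit_def frobenius_mult_def frobenius_unit_def
  by (rule den_cong, (rule den_intros den_gens den_frobenius | (simp; fail))+)+

lemma frobenius_algebra: "frobenius_algebra C (ob Hc) (ar Mu) (ar Eta) cup\<^sub>r g\<^sub>r"
proof -
  let ?X = "ob Hc" and ?h = "Leaf Hc"
  have "[(Mu, 0), (Mu, 0), (Itg, 0)] \<approx>\<langle>[Hc, Hc, Hc]\<rangle> [(Mu, 1), (Mu, 0), (Itg, 0)]"
    by (rule rw[OF mu_assoc], code_simp)
  from eq_of_weq[OF this, where t = "(?h \<diamondop> ?h) \<diamondop> ?h"]
  have "cup\<^sub>r \<cdot> (ar Mu \<otimes> Id C ?X) = cup\<^sub>r \<cdot> (Id C ?X \<otimes> ar Mu) \<cdot> assoc C ?X ?X ?X"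
    by this ((rule den_intros den_gens den_frobenius | (simp; fail))+)
  moreover have "dual_pairing C ?X ?X cup\<^sub>r g\<^sub>r"
    by (rule dual_pairingI[OF den_frobenius(1,2)])
      (use metric_zigzag_left metric_zigzag_right in \<open>simp_all add: eval_nat_numeral\<close>)
  ultimately show ?thesis
    using hopf_axioms by (simp add: frobenius_algebra_def algebra_def)
qed

lemma frobenius_coalgebra: "frobenius_coalgebra C (ob Hc) (ar Delta) (ar Eps) cup\<^sub>g g\<^sub>g"
proof -
  let ?X = "ob Hc" and ?h = "Leaf Hc"
  have "[(Lam, 0), (Delta, 0), (Delta, 0)] \<approx>\<langle>[]\<rangle> [(Lam, 0), (Delta, 0), (Delta, 1)]"
    by (rule rw[OF delta_coassoc], code_simp)
  from eq_of_weq[OF this, where t = Unit]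
  have "assoc C ?X ?X ?X \<cdot> (ar Delta \<otimes> Id C ?X) \<cdot> g\<^sub>g = (Id C ?X \<otimes> ar Delta) \<cdot> g\<^sub>g"
    by this ((rule den_intros den_gens den_frobenius | (simp; fail))+)
  moreover have "dual_pairing C ?X ?X cup\<^sub>g g\<^sub>g"
    by (rule dual_pairingI[OF den_frobenius(3,4)])
      (use cometric_zigzag_left metric_zigzag_right in \<open>simp_all add: eval_nat_numeral\<close>)
  ultimately show ?thesis
    using hopf_axioms by (simp add: frobenius_coalgebra_def coalgebra_def)
qed

lemma antipode_eq:
  "ar Ant = lunit C (ob Hc) \<cdot> (cup\<^sub>g \<otimes> Id C (ob Hc)) \<cdot> cinv C (assoc C (ob Hc) (ob Hc) (ob Hc))
    \<cdot> (Id C (ob Hc) \<otimes> g\<^sub>r) \<cdot> cinv C (runit C (ob Hc))"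
proof -
  have "[(Ant, 0)] \<approx>\<langle>[Hc]\<rangle> [(Lam, 1), (Delta, 1), (Ant, 2), (Ant, 0), (Mu, 0), (Itg, 0)]"
    by (rule rw_sym[OF metric_zigzag_left], code_simp)
  from eq_of_weq[OF this, where t = "Leaf Hc"] show ?thesis
    by this ((rule den_intros den_gens den_frobenius | (simp add: eval_nat_numeral; fail))+)
qed

lemma F_algebras:
  "F_algebra C (ob Hc) (ar Mu) (ar Eta) \<Delta>\<^sub>r \<epsilon>\<^sub>r"
  "F_algebra C (ob Hc) \<mu>\<^sub>g \<eta>\<^sub>g (ar Delta) (ar Eps)"
proof -
  have "coalgebra C (ob Hc) \<Delta>\<^sub>r \<epsilon>\<^sub>r"
    by (rule coalgebraI[OF den_associated(1,2)])
      (use frobenius_comult_coassoc frobenius_counit_left frobenius_counit_right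
        in \<open>simp_all add: eval_nat_numeral\<close>)
  then show "F_algebra C (ob Hc) (ar Mu) (ar Eta) \<Delta>\<^sub>r \<epsilon>\<^sub>r"
    by (intro F_algebraI[OF _ _ den_gens(1) den_associated(1)])
      (use hopf_axioms frobenius_comult_mu mu_frobenius_comult
        in \<open>simp_all add: eval_nat_numeral algebra_def\<close>)
  have "algebra C (ob Hc) \<mu>\<^sub>g \<eta>\<^sub>g"
    by (rule algebraI[OF den_associated(3,4)])
      (use frobenius_mult_assoc frobenius_unit_left frobenius_unit_right
        in \<open>simp_all add: eval_nat_numeral\<close>)
  then show "F_algebra C (ob Hc) \<mu>\<^sub>g \<eta>\<^sub>g (ar Delta) (ar Eps)"
    by (intro F_algebraI[OF _ _ den_associated(3) den_gens(3)])
      (use hopf_axioms delta_frobenius_mult frobenius_mult_delta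
        in \<open>simp_all add: eval_nat_numeral coalgebra_def\<close>)
qed

text \<open>
  The pairing is \<open>a \<otimes> h \<mapsto> I(S\<^sup>2(h) a)\<close>. The Frobenius form \<open>cup\<^sub>r\<close> itself only identifies \<open>\<Delta>\<^sub>r\<close> with the
  dual of the multiplication: in general it does not turn \<open>\<mu>\<^sub>g \<cdot> \<Psi>\<close> into the dual
  of \<open>\<Delta>\<^sub>g\<close>. The square of the antipode cancels the twist caused by the braiding.
\<close>

definition "pair = ar Itg \<cdot> ar Mu \<cdot> (ar Ant \<otimes> Id C (ob Hc)) \<cdot> (ar Ant \<otimes> Id C (ob Hc))
  \<cdot> braid C (ob Hc) (ob Hc)"
definition "copair = (ar Ant_inv \<otimes> Id C (ob Hc)) \<cdot> (ar Ant_inv \<otimes> Id C (ob Hc))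
  \<cdot> cinv C (braid C (ob Hc) (ob Hc)) \<cdot> g\<^sub>r"

lemma den_pairing:
  "den (Leaf Hc \<diamondop> Leaf Hc) Unit pair [(B, 0), (Ant, 0), (Ant, 0), (Mu, 0), (Itg, 0)]"
  "den Unit (Leaf Hc \<diamondop> Leaf Hc) copair
    [(Lam, 0), (Delta, 0), (Ant, 1), (B', 0), (Ant_inv, 0), (Ant_inv, 0)]"
  unfolding pair_def copair_def
  by (rule den_cong, (rule den_intros den_braid_inv den_gens den_frobenius | (simp; fail))+)+

lemma dual_pairing_pair: "dual_pairing C (ob Hc) (ob Hc) pair copair"
  by (rule dual_pairingI[OF den_pairing])
    (use pairing_zigzag_left pairing_zigzag_right in \<open>simp_all add: eval_nat_numeral\<close>)

text \<open>The second Hopf algebra is literally the dual of the first one along this pairing.\<close>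

lemma dual_hopf_pair:
  "\<lparr>hobj = ob Hc, hmult = \<mu>\<^sub>g \<cdot> braid C (ob Hc) (ob Hc), hunit = \<eta>\<^sub>g, hcomult = \<Delta>\<^sub>r, hcounit = \<epsilon>\<^sub>r,
    hantipode = hantipode (dual_hopf C H (ob Hc) pair copair)\<rparr> = dual_hopf C H (ob Hc) pair copair"
proof -
  let ?h = "Leaf Hc" and ?K = "dual_hopf C H (ob Hc) pair copair"
  note D = den_dual_hopf[OF den_pairing]
  have "hmult ?K = \<mu>\<^sub>g \<cdot> braid C (ob Hc) (ob Hc)"
    by (rule eq_of_weq[OF pairing_mult, where t = "?h \<diamondop> ?h"])
      (rule den_intros D den_associated | (simp add: eval_nat_numeral; fail))+
  moreover have "hunit ?K = \<eta>\<^sub>g"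
    by (rule eq_of_weq[OF pairing_unit, where t = Unit])
      (rule D den_associated | (simp add: eval_nat_numeral; fail))+
  moreover have "hcomult ?K = \<Delta>\<^sub>r"
    by (rule eq_of_weq[OF pairing_comult, where t = ?h])
      (rule D den_associated | (simp add: eval_nat_numeral; fail))+
  moreover have "hcounit ?K = \<epsilon>\<^sub>r"
    by (rule eq_of_weq[OF pairing_counit, where t = ?h])
      (rule D den_associated | (simp add: eval_nat_numeral; fail))+
  moreover have "hobj ?K = ob Hc" by (simp add: dual_hopf_def Let_def)
  ultimately show ?thesis by (intro hopf_data.equality) simp_all
qed

end


section \<open>Interpretation of the generators\<close>

context colored
begin

fun model :: "('o, 'a) hopf_data \<Rightarrow> 'a \<Rightarrow> 'a \<Rightarrow> 'a \<Rightarrow> (color \<Rightarrow> 'a) \<Rightarrow> (color \<Rightarrow> 'a) \<Rightarrow> gen \<Rightarrow> 'a" where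
  "model H s l i ev coev Mu = hmult H"
| "model H s l i ev coev Eta = hunit H"
| "model H s l i ev coev Delta = hcomult H"
| "model H s l i ev coev Eps = hcounit H"
| "model H s l i ev coev Ant = hantipode H"
| "model H s l i ev coev Ant_inv = s"
| "model H s l i ev coev Lam = l"
| "model H s l i ev coev Itg = i"
| "model H s l i ev coev (Br t u) = braid C (tob t) (tob u)"
| "model H s l i ev coev (Br_inv t u) = cinv C (braid C (tob t) (tob u))"
| "model H s l i ev coev (Ev c) = ev c"
| "model H s l i ev coev (Coev c) = coev c"

lemma hopf_diagram_model:
  assumes H: "hopf_algebra C H" "hobj H = ob Hc"
    and "s \<in> hom C (ob Hc) (ob Hc)" "l \<in> hom C \<one> (ob Hc)" "i \<in> hom C (ob Hc) \<one>"
    and "\<And>c. ev c \<in> hom C (ob c \<boxtimes> ob Hc) \<one>" "\<And>c. coev c \<in> hom C \<one> (ob Hc \<boxtimes> ob c)"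
  shows "hopf_diagram C ob (model H s l i ev coev)"
proof (intro hopf_diagram.intro diagram.intro colored_axioms diagram_axioms.intro hopf_diagram_axioms.intro)
  fix g
  show "model H s l i ev coev g \<in> hom C (tob (src g)) (tob (tgt g))"
  proof (cases g)
    case (Br_inv t u)
    have "braid C (tob t) (tob u) \<in> hom C (tob t \<boxtimes> tob u) (tob u \<boxtimes> tob t)"
      by (simp add: braid_hom)
    then show ?thesis using Br_inv braid_iso[of "tob t" "tob u"] by (simp add: hom_iff)
  qed (use assms in \<open>auto simp: hopf_algebra_def Let_def algebra_def coalgebra_def braid_hom\<close>)
next
  show "hopf_algebra C \<lparr>hobj = ob Hc, hmult = model H s l i ev coev Mu, hunit = model H s l i ev coev Eta,
      hcomult = model H s l i ev coev Delta, hcounit = model H s l i ev coev Eps,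
      hantipode = model H s l i ev coev Ant\<rparr>"
    using H by (cases H) simp
qed simp_all

end

lemma hopf_algebra_homs:
  assumes "hopf_algebra C H"
  shows "hobj H \<in> Obj C" "hantipode H \<in> hom C (hobj H) (hobj H)"
    "hunit H \<in> hom C (unit_obj C) (hobj H)" "hcounit H \<in> hom C (hobj H) (unit_obj C)"
  using assms by (auto simp: hopf_algebra_def Let_def algebra_def coalgebra_def)

lemma dual_pairing_hom:
  assumes "dual_pairing C X D ev coev"
  shows "D \<in> Obj C" "ev \<in> hom C (tensor_obj C D X) (unit_obj C)" "coev \<in> hom C (unit_obj C) (tensor_obj C X D)"
  using assms by (auto simp: dual_pairing_def)

text \<open>
  The generators for the inverse antipode and the integrals do not occur in the statements about
  duals; they are interpreted arbitrarily, as is the pairing with the colour \<open>Hc\<close>.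
\<close>

lemma hopf_algebra_dual:
  fixes C :: "('o, 'a, 'x) braided_data_scheme" (structure)
  assumes C: "braided_monoidal_category C" and H: "hopf_algebra C H"
    and D: "dual_pairing C (hobj H) D ev coev" and E: "dual_pairing C (hobj H) E ev' coev'"
  shows "hopf_algebra C (dual_hopf C H D ev coev)"
    and "hopf_isomorphic C (dual_hopf C H D ev coev) (dual_hopf C H E ev' coev')"
proof -
  define ob where "ob c = (case c of Hc \<Rightarrow> hobj H | Dc \<Rightarrow> D | Ec \<Rightarrow> E)" for c
  note H' = hopf_algebra_homs[OF H] and D' = dual_pairing_hom[OF D] and E' = dual_pairing_hom[OF E]
  interpret colored C ob
    using C H' D' E' by (intro colored.intro colored_axioms.intro) (simp_all add: ob_def split: color.split)
  let ?unit = "runit C \<one> \<cdot> (hcounit H \<otimes> hcounit H)" and ?counit = "(hunit H \<otimes> hunit H) \<cdot> cinv C (runit C \<one>)"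
  define evs where "evs c = (case c of Hc \<Rightarrow> ?unit | Dc \<Rightarrow> ev | Ec \<Rightarrow> ev')" for c
  define coevs where "coevs c = (case c of Hc \<Rightarrow> ?counit | Dc \<Rightarrow> coev | Ec \<Rightarrow> coev')" for c
  let ?ar = "model H (hantipode H) (hunit H) (hcounit H) evs coevs"
  interpret hopf_diagram C ob ?ar
  proof (rule hopf_diagram_model[OF H])
    show "evs c \<in> hom C (ob c \<boxtimes> ob Hc) \<one>" "coevs c \<in> hom C \<one> (ob Hc \<boxtimes> ob c)" for c
      using H' D' E' by (cases c; simp add: evs_def coevs_def ob_def hom_iff)+
  qed (use H' in \<open>simp_all add: ob_def\<close>)
  interpret dual_pair_diagram C ob ?ar
    using D E by unfold_locales (simp_all add: ob_def evs_def coevs_def)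
  have H_eq: "\<lparr>hobj = ob Hc, hmult = ?ar Mu, hunit = ?ar Eta, hcomult = ?ar Delta, hcounit = ?ar Eps,
      hantipode = ?ar Ant\<rparr> = H"
    by (cases H) (simp add: ob_def)
  show "hopf_algebra C (dual_hopf C H D ev coev)"
    using hopf_algebra_dual_hopf unfolding H_eq by (simp add: ob_def evs_def coevs_def)
  show "hopf_isomorphic C (dual_hopf C H D ev coev) (dual_hopf C H E ev' coev')"
    using hopf_isomorphic_duals unfolding H_eq by (simp add: ob_def evs_def coevs_def)
qed

theorem corollary4p3:
  fixes C :: "('o, 'a, 'x) braided_data_scheme" (structure)
    and H :: "('o, 'a) hopf_data"
    and \<Lambda> I :: 'a
  assumes "braided_monoidal_category C"
    and "hopf_algebra C H"
    and "is_iso C (hantipode H)"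
    and "left_integral C H \<Lambda>"
    and "right_integral C H I"
    and "I \<cdot> \<Lambda> = Id C \<one>"
  shows "\<exists>cup\<^sub>r g\<^sub>r cup\<^sub>g g\<^sub>g.
    let X = hobj H; \<mu>\<^sub>r = hmult H; \<eta>\<^sub>r = hunit H; \<Delta>\<^sub>g = hcomult H; \<epsilon>\<^sub>g = hcounit H;
        \<Delta>\<^sub>r = frobenius_comult C X \<mu>\<^sub>r g\<^sub>r; \<epsilon>\<^sub>r = frobenius_counit C X \<eta>\<^sub>r cup\<^sub>r;
        \<mu>\<^sub>g = frobenius_mult C X \<Delta>\<^sub>g cup\<^sub>g; \<eta>\<^sub>g = frobenius_unit C X \<epsilon>\<^sub>g g\<^sub>g
    in
      frobenius_algebra C X \<mu>\<^sub>r \<eta>\<^sub>r cup\<^sub>r g\<^sub>r \<and>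
      frobenius_coalgebra C X \<Delta>\<^sub>g \<epsilon>\<^sub>g cup\<^sub>g g\<^sub>g \<and>
      hantipode H = lunit C X \<cdot> (cup\<^sub>g \<otimes> Id C X) \<cdot> cinv C (assoc C X X X) \<cdot> (Id C X \<otimes> g\<^sub>r)
        \<cdot> cinv C (runit C X) \<and>
      F_algebra C X \<mu>\<^sub>r \<eta>\<^sub>r \<Delta>\<^sub>r \<epsilon>\<^sub>r \<and>
      F_algebra C X \<mu>\<^sub>g \<eta>\<^sub>g \<Delta>\<^sub>g \<epsilon>\<^sub>g \<and>
      hopf_algebra C H \<and>
      (\<exists>S'. let K = \<lparr> hobj = X, hmult = \<mu>\<^sub>g \<cdot> braid C X X, hunit = \<eta>\<^sub>g, hcomult = \<Delta>\<^sub>r,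
                      hcounit = \<epsilon>\<^sub>r, hantipode = S' \<rparr>
            in hopf_algebra C K \<and>
               (\<forall>D ev coev. dual_pairing C X D ev coev \<longrightarrow>
                  hopf_isomorphic C K (dual_hopf C H D ev coev)))"
proof -
  \<comment> \<open>The calculus of integrals runs on strands of colour \<open>Hc\<close>, so one
    object serves for all colours. Duals are treated by \<open>hopf_algebra_dual\<close>, which
    interprets the colours anew.\<close>
  define ob where "ob c = hobj H" for c :: color
  note H' = hopf_algebra_homs[OF assms(2)]
  interpret colored C ob
    using assms(1) H' by (intro colored.intro colored_axioms.intro) (simp_all add: ob_def)
  \<comment> \<open>Arrows of the right type, so that every generator has a meaning; they need not
    form a dual pairing.\<close>
  define ev where "ev = (\<lambda>c :: color. runit C \<one> \<cdot> (hcounit H \<otimes> hcounit H))"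
  define coev where "coev = (\<lambda>c :: color. (hunit H \<otimes> hunit H) \<cdot> cinv C (runit C \<one>))"
  let ?ar = "model H (cinv C (hantipode H)) \<Lambda> I ev coev"
  have homs: "\<Lambda> \<in> hom C \<one> (hobj H)" "I \<in> hom C (hobj H) \<one>"
    using assms(4,5) by (auto simp: left_integral_def right_integral_def)
  interpret hopf_diagram C ob ?ar
    by (rule hopf_diagram_model[OF assms(2)])
      (use H' homs assms(3) in \<open>simp_all add: ob_def ev_def coev_def hom_iff\<close>)
  have H_eq: "\<lparr>hobj = ob Hc, hmult = ?ar Mu, hunit = ?ar Eta, hcomult = ?ar Delta, hcounit = ?ar Eps,
      hantipode = ?ar Ant\<rparr> = H"
    by (cases H) (simp add: ob_def)
  interpret integral_diagram C ob ?ar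
    by unfold_locales (unfold H_eq, use assms in simp_all)
  let ?K = "dual_hopf C H (hobj H) pair copair"
  have obH: "ob Hc = hobj H" by (simp add: ob_def)
  note P = dual_pairing_pair[unfolded obH]
  \<comment> \<open>The calculus is applied a second time, to a model in which \<open>Dc\<close>
    denotes the object of \<open>H\<close> itself, with the arrows \<open>pair\<close> and
    \<open>copair\<close> as evaluation and coevaluation.\<close>
  have "hopf_algebra C ?K"
    using hopf_algebra_dual(1)[OF assms(1,2) P P] .
  moreover have "hopf_isomorphic C ?K (dual_hopf C H D ev coev)"
    if "dual_pairing C (hobj H) D ev coev" for D ev coev
    using hopf_algebra_dual(2)[OF assms(1,2) P that] .
  ultimately have "\<exists>S'. let K = \<lparr>hobj = hobj H, hmult = \<mu>\<^sub>g \<cdot> braid C (hobj H) (hobj H), hunit = \<eta>\<^sub>g,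
      hcomult = \<Delta>\<^sub>r, hcounit = \<epsilon>\<^sub>r, hantipode = S'\<rparr> in hopf_algebra C K \<and>
        (\<forall>D ev coev. dual_pairing C (hobj H) D ev coev \<longrightarrow> hopf_isomorphic C K (dual_hopf C H D ev coev))"
    \<comment> \<open>The witness is the antipode of the dual along \<open>pair\<close>; with it the
      record in the claim is that dual.\<close>
    using dual_hopf_pair unfolding H_eq by (intro exI[of _ "hantipode ?K"]) (simp add: obH Let_def)
  then show ?thesis
    using frobenius_algebra frobenius_coalgebra antipode_eq F_algebras assms(2)
    by (intro exI[of _ cup\<^sub>r] exI[of _ g\<^sub>r] exI[of _ cup\<^sub>g] exI[of _ g\<^sub>g]) (simp add: obH Let_def)
qed

end
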